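(* Let $K, L$ be number fields (subfields of $\mathbb{C}$) and let $\phi: K\to L$ be a $\mathbb{Q}$-linear isometry from $(K,\mathrm{tr}_{K/\mathbb{Q}})$ onto $(L,\mathrm{tr}_{L/\mathbb{Q}})$ such that $\phi(O_K)=O_L$. Let $E=KL$, and let $c := \langle \iota_K, \iota_L\circ\phi\rangle_{\mathrm{tr}_{K/\mathbb{Q}}}\in E$. Write $d_K=\mathrm{disc}(K)=d_s d_f$, where $d_f$ is the product of the primes $p$ with $v_p(d_K)=1$. Then $d_s c$ is an algebraic integer. More generally, if $K$ has no wild ramification, then $\mathrm{rad}(d_s)\,c$ is an algebraic integer. In particular, if $K$ has squarefree discriminant then $c$ is an algebraic integer.
   Context: $\mathrm{tr}_{K/\mathbb{Q}}$ denotes the bilinear form $(x,y)\mapsto\mathrm{Tr}_{K/\mathbb{Q}}(xy)$ on $K$. $\iota_K:K\to E$, $\iota_L:L\to E$ are inclusions. For a $\mathbb{Q}$-basis $\alpha_1,\dots,\alpha_n$ of $K$ with trace-dual basis $\alpha_i^*$ ($\mathrm{Tr}_{K/\mathbb{Q}}(\alpha_i^*\alpha_j)=\delta_{ij}$), $\langle \iota_K,\iota_L\circ\phi\rangle_{\mathrm{tr}_{K/\mathbb{Q}}}=\sum_i\alpha_i^*\phi(\alpha_i)$, independent of the basis. $\mathrm{rad}(m)$ is the product of the distinct primes dividing $m$. *)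

theory Defs
  imports
    Complex_Main
    "HOL-Computational_Algebra.Computational_Algebra"
    "HOL-Algebra.Generated_Fields"
    "HOL-Algebra.Ideal_Product"
    "HOL-Algebra.Divisibility"
    "Jordan_Normal_Form.Determinant"
begin

definition complex_ring :: "complex ring" where
  "complex_ring = \<lparr>carrier = UNIV, mult = (*), one = 1, zero = 0, add = (+)\<rparr>"

interpretation rat_vs: Vector_Spaces.vector_space "\<lambda>(q::rat) (z::complex). of_rat q * z"
  by unfold_locales (simp_all add: algebra_simps of_rat_add of_rat_mult)

interpretation int_mod: Modules.module "\<lambda>(k::int) (z::complex). of_int k * z"
  by unfold_locales (simp_all add: algebra_simps)

definition rat_basis :: "complex set \<Rightarrow> complex set \<Rightarrow> bool" where
  "rat_basis K B \<longleftrightarrow> rat_vs.independent B \<and> rat_vs.span B = K"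

definition number_field :: "complex set \<Rightarrow> bool" where
  "number_field K \<longleftrightarrow> subfield K complex_ring \<and> (\<exists>B. finite B \<and> rat_basis K B)"

definition compositum :: "complex set \<Rightarrow> complex set \<Rightarrow> complex set" where
  "compositum K L = generate_field complex_ring (K \<union> L)"

definition some_rat_basis :: "complex set \<Rightarrow> complex set" where
  "some_rat_basis K = (SOME B. rat_basis K B)"

text \<open>The trace of an element is the trace of the \<open>\<rat>\<close>-linear multiplication map
  \<open>y \<mapsto> x * y\<close> of \<open>K\<close>: the sum of the diagonal entries of its matrix in a basis, the
  choice of which does not matter.\<close>

definition field_trace :: "complex set \<Rightarrow> complex \<Rightarrow> rat" where
  "field_trace K x =
     (let B = some_rat_basis K in \<Sum>b\<in>B. rat_vs.representation B (x * b) b)"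

definition trace_dual :: "complex set \<Rightarrow> complex set \<Rightarrow> complex \<Rightarrow> complex" where
  "trace_dual K B b =
     (THE a. a \<in> K \<and> (\<forall>b'\<in>B. field_trace K (a * b') = (if b' = b then 1 else 0)))"

text \<open>The pairing \<open>\<langle>f, g\<rangle>\<close> of two \<open>\<rat>\<close>-linear maps from \<open>K\<close> into a common overfield with
  respect to the trace form: \<open>\<Sum>\<^sub>i f (\<alpha>\<^sub>i\<^sup>*) g (\<alpha>\<^sub>i)\<close> for any \<open>\<rat>\<close>-basis \<open>\<alpha>\<^sub>i\<close> of \<open>K\<close>.\<close>

definition trace_pairing ::
    "complex set \<Rightarrow> (complex \<Rightarrow> complex) \<Rightarrow> (complex \<Rightarrow> complex) \<Rightarrow> complex" where
  "trace_pairing K f g =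
     (let B = some_rat_basis K in \<Sum>b\<in>B. f (trace_dual K B b) * g b)"

definition rat_linear_on :: "complex set \<Rightarrow> (complex \<Rightarrow> complex) \<Rightarrow> bool" where
  "rat_linear_on K f \<longleftrightarrow>
     (\<forall>x\<in>K. \<forall>y\<in>K. f (x + y) = f x + f y) \<and>
     (\<forall>q::rat. \<forall>x\<in>K. f (of_rat q * x) = of_rat q * f x)"

definition trace_isometry ::
    "complex set \<Rightarrow> complex set \<Rightarrow> (complex \<Rightarrow> complex) \<Rightarrow> bool" where
  "trace_isometry K L f \<longleftrightarrow>
     rat_linear_on K f \<and> bij_betw f K L \<and>
     (\<forall>x\<in>K. \<forall>y\<in>K. field_trace L (f x * f y) = field_trace K (x * y))"

definition integers_of :: "complex set \<Rightarrow> complex set" where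
  "integers_of K = {x \<in> K. algebraic_int x}"

definition integer_ring :: "complex set \<Rightarrow> complex ring" where
  "integer_ring K = complex_ring\<lparr>carrier := integers_of K\<rparr>"

definition integral_basis :: "complex set \<Rightarrow> complex list \<Rightarrow> bool" where
  "integral_basis K bs \<longleftrightarrow>
     distinct bs \<and> int_mod.independent (set bs) \<and> int_mod.span (set bs) = integers_of K"

text \<open>The determinant of the trace form is a rational integer that does not depend on the
  integral basis.\<close>

definition field_disc :: "complex set \<Rightarrow> int" where
  "field_disc K =
     (THE d. \<exists>bs. integral_basis K bs \<and>
        of_int d = det (mat (length bs) (length bs) (\<lambda>(i, j). field_trace K (bs ! i * bs ! j))))"

definition disc_f :: "complex set \<Rightarrow> int" where
  "disc_f K = \<Prod>{p. Factorial_Ring.prime p \<and> multiplicity p (field_disc K) = 1}"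

definition disc_s :: "complex set \<Rightarrow> int" where
  "disc_s K = field_disc K div disc_f K"

definition rad :: "int \<Rightarrow> int" where
  "rad m = \<Prod>(prime_factors m)"

text \<open>The exponent of \<open>P\<close> in the factorisation of the ideal \<open>p O\<^sub>K\<close>; products, powers and
  divisibility are those of the monoid of ideals of \<open>O\<^sub>K\<close>.\<close>

definition ramification_index :: "complex set \<Rightarrow> complex set \<Rightarrow> nat \<Rightarrow> nat" where
  "ramification_index K P p =
     (GREATEST e. (P [^]\<^bsub>ideals_set (integer_ring K)\<^esub> e)
        divides\<^bsub>ideals_set (integer_ring K)\<^esub> (PIdl\<^bsub>integer_ring K\<^esub> (of_nat p)))"

text \<open>Residue fields of \<open>O\<^sub>K\<close> are finite, hence perfect, so a prime ideal \<open>P\<close> above \<open>p\<close> is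
  wildly ramified exactly when \<open>p\<close> divides its ramification index.\<close>

definition no_wild_ramification :: "complex set \<Rightarrow> bool" where
  "no_wild_ramification K \<longleftrightarrow>
     (\<forall>P p. primeideal P (integer_ring K) \<and> Factorial_Ring.prime p \<and> of_nat p \<in> P \<longrightarrow>
        \<not> p dvd ramification_index K P p)"

end

(* Writing a_1, ..., a_n for an integral basis with trace-dual basis a_i^*, the pairing
   c = sum a_i^* phi(a_i) becomes integral after multiplication by any m that maps the dual lattice of O_K
   into O_K; m = d_K is one such integer. The integers m with m c integral form an ideal gZ, so
   it remains to bound the p-part of g for the primes p dividing d_K.

   If p divides d_K exactly once, the radical of the trace form modulo p is at most a line, spanned by some b;
   the trace of b is its eigenvalue on that line, so b^2 is divisible by p, and likewise phi(b)^2.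
   Modulo integral elements (d_K / p) c is an integer multiple of b phi(b) / p, whose square is integral. Hence
   p does not divide g.

   If p is tamely ramified and y in O_K has all traces Tr(y z) divisible by p^2, then y is divisible
   by p: otherwise, as the localisations of O_K are valuation rings, there are a prime P over p and
   an s outside P with all Tr(s z) divisible by p. But modulo p the traces of suitable multiples of s are e
   times arbitrary traces of the residue field of P, which do not all vanish. Hence p^2 does not divide g. *)

theory Submission
  imports Defs "Jordan_Normal_Form.Char_Poly"
begin

section \<open>Algebraic integers\<close>

text \<open>For a prime p dividing d_K exactly once, bounding the dual lattice is not enough: its
  elements are not all integral at p, so the gain has to come from cancellation inside c. As \<phi>
  is not multiplicative, the square of \<phi>(b) is controlled by repeating the eigenvalue argument
  in L, where \<phi>(b) spans the radical. The tame bound concerns the dual lattice itself: if p^i x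
  is integral for a suitable multiple x of a dual element and i is at least 2, its traces are
  divisible by p^2, so a factor p can be removed, down to p x. Unique factorisation of ideals is
  avoided. Two facts replace it: primitive integer polynomials show that the localisation at P is a
  valuation ring, and p O_K = P^e a with e maximal forces a to leave P. An element of a congruent to
  r modulo P then acts on each P^i / P^(i+1) with i < e as r does on the residue field, and as zero
  on P^e / p O_K, which is where the factor e in the trace comes from.\<close>

lemma algebraic_int_of_eigen_system:
  fixes g :: "nat \<Rightarrow> complex" and a :: "nat \<Rightarrow> nat \<Rightarrow> int"
  assumes eq: "\<And>i. i < n \<Longrightarrow> x * g i = (\<Sum>j<n. of_int (a i j) * g j)"
    and nz: "i0 < n" "g i0 \<noteq> 0"
  shows "algebraic_int x"
proof -
  define A where "A = mat n n (\<lambda>(i, j). a i j)"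
  have A: "A \<in> carrier_mat n n" by (simp add: A_def)
  define C :: "complex mat" where "C = of_int_hom.mat_hom A"
  have C: "C \<in> carrier_mat n n" by (simp add: C_def A_def)
  have "C *\<^sub>v vec n g = x \<cdot>\<^sub>v vec n g"
    by (rule eq_vecI) (auto simp: C_def A_def scalar_prod_def eq atLeast0LessThan)
  moreover have "vec n g \<noteq> 0\<^sub>v n"
    using nz by (metis index_vec index_zero_vec(1))
  ultimately have "eigenvector C (vec n g) x"
    using C by (auto simp: eigenvector_def)
  then have "poly (char_poly C) x = 0"
    using eigenvalue_root_char_poly[OF C] eigenvalue_def by blast
  moreover have "char_poly C = map_poly of_int (char_poly A)"
    unfolding C_def by (rule of_int_hom.char_poly_hom[OF A])
  moreover have "lead_coeff (char_poly A) = 1"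
    using degree_monic_char_poly[OF A] by simp
  ultimately show ?thesis
    unfolding algebraic_int_altdef_ipoly by metis
qed

lemma int_span_mult_left:
  assumes "\<And>s. s \<in> S \<Longrightarrow> x * s \<in> int_mod.span T" and "y \<in> int_mod.span S"
  shows "x * y \<in> int_mod.span T"
  using assms(2)
proof (induction rule: int_mod.span_induct_alt)
  case base
  then show ?case by (simp add: int_mod.span_zero)
next
  case (step c s y)
  have "x * (of_int c * s + y) = of_int c * (x * s) + x * y" by (simp add: algebra_simps)
  then show ?case using step assms(1) by (simp add: int_mod.span_add int_mod.span_scale)
qed

text \<open>The generators may be dependent: any choice of integer coefficients makes x an
  eigenvalue of an integer matrix, with the vector of generators as eigenvector. A nonzero generator
  keeps that vector nonzero.\<close>

lemma algebraic_int_of_span: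
  assumes "finite S" and "s0 \<in> S" "s0 \<noteq> 0"
    and "\<And>s. s \<in> S \<Longrightarrow> x * s \<in> int_mod.span S"
  shows "algebraic_int x"
proof -
  obtain xs where xs: "set xs = S" "distinct xs"
    using finite_distinct_list[OF assms(1)] by blast
  have bij: "bij_betw ((!) xs) {..<length xs} S"
    using bij_betw_nth[OF xs(2)] xs(1) by blast
  have "\<exists>u. x * s = (\<Sum>v\<in>S. of_int (u v) * v)" if "s \<in> S" for s
    using assms(4)[OF that] int_mod.span_finite[OF assms(1)] by auto
  then obtain u where u: "\<And>s. s \<in> S \<Longrightarrow> x * s = (\<Sum>v\<in>S. of_int (u s v) * v)"
    by metis
  obtain i0 where i0: "i0 < length xs" "xs ! i0 = s0"
    using assms(2) xs by (metis in_set_conv_nth)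
  show ?thesis
  proof (rule algebraic_int_of_eigen_system[where n = "length xs" and g = "(!) xs"
        and a = "\<lambda>i j. u (xs ! i) (xs ! j)"])
    fix i assume "i < length xs"
    then have "xs ! i \<in> S" using xs by auto
    then show "x * xs ! i = (\<Sum>j<length xs. of_int (u (xs ! i) (xs ! j)) * xs ! j)"
      by (simp add: u sum.reindex_bij_betw[OF bij, of "\<lambda>v. of_int (u (xs ! i) v) * v"])
  qed (use i0 assms in auto)
qed

text \<open>The monic equation is solved for its leading power. Positivity of \<open>m\<close> puts
  1 among the generating powers.\<close>

lemma algebraic_int_power_span:
  fixes x :: complex
  assumes "algebraic_int x"
  obtains m where "m > 0" "x ^ m \<in> int_mod.span ((\<lambda>i. x ^ i) ` {..<m})"
proof -
  obtain p where p: "poly (map_poly of_int p) x = 0" "lead_coeff p = (1::int)"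
    using assms algebraic_int_altdef_ipoly by blast
  define m where "m = degree p"
  have "m > 0"
  proof (rule ccontr)
    assume "\<not> m > 0"
    then obtain c where "p = [:c:]" by (metis degree_eq_zeroE gr0I m_def)
    then show False using p by simp
  qed
  have "0 = (\<Sum>i\<le>m. of_int (Polynomial.coeff p i) * x ^ i)"
    using p(1) by (simp add: poly_altdef m_def coeff_map_poly degree_map_poly)
  also have "{..m} = insert m {..<m}" by auto
  also have "(\<Sum>i\<in>\<dots>. of_int (Polynomial.coeff p i) * x ^ i) = x ^ m + (\<Sum>i<m. of_int (Polynomial.coeff p i) * x ^ i)"
    using p(2) by (simp add: m_def)
  finally have "x ^ m = - (\<Sum>i<m. of_int (Polynomial.coeff p i) * x ^ i)"
    by (simp add: eq_neg_iff_add_eq_0)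
  also have "\<dots> \<in> int_mod.span ((\<lambda>i. x ^ i) ` {..<m})"
    by (intro int_mod.span_neg int_mod.span_sum int_mod.span_scale int_mod.span_base) auto
  finally show ?thesis using \<open>m > 0\<close> that by blast
qed

text \<open>Both x and y map the module spanned by the monomials x^i y^j with i < m and j < n into
  itself, so their sum and product do as well.\<close>

lemma algebraic_int_add_mult:
  fixes x y :: complex
  assumes "algebraic_int x" "algebraic_int y"
  shows algebraic_int_add: "algebraic_int (x + y)" and algebraic_int_mult: "algebraic_int (x * y)"
proof -
  obtain m where m: "m > 0" "x ^ m \<in> int_mod.span ((\<lambda>i. x ^ i) ` {..<m})"
    using algebraic_int_power_span[OF assms(1)] .
  obtain n where n: "n > 0" "y ^ n \<in> int_mod.span ((\<lambda>i. y ^ i) ` {..<n})"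
    using algebraic_int_power_span[OF assms(2)] .
  define S where "S = (\<lambda>(i, j). x ^ i * y ^ j) ` ({..<m} \<times> {..<n})"
  have fin: "finite S" by (simp add: S_def)
  have S: "x ^ i * y ^ j \<in> S" if "i < m" "j < n" for i j
    using that by (auto simp: S_def)
  have one: "1 \<in> S" using S[of 0 0] m n by simp
  have xS: "x * s \<in> int_mod.span S" if "s \<in> S" for s
  proof -
    obtain i j where ij: "i < m" "j < n" "s = x ^ i * y ^ j" using \<open>s \<in> S\<close> by (auto simp: S_def)
    show ?thesis
    proof (cases "Suc i < m")
      case True
      then show ?thesis using S[OF True ij(2)] ij by (simp add: int_mod.span_base mult.assoc)
    next
      case False
      then have "Suc i = m" using ij by simp
      then have "x * s = y ^ j * x ^ m" using ij by (auto simp: algebra_simps)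
      also have "\<dots> \<in> int_mod.span S"
        by (rule int_span_mult_left[OF _ m(2)])
          (use S ij(2) in \<open>auto simp: mult.commute[of "y ^ j"] intro: int_mod.span_base\<close>)
      finally show ?thesis .
    qed
  qed
  have yS: "y * s \<in> int_mod.span S" if "s \<in> S" for s
  proof -
    obtain i j where ij: "i < m" "j < n" "s = x ^ i * y ^ j" using \<open>s \<in> S\<close> by (auto simp: S_def)
    show ?thesis
    proof (cases "Suc j < n")
      case True
      have "y * s = x ^ i * y ^ Suc j" using ij by simp
      then show ?thesis using S[OF ij(1) True] by (metis int_mod.span_base)
    next
      case False
      then have "Suc j = n" using ij by simp
      then have "y * s = x ^ i * y ^ n" using ij by (auto simp: algebra_simps)
      also have "\<dots> \<in> int_mod.span S"
        by (rule int_span_mult_left[OF _ n(2)])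
          (use S ij(1) in \<open>auto intro: int_mod.span_base\<close>)
      finally show ?thesis .
    qed
  qed
  show "algebraic_int (x + y)"
    by (rule algebraic_int_of_span[OF fin one]) (simp_all add: distrib_right int_mod.span_add xS yS)
  show "algebraic_int (x * y)"
  proof (rule algebraic_int_of_span[OF fin one])
    fix s assume "s \<in> S"
    then show "x * y * s \<in> int_mod.span S"
      using int_span_mult_left[OF xS yS] by (simp add: mult.assoc)
  qed simp
qed

lemma algebraic_int_diff:
  "algebraic_int x \<Longrightarrow> algebraic_int y \<Longrightarrow> algebraic_int (x - y)" for x y :: complex
  using algebraic_int_add[of x "- y"] by simp

lemma algebraic_int_sum:
  "(\<And>i. i \<in> A \<Longrightarrow> algebraic_int (f i)) \<Longrightarrow> algebraic_int (sum f A)" for f :: "'i \<Rightarrow> complex"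
  by (induction A rule: infinite_finite_induct) (auto intro: algebraic_int_add)

text \<open>Serves for an element b \<phi>(b) / p, of which only the square is visibly
  integral.\<close>

lemma algebraic_int_of_square:
  fixes x :: complex
  assumes "algebraic_int (x ^ 2)"
  shows "algebraic_int x"
proof (rule algebraic_int_root[OF assms])
  show "poly (Polynomial.monom 1 2) x = x ^ 2" by (simp add: poly_monom)
qed (auto simp: degree_monom_eq)

text \<open>For a root \<open>u\<close> of \<open>\<Sum>\<^sub>i a\<^sub>i X\<^sup>i\<close>, the coefficients \<open>b\<^sub>i\<close> of the quotient by \<open>X - u\<close> map the
  lattice spanned by \<open>1, u, \<dots>, u\<^bsup>n-1\<^esup>\<close> into itself.\<close>

lemma algebraic_int_quotient_coeff:
  fixes u :: complex and a :: "nat \<Rightarrow> int"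
  assumes root: "(\<Sum>i\<le>n. of_int (a i) * u ^ i) = 0" and "i < n"
  shows "algebraic_int (\<Sum>k\<in>{i<..n}. of_int (a k) * u ^ (k - Suc i))" (is "algebraic_int ?b")
proof -
  define S where "S = (\<lambda>j. u ^ j) ` {..<n}"
  have S: "of_int c * u ^ j \<in> int_mod.span S" if "j < n" for j c
    using that by (intro int_mod.span_scale int_mod.span_base) (auto simp: S_def)
  show ?thesis
  proof (rule algebraic_int_of_span)
    show "finite S" by (simp add: S_def)
    show "1 \<in> S" using \<open>i < n\<close> by (auto simp: S_def intro!: image_eqI[of _ _ 0])
    fix s assume "s \<in> S"
    then obtain j where j: "j < n" "s = u ^ j" by (auto simp: S_def)
    show "?b * s \<in> int_mod.span S"
    proof (cases "j \<le> i")
      case True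
      have "?b * s = (\<Sum>k\<in>{i<..n}. of_int (a k) * u ^ (k - Suc i + j))"
        unfolding j sum_distrib_right
        by (intro sum.cong refl) (simp only: power_add mult.assoc)
      also have "\<dots> \<in> int_mod.span S"
        by (intro int_mod.span_sum S) (use True \<open>i < n\<close> in auto)
      finally show ?thesis .
    next
      case False
      have split: "{..n} = {i<..n} \<union> {..i}" "{i<..n} \<inter> {..i} = {}" using \<open>i < n\<close> by auto
      \<comment> \<open>For j > i the exponents could exceed n - 1. The shifted relation trades the
        part above i for minus the part up to i, whose exponents stay below j.\<close>
      have "0 = u ^ (j - Suc i) * (\<Sum>k\<le>n. of_int (a k) * u ^ k)" using root by simp
      also have "\<dots> = (\<Sum>k\<in>{i<..n}. of_int (a k) * (u ^ (j - Suc i) * u ^ k)) +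
          (\<Sum>k\<le>i. of_int (a k) * (u ^ (j - Suc i) * u ^ k))"
        unfolding split(1) by (subst sum.union_disjoint) (use split(2) in \<open>auto simp: sum_distrib_left algebra_simps\<close>)
      also have "(\<Sum>k\<in>{i<..n}. of_int (a k) * (u ^ (j - Suc i) * u ^ k)) = ?b * s"
        unfolding j sum_distrib_right
        by (intro sum.cong refl) (use False in \<open>simp add: mult.assoc add.commute flip: power_add\<close>)
      finally have "?b * s = - (\<Sum>k\<le>i. of_int (a k) * u ^ (j - Suc i + k))"
        by (simp add: eq_neg_iff_add_eq_0 power_add)
      also have "\<dots> \<in> int_mod.span S"
        by (intro int_mod.span_neg int_mod.span_sum S) (use False j in auto)
      finally show ?thesis .
    qed
  qed simp
qed

text \<open>Division by the content makes the coefficients coprime. This later keeps them from all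
  lying in one prime ideal.\<close>

lemma primitive_int_relation:
  fixes u :: complex
  assumes "algebraic u"
  obtains n and a :: "nat \<Rightarrow> int" where
    "(\<Sum>i\<le>n. of_int (a i) * u ^ i) = 0" "Gcd (a ` {..n}) = 1" "n > 0" "a n \<noteq> 0"
proof -
  obtain p :: "int poly" where p: "p \<noteq> 0" "poly (map_poly of_int p) u = 0"
    using algebraicE'[OF assms] by metis
  define q where "q = primitive_part p"
  have q: "q \<noteq> 0" "content q = 1" using p by (auto simp: q_def)
  have "p = Polynomial.smult (content p) q" by (simp add: q_def)
  then have "map_poly of_int p = Polynomial.smult (of_int (content p)) (map_poly of_int q :: complex poly)"
    by (metis of_int_hom.map_poly_hom_smult)
  then have root: "poly (map_poly of_int q) u = 0" using p by simp
  have eq: "(\<Sum>i\<le>degree q. of_int (Polynomial.coeff q i) * u ^ i) = 0"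
    using root by (simp add: poly_altdef coeff_map_poly degree_map_poly)
  have deg: "degree q > 0"
  proof (rule ccontr)
    assume "\<not> degree q > 0"
    then obtain c where "q = [:c:]" by (metis degree_eq_zeroE gr0I)
    then show False using root q by simp
  qed
  have gcd: "Gcd (Polynomial.coeff q ` {..degree q}) = 1"
  proof -
    have "set (coeffs q) = Polynomial.coeff q ` {..degree q}"
      using q(1) by (simp add: coeffs_def atLeast0LessThan lessThan_Suc_atMost del: upt_Suc)
    then show ?thesis
      using q(2) by (simp add: content_def flip: Gcd_set_eq_fold)
  qed
  show ?thesis using that[OF eq gcd deg] q by simp
qed

section \<open>Rational bases and the trace\<close>

lemma complex_ring_simps [simp]:
  "carrier complex_ring = UNIV" "x \<otimes>\<^bsub>complex_ring\<^esub> y = x * y" "\<one>\<^bsub>complex_ring\<^esub> = 1"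
  "\<zero>\<^bsub>complex_ring\<^esub> = 0" "x \<oplus>\<^bsub>complex_ring\<^esub> y = x + y"
  by (simp_all add: complex_ring_def)

lemma cring_complex_ring: "cring complex_ring"
proof (intro cringI abelian_groupI comm_monoidI)
  fix x assume "x \<in> carrier complex_ring"
  show "\<exists>y\<in>carrier complex_ring. y \<oplus>\<^bsub>complex_ring\<^esub> x = \<zero>\<^bsub>complex_ring\<^esub>"
    by (rule bexI[of _ "- x"]) auto
qed (auto simp: algebra_simps)

text \<open>An indexed counterpart of \<open>rat_basis\<close>: Gram matrices need numbered bases,
  and sets are covered by the identity family.\<close>

definition qbasis :: "complex set \<Rightarrow> 'i set \<Rightarrow> ('i \<Rightarrow> complex) \<Rightarrow> bool" where
  "qbasis K J b \<longleftrightarrow> finite J \<and> b ` J \<subseteq> K \<and>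
     (\<forall>x\<in>K. \<exists>q. x = (\<Sum>j\<in>J. of_rat (q j) * b j)) \<and>
     (\<forall>q. (\<Sum>j\<in>J. of_rat (q j) * b j) = 0 \<longrightarrow> (\<forall>j\<in>J. q j = 0))"

lemma qbasisD:
  assumes "qbasis K J b"
  shows "finite J" "j \<in> J \<Longrightarrow> b j \<in> K"
    "x \<in> K \<Longrightarrow> \<exists>q. x = (\<Sum>j\<in>J. of_rat (q j) * b j)"
    "(\<Sum>j\<in>J. of_rat (q j) * b j) = 0 \<Longrightarrow> j \<in> J \<Longrightarrow> q j = 0"
  using assms by (auto simp: qbasis_def)

lemma qbasis_unique:
  assumes "qbasis K J b" "(\<Sum>j\<in>J. of_rat (q j) * b j) = (\<Sum>j\<in>J. of_rat (r j) * b j)" "j \<in> J"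
  shows "q j = r j"
  using qbasisD(4)[OF assms(1), of "\<lambda>j. q j - r j" j] assms(2,3)
  by (simp add: of_rat_diff left_diff_distrib sum_subtractf)

lemma qbasis_matrix:
  assumes "qbasis K J b" "\<And>i. i \<in> I \<Longrightarrow> g i \<in> K"
  obtains q where "\<And>i. i \<in> I \<Longrightarrow> g i = (\<Sum>j\<in>J. of_rat (q i j) * b j)"
  using qbasisD(3)[OF assms(1) assms(2)] by metis

lemma qbasis_int_independent:
  assumes "qbasis K J b" "(\<Sum>j\<in>J. of_int (m j) * b j) = 0" "j \<in> J"
  shows "m j = 0"
  using qbasisD(4)[OF assms(1), of "\<lambda>j. of_int (m j)" j] assms(2,3) by simp

lemma finite_rat_basis_imp_qbasis:
  assumes "rat_basis K B" "finite B"
  shows "qbasis K B (\<lambda>x. x)"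
  using assms rat_vs.span_finite[OF assms(2)] rat_vs.independentD[of B B]
  by (auto simp: qbasis_def rat_basis_def rat_vs.span_base)

lemma qbasis_inj_on:
  assumes "qbasis K J b" shows "inj_on b J"
proof (rule inj_onI, rule ccontr)
  fix i j assume ij: "i \<in> J" "j \<in> J" "b i = b j" "i \<noteq> j"
  have *: "(\<Sum>k\<in>J. of_rat (if k = l then 1 else 0) * b k) = b l" if "l \<in> J" for l
    using that qbasisD(1)[OF assms] by (simp add: of_rat_eq_iff if_distrib[of of_rat] if_distrib[of "\<lambda>x. x * _"] cong: if_cong)
  show False using qbasis_unique[OF assms, of "\<lambda>k. if k = i then 1 else 0" "\<lambda>k. if k = j then 1 else 0" i]
      *[OF ij(1)] *[OF ij(2)] ij by auto
qed

lemma qbasis_reindex: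
  assumes "bij_betw f I J"
  shows "qbasis K J b \<longleftrightarrow> qbasis K I (b \<circ> f)"
proof -
  define g where "g = the_inv_into I f"
  have gf: "g (f i) = i" if "i \<in> I" for i
    using assms that by (simp add: g_def bij_betw_def the_inv_into_f_f)
  have s: "(\<Sum>j\<in>J. of_rat (q j) * b j) = (\<Sum>i\<in>I. of_rat (q (f i)) * (b \<circ> f) i)" for q
    using sum.reindex_bij_betw[OF assms, of "\<lambda>j. of_rat (q j) * b j"] by simp
  have s': "(\<Sum>i\<in>I. of_rat (q i) * (b \<circ> f) i) = (\<Sum>j\<in>J. of_rat (q (g j)) * b j)" for q
    unfolding s by (intro sum.cong) (auto simp: gf)
  have img: "f ` I = J" using assms by (simp add: bij_betw_def)
  show ?thesis
  proof
    assume q: "qbasis K J b"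
    show "qbasis K I (b \<circ> f)"
      unfolding qbasis_def
    proof (intro conjI ballI allI impI)
      show "finite I" using q assms bij_betw_finite by (auto simp: qbasis_def)
      show "(b \<circ> f) ` I \<subseteq> K" using q img by (auto simp: qbasis_def)
      fix x assume "x \<in> K" then show "\<exists>q. x = (\<Sum>i\<in>I. of_rat (q i) * (b \<circ> f) i)"
        using qbasisD(3)[OF q] s by metis
    next
      fix r i assume "(\<Sum>i\<in>I. of_rat (r i) * (b \<circ> f) i) = 0" "i \<in> I"
      then show "r i = 0" using qbasisD(4)[OF q, of "\<lambda>j. r (g j)" "f i"] s' img gf by auto
    qed
  next
    assume q: "qbasis K I (b \<circ> f)"
    show "qbasis K J b"
      unfolding qbasis_def
    proof (intro conjI ballI allI impI)
      show "finite J" using q assms bij_betw_finite by (auto simp: qbasis_def)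
      show "b ` J \<subseteq> K" using q img by (auto simp: qbasis_def)
      fix x assume "x \<in> K" then show "\<exists>q. x = (\<Sum>j\<in>J. of_rat (q j) * b j)"
        using qbasisD(3)[OF q] s' by metis
    next
      fix r j assume "(\<Sum>j\<in>J. of_rat (r j) * b j) = 0" "j \<in> J"
      then show "r j = 0" using qbasisD(4)[OF q, of "\<lambda>i. r (f i)" "g j"] s img gf by auto
    qed
  qed
qed

locale num_field =
  fixes K :: "complex set"
  assumes number_field: "number_field K"
begin

lemma subfield: "subfield K complex_ring"
  using number_field by (simp add: number_field_def)

abbreviation "B\<^sub>0 \<equiv> some_rat_basis K"

lemma ex_rat_basis: "\<exists>B. finite B \<and> rat_basis K B"
  using number_field by (simp add: number_field_def)

lemma finite_rat_basis: "rat_basis K B \<Longrightarrow> finite B"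
proof -
  assume B: "rat_basis K B"
  obtain B' where "finite B'" "rat_basis K B'" using ex_rat_basis by blast
  then show "finite B"
    using B rat_vs.independent_span_bound[of B' B] rat_vs.span_superset[of B] by (auto simp: rat_basis_def)
qed

lemma some_rat_basis: "rat_basis K B\<^sub>0"
  unfolding some_rat_basis_def using ex_rat_basis someI_ex[of "rat_basis K"] by blast

lemma finite_B0: "finite B\<^sub>0"
  using finite_rat_basis some_rat_basis .

lemma qbasis_B0: "qbasis K B\<^sub>0 (\<lambda>x. x)"
  using finite_rat_basis_imp_qbasis some_rat_basis finite_B0 by blast

lemma subspace_K: "rat_vs.subspace K"
  using some_rat_basis rat_vs.subspace_span by (metis rat_basis_def)

lemma K_add: "x \<in> K \<Longrightarrow> y \<in> K \<Longrightarrow> x + y \<in> K"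
  and K_diff: "x \<in> K \<Longrightarrow> y \<in> K \<Longrightarrow> x - y \<in> K"
  and K_neg: "x \<in> K \<Longrightarrow> - x \<in> K"
  and K_scale: "x \<in> K \<Longrightarrow> of_rat q * x \<in> K"
  and K_zero: "0 \<in> K"
  using subspace_K rat_vs.subspace_add rat_vs.subspace_diff rat_vs.subspace_neg rat_vs.subspace_scale
    rat_vs.subspace_0 by blast+

lemma K_sum: "(\<And>i. i \<in> A \<Longrightarrow> f i \<in> K) \<Longrightarrow> sum f A \<in> K"
  using subspace_K rat_vs.subspace_sum by blast

lemma K_mult: "x \<in> K \<Longrightarrow> y \<in> K \<Longrightarrow> x * y \<in> K"
  and K_one: "1 \<in> K"
  using subcringE(3,6)[OF subfieldE(2)[OF subfield]] by auto

lemma K_power: "x \<in> K \<Longrightarrow> x ^ k \<in> K"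
  by (induction k) (auto simp: K_one K_mult)

lemma K_of_rat: "of_rat q \<in> K"
  using K_scale[OF K_one] by simp

lemma K_of_int: "of_int m \<in> K"
  using K_of_rat[of "of_int m"] by simp

lemma K_inverse: "inverse x \<in> K" if "x \<in> K"
proof (cases "x = 0")
  case False
  interpret cring complex_ring by (rule cring_complex_ring)
  have "inv\<^bsub>complex_ring\<^esub> x \<in> K" "x * inv\<^bsub>complex_ring\<^esub> x = 1"
    using subfield_m_inv[OF subfield, of x] that False by auto
  then show ?thesis by (metis inverse_unique)
qed (simp add: K_zero)

lemma K_divide: "x \<in> K \<Longrightarrow> y \<in> K \<Longrightarrow> x / y \<in> K"
  by (simp add: divide_inverse K_mult K_inverse)

lemma qbasis_rat_basis:
  assumes "qbasis K J b"
  shows "rat_basis K (b ` J)"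
proof -
  have fin: "finite J" using assms qbasisD by blast
  have inj: "inj_on b J" by (rule qbasis_inj_on[OF assms])
  have sum: "(\<Sum>v\<in>b ` J. of_rat (u v) * v) = (\<Sum>j\<in>J. of_rat (u (b j)) * b j)" for u
    using sum.reindex[OF inj] by simp
  have "rat_vs.independent (b ` J)"
    unfolding rat_vs.dependent_finite[OF finite_imageI[OF fin]] sum
    using qbasisD(4)[OF assms] by fastforce
  moreover have "rat_vs.span (b ` J) = K"
  proof
    show "rat_vs.span (b ` J) \<subseteq> K"
      by (rule rat_vs.span_minimal) (use qbasisD(2)[OF assms] subspace_K in auto)
    show "K \<subseteq> rat_vs.span (b ` J)"
    proof
      fix x assume "x \<in> K"
      then obtain q where "x = (\<Sum>j\<in>J. of_rat (q j) * b j)" using qbasisD(3)[OF assms] by blast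
      then show "x \<in> rat_vs.span (b ` J)"
        by (simp only:) (intro rat_vs.span_sum rat_vs.span_scale rat_vs.span_base imageI)
    qed
  qed
  ultimately show ?thesis by (simp add: rat_basis_def)
qed

definition deg :: nat where "deg = card B\<^sub>0"

lemma card_rat_basis:
  assumes "rat_basis K B" shows "card B = deg"
proof -
  have "card B \<le> deg" "deg \<le> card B"
    unfolding deg_def using rat_vs.independent_span_bound[of B\<^sub>0 B] rat_vs.independent_span_bound[of B B\<^sub>0]
      assms some_rat_basis finite_rat_basis rat_vs.span_superset by (metis rat_basis_def)+
  then show ?thesis by simp
qed

lemma card_qbasis: "qbasis K J b \<Longrightarrow> card J = deg"
  using card_rat_basis[OF qbasis_rat_basis] card_image[OF qbasis_inj_on] by fastforce

text \<open>A dimension count: an element of K outside the span would give \<open>deg\<close> + 1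
  independent elements in the span of the \<open>deg\<close> elements of
  \<open>B\<^sub>0\<close>.\<close>

lemma independent_imp_qbasis:
  assumes "finite J" "\<And>j. j \<in> J \<Longrightarrow> b j \<in> K" "card J = deg"
    and ind: "\<And>q j. (\<Sum>j\<in>J. of_rat (q j) * b j) = 0 \<Longrightarrow> j \<in> J \<Longrightarrow> q j = 0"
  shows "qbasis K J b"
proof -
  have inj: "inj_on b J"
  proof (rule inj_onI, rule ccontr)
    fix i j assume ij: "i \<in> J" "j \<in> J" "b i = b j" "i \<noteq> j"
    define q :: "_ \<Rightarrow> rat" where "q = (\<lambda>k. if k = i then 1 else if k = j then -1 else 0)"
    have "(\<Sum>k\<in>J. of_rat (q k) * b k) = (\<Sum>k\<in>{i, j}. of_rat (q k) * b k)"
      using assms(1) ij by (intro sum.mono_neutral_right) (auto simp: q_def)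
    also have "\<dots> = 0" using ij by (simp add: q_def of_rat_minus)
    finally show False using ind[of q i] ij by (simp add: q_def)
  qed
  have sum: "(\<Sum>v\<in>b ` J. of_rat (u v) * v) = (\<Sum>j\<in>J. of_rat (u (b j)) * b j)" for u
    using sum.reindex[OF inj] by simp
  have indep: "rat_vs.independent (b ` J)"
    unfolding rat_vs.dependent_finite[OF finite_imageI[OF assms(1)]] sum
    using ind by fastforce
  have "K \<subseteq> rat_vs.span (b ` J)"
  proof
    fix x assume x: "x \<in> K"
    show "x \<in> rat_vs.span (b ` J)"
    proof (rule ccontr)
      assume nx: "x \<notin> rat_vs.span (b ` J)"
      then have "rat_vs.independent (insert x (b ` J))"
        using indep rat_vs.independent_insert rat_vs.span_base by metis
      moreover have "insert x (b ` J) \<subseteq> rat_vs.span B\<^sub>0"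
        using some_rat_basis x assms(2) by (auto simp: rat_basis_def)
      ultimately have "card (insert x (b ` J)) \<le> deg"
        using rat_vs.independent_span_bound[OF finite_B0] by (auto simp: deg_def)
      moreover have "card (insert x (b ` J)) = Suc deg"
        using nx rat_vs.span_base[of x "b ` J"] assms(1,3) card_image[OF inj] by (subst card_insert_disjoint) auto
      ultimately show False by simp
    qed
  qed
  then have "\<exists>q. x = (\<Sum>j\<in>J. of_rat (q j) * b j)" if "x \<in> K" for x
    using that rat_vs.span_finite[OF finite_imageI[OF assms(1)]] sum by fastforce
  then show ?thesis using assms ind by (auto simp: qbasis_def)
qed

abbreviation "tr \<equiv> field_trace K"

text \<open>The trace of a matrix is invariant under conjugation. Here \<open>u\<close> and
  \<open>v\<close> are the transition matrices between the given family and
  \<open>B\<^sub>0\<close>; as u v is the identity, v q u has the same trace as q.\<close>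

lemma trace_qbasis:
  assumes b: "qbasis K J b" and x: "x \<in> K"
    and eq: "\<And>j. j \<in> J \<Longrightarrow> x * b j = (\<Sum>k\<in>J. of_rat (q j k) * b k)"
  shows "tr x = (\<Sum>j\<in>J. q j j)"
proof -
  let ?r = "\<lambda>c c'. rat_vs.representation B\<^sub>0 (x * c) c'"
  have B0: "rat_vs.independent B\<^sub>0" "rat_vs.span B\<^sub>0 = K" using some_rat_basis by (auto simp: rat_basis_def)
  have B0K: "c \<in> K" if "c \<in> B\<^sub>0" for c using that B0 rat_vs.span_base by blast
  obtain u where u: "\<And>j. j \<in> J \<Longrightarrow> b j = (\<Sum>c\<in>B\<^sub>0. of_rat (u j c) * c)"
    using qbasis_matrix[OF qbasis_B0, of J b] qbasisD(2)[OF b] by metis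
  obtain v where v: "\<And>c. c \<in> B\<^sub>0 \<Longrightarrow> c = (\<Sum>j\<in>J. of_rat (v c j) * b j)"
    using qbasis_matrix[OF b, of B\<^sub>0 "\<lambda>x. x"] B0K by metis
  have uv: "(\<Sum>c\<in>B\<^sub>0. u j c * v c k) = (if k = j then 1 else 0)" if "j \<in> J" "k \<in> J" for j k
  proof (rule qbasis_unique[OF b _ that(2)])
    have "(\<Sum>k\<in>J. of_rat (\<Sum>c\<in>B\<^sub>0. u j c * v c k) * b k) = (\<Sum>c\<in>B\<^sub>0. of_rat (u j c) * (\<Sum>k\<in>J. of_rat (v c k) * b k))"
      unfolding of_rat_sum sum_distrib_left sum_distrib_right of_rat_mult
      by (subst sum.swap) (simp add: mult.assoc)
    also have "\<dots> = (\<Sum>c\<in>B\<^sub>0. of_rat (u j c) * c)" using v by (intro sum.cong) auto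
    also have "\<dots> = b j" using u that by simp
    also have "\<dots> = (\<Sum>k\<in>J. of_rat (if k = j then 1 else 0) * b k)"
      using qbasisD(1)[OF b] that by (simp add: if_distrib[of of_rat] if_distrib[of "\<lambda>x. x * _"] cong: if_cong)
    finally show "(\<Sum>k\<in>J. of_rat (\<Sum>c\<in>B\<^sub>0. u j c * v c k) * b k) = (\<Sum>k\<in>J. of_rat (if k = j then 1 else 0) * b k)" .
  qed
  have r: "?r c c' = (\<Sum>j\<in>J. v c j * (\<Sum>k\<in>J. q j k * u k c'))" if c: "c \<in> B\<^sub>0" "c' \<in> B\<^sub>0" for c c'
  proof (rule qbasis_unique[OF qbasis_B0 _ c(2)])
    have "(\<Sum>c'\<in>B\<^sub>0. of_rat (?r c c') * c') = x * c"
      using rat_vs.sum_representation_eq[OF B0(1) _ finite_B0 order_refl] B0K[OF c(1)] B0(2) K_mult[OF x] by simp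
    also have "\<dots> = (\<Sum>j\<in>J. of_rat (v c j) * (x * b j))"
      by (subst v[OF c(1)]) (simp add: sum_distrib_left algebra_simps)
    also have "\<dots> = (\<Sum>j\<in>J. of_rat (v c j) * (\<Sum>k\<in>J. of_rat (q j k) * (\<Sum>c'\<in>B\<^sub>0. of_rat (u k c') * c')))"
      using eq u by simp
    also have "\<dots> = (\<Sum>c'\<in>B\<^sub>0. of_rat (\<Sum>j\<in>J. v c j * (\<Sum>k\<in>J. q j k * u k c')) * c')"
      unfolding of_rat_sum of_rat_mult sum_distrib_left sum_distrib_right
      by (subst (2) sum.swap, subst (3) sum.swap, subst sum.swap) (simp add: mult.assoc, subst sum.swap, rule refl)
    finally show "(\<Sum>c'\<in>B\<^sub>0. of_rat (?r c c') * c') = (\<Sum>c'\<in>B\<^sub>0. of_rat (\<Sum>j\<in>J. v c j * (\<Sum>k\<in>J. q j k * u k c')) * c')" .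
  qed
  have "tr x = (\<Sum>c\<in>B\<^sub>0. \<Sum>j\<in>J. \<Sum>k\<in>J. q j k * (u k c * v c j))"
    unfolding field_trace_def Let_def
    by (intro sum.cong refl) (subst r, simp_all add: sum_distrib_left mult.left_commute mult.commute)
  also have "\<dots> = (\<Sum>j\<in>J. \<Sum>k\<in>J. q j k * (\<Sum>c\<in>B\<^sub>0. u k c * v c j))"
    unfolding sum_distrib_left by (subst sum.swap, subst (2) sum.swap) simp
  also have "\<dots> = (\<Sum>j\<in>J. \<Sum>k\<in>J. if j = k then q j k else 0)"
    by (intro sum.cong) (auto simp: uv)
  also have "\<dots> = (\<Sum>j\<in>J. q j j)" using qbasisD(1)[OF b] by simp
  finally show ?thesis .
qed

lemma trace_add: "x \<in> K \<Longrightarrow> y \<in> K \<Longrightarrow> tr (x + y) = tr x + tr y"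
  and trace_scale: "x \<in> K \<Longrightarrow> tr (of_rat q * x) = q * tr x"
  and trace_one: "tr 1 = of_nat deg"
proof -
  have B0: "rat_vs.independent B\<^sub>0" "rat_vs.span B\<^sub>0 = K" using some_rat_basis by (auto simp: rat_basis_def)
  have B0K: "c \<in> K" if "c \<in> B\<^sub>0" for c using that B0 rat_vs.span_base by blast
  show "tr (x + y) = tr x + tr y" if "x \<in> K" "y \<in> K"
    by (simp add: field_trace_def Let_def distrib_right rat_vs.representation_add B0 K_mult that B0K flip: sum.distrib)
  show "tr (of_rat q * x) = q * tr x" if "x \<in> K"
    by (simp add: field_trace_def Let_def mult.assoc rat_vs.representation_scale B0 K_mult that B0K sum_distrib_left)
  show "tr 1 = of_nat deg"
    by (simp add: field_trace_def Let_def rat_vs.representation_basis B0 deg_def)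
qed

lemma trace_zero: "tr 0 = 0"
  using trace_scale[OF K_zero, of 0] by simp

lemma trace_sum: "(\<And>i. i \<in> A \<Longrightarrow> f i \<in> K) \<Longrightarrow> tr (sum f A) = (\<Sum>i\<in>A. tr (f i))"
  by (induction A rule: infinite_finite_induct) (auto simp: trace_zero trace_add K_sum)

lemma trace_diff: "x \<in> K \<Longrightarrow> y \<in> K \<Longrightarrow> tr (x - y) = tr x - tr y"
  using trace_add[of "x - y" y] K_diff[of x y] by simp

lemma trace_int_scale: "x \<in> K \<Longrightarrow> tr (of_int m * x) = of_int m * tr x"
  using trace_scale[of x "of_int m"] by simp

lemma deg_pos: "deg > 0"
proof (rule ccontr)
  assume "\<not> deg > 0"
  then have "B\<^sub>0 = {}" using finite_B0 by (simp add: deg_def)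
  then have "K = {0}" using some_rat_basis by (simp add: rat_basis_def)
  then show False using K_one by simp
qed

text \<open>Pairing a nonzero z with its inverse gives Tr(1) = \<open>deg\<close>, which is not
  0.\<close>

lemma trace_nondegenerate:
  assumes b: "qbasis K J b" and z: "z \<in> K" and 0: "\<And>j. j \<in> J \<Longrightarrow> tr (z * b j) = 0"
  shows "z = 0"
proof (rule ccontr)
  assume "z \<noteq> 0"
  obtain q where q: "inverse z = (\<Sum>j\<in>J. of_rat (q j) * b j)"
    using qbasisD(3)[OF b K_inverse[OF z]] by blast
  have "tr 1 = tr (z * inverse z)" using \<open>z \<noteq> 0\<close> by simp
  also have "\<dots> = (\<Sum>j\<in>J. q j * tr (z * b j))"
    unfolding q sum_distrib_left mult.left_commute[of z]
    by (subst trace_sum) (auto intro!: K_scale K_mult z qbasisD(2)[OF b] trace_scale sum.cong)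
  finally show False using 0 deg_pos trace_one by simp
qed

end

section \<open>Gram determinants and lattices\<close>

lemma det_Ints:
  fixes A :: "rat mat"
  assumes A: "A \<in> carrier_mat n n" and "\<And>i j. i < n \<Longrightarrow> j < n \<Longrightarrow> A $$ (i, j) \<in> \<int>"
  shows "det A \<in> \<int>"
proof -
  have "A = of_int_hom.mat_hom (map_mat floor A)"
    by (rule eq_matI) (use assms in \<open>auto elim!: Ints_cases\<close>)
  then have "det A = of_int (det (map_mat floor A))"
    by (metis of_int_hom.hom_det)
  then show ?thesis by simp
qed

text \<open>In the Leibniz formula only the identity contributes: a permutation that fixes every
  index except k also fixes k.\<close>

lemma det_replaced_identity_row:
  fixes q :: "nat \<Rightarrow> 'a :: comm_ring_1"
  assumes "k < n"
  shows "det (mat n n (\<lambda>(i, j). if i = k then q j else if i = j then 1 else 0)) = q k" (is "det ?A = _")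
proof -
  have A: "?A \<in> carrier_mat n n" by simp
  have perm: "p = id" if p: "p permutes {0..<n}" "\<And>i. i < n \<Longrightarrow> i \<noteq> k \<Longrightarrow> p i = i" for p
  proof
    fix i
    have "p k = k"
    proof (rule ccontr)
      assume "p k \<noteq> k"
      moreover have "p k < n" using p(1) assms permutes_in_image[OF p(1), of k] by simp
      ultimately have "p (p k) = p k" using p(2) by blast
      then show False using permutes_inj[OF p(1)] \<open>p k \<noteq> k\<close> by (meson injD)
    qed
    then show "p i = id i" using p permutes_not_in[OF p(1), of i] by (cases "i < n"; cases "i = k") auto
  qed
  have zero: "signof p * (\<Prod>i = 0..<n. ?A $$ (i, p i)) = 0"
    if p: "p permutes {0..<n}" "p \<noteq> id" for p
  proof -
    obtain i where i: "i < n" "i \<noteq> k" "p i \<noteq> i" using perm p by metis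
    have "p i < n" using p(1) i(1) permutes_in_image[OF p(1), of i] by simp
    then have "?A $$ (i, p i) = 0" using i by simp
    then have "(\<Prod>i = 0..<n. ?A $$ (i, p i)) = 0" using i by (intro prod_zero) auto
    then show ?thesis by simp
  qed
  have "det ?A = (\<Sum>p\<in>{p. p permutes {0..<n}}. if p = id then (\<Prod>i = 0..<n. ?A $$ (i, i)) else 0)"
    unfolding det_def'[OF A] by (intro sum.cong refl) (use zero in \<open>auto simp: id_def\<close>)
  also have "\<dots> = (\<Prod>i = 0..<n. ?A $$ (i, i))"
    by (simp add: finite_permutations permutes_id)
  also have "\<dots> = (\<Prod>i = 0..<n. if i = k then q k else 1)"
    by (intro prod.cong) auto
  also have "\<dots> = q k" using assms by simp
  finally show ?thesis .
qed

context num_field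
begin

definition gram :: "nat \<Rightarrow> (nat \<Rightarrow> complex) \<Rightarrow> rat mat" where
  "gram n b = mat n n (\<lambda>(i, j). tr (b i * b j))"

lemma gram_carrier [simp]: "gram n b \<in> carrier_mat n n"
  by (simp add: gram_def)

definition fdisc :: "nat \<Rightarrow> (nat \<Rightarrow> complex) \<Rightarrow> rat" where
  "fdisc n b = det (gram n b)"

lemma trace_sum_scale:
  assumes "\<And>i. i \<in> A \<Longrightarrow> f i \<in> K"
  shows "tr (\<Sum>i\<in>A. of_rat (q i) * f i) = (\<Sum>i\<in>A. q i * tr (f i))"
  using assms by (subst trace_sum) (auto intro!: K_scale sum.cong trace_scale)

text \<open>With U the transition matrix, the new Gram matrix is U G U^T.\<close>

lemma fdisc_change:
  assumes b: "\<And>j. j < n \<Longrightarrow> b j \<in> K"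
    and b': "\<And>i. i < n \<Longrightarrow> b' i = (\<Sum>j<n. of_rat (u i j) * b j)"
  shows "fdisc n b' = (det (mat n n (\<lambda>(i, j). u i j)))\<^sup>2 * fdisc n b"
proof -
  let ?U = "mat n n (\<lambda>(i, j). u i j)"
  have U: "?U \<in> carrier_mat n n" by simp
  have "tr (b' i * b' j) = (\<Sum>k<n. \<Sum>l<n. u i l * tr (b l * b k) * u j k)" if "i < n" "j < n" for i j
  proof -
    have "b' i * b' j = (\<Sum>l<n. \<Sum>k<n. (of_rat (u i l) * b l) * (of_rat (u j k) * b k))"
      by (simp only: b'[OF that(1)] b'[OF that(2)] sum_product)
    also have "\<dots> = (\<Sum>k<n. \<Sum>l<n. (of_rat (u i l) * b l) * (of_rat (u j k) * b k))"
      by (rule sum.swap)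
    also have "\<dots> = (\<Sum>k<n. \<Sum>l<n. of_rat (u i l * u j k) * (b l * b k))"
      by (intro sum.cong refl) (simp add: of_rat_mult)
    also have "tr \<dots> = (\<Sum>k<n. tr (\<Sum>l<n. of_rat (u i l * u j k) * (b l * b k)))"
      by (rule trace_sum) (intro K_sum K_scale K_mult b; simp)
    also have "\<dots> = (\<Sum>k<n. \<Sum>l<n. (u i l * u j k) * tr (b l * b k))"
      by (intro sum.cong refl trace_sum_scale K_mult b) simp_all
    also have "\<dots> = (\<Sum>k<n. \<Sum>l<n. u i l * tr (b l * b k) * u j k)"
      by (intro sum.cong refl) simp
    finally show ?thesis .
  qed
  then have "gram n b' = ?U * gram n b * ?U\<^sup>T"
    by (intro eq_matI) (auto simp: gram_def scalar_prod_def atLeast0LessThan sum_distrib_right)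
  then have "fdisc n b' = det ?U * det (gram n b) * det (?U\<^sup>T)"
    unfolding fdisc_def using det_mult[of "?U * gram n b" n "?U\<^sup>T"] det_mult[OF U gram_carrier[of n b]]
    by (metis U gram_carrier mult_carrier_mat transpose_carrier_mat)
  then show ?thesis by (simp add: det_transpose[OF U] power2_eq_square fdisc_def)
qed

text \<open>The transition matrix is the identity outside row k, so its determinant is the single
  coordinate \<open>q k\<close>. The formula serves twice: to lower a Gram determinant, and to
  exchange basis elements for elements of the radical.\<close>

lemma fdisc_replace:
  assumes b: "\<And>j. j < n \<Longrightarrow> b j \<in> K" and k: "k < n"
    and x: "x = (\<Sum>j<n. of_rat (q j) * b j)"
  shows "fdisc n (b(k := x)) = (q k)\<^sup>2 * fdisc n b"
proof -
  have "(b(k := x)) i = (\<Sum>j<n. of_rat (if i = k then q j else if i = j then 1 else 0) * b j)" if "i < n" for i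
    using that x by (simp add: if_distrib[of of_rat] if_distrib[of "\<lambda>x. x * _"] cong: if_cong)
  note row = this
  have "fdisc n (b(k := x)) = (det (mat n n (\<lambda>(i, j). if i = k then q j else if i = j then 1 else 0)))\<^sup>2 * fdisc n b"
    by (rule fdisc_change) (use b row in simp_all)
  then show ?thesis
    using det_replaced_identity_row[OF k, of q] by simp
qed

lemma gram_mult_vec:
  assumes "\<And>j. j < n \<Longrightarrow> b j \<in> K" "i < n"
  shows "tr (b i * (\<Sum>j<n. of_rat (q j) * b j)) = (\<Sum>j<n. tr (b i * b j) * q j)"
proof -
  have "b i * (\<Sum>j<n. of_rat (q j) * b j) = (\<Sum>j<n. of_rat (q j) * (b i * b j))"
    by (simp add: sum_distrib_left algebra_simps)
  also have "tr \<dots> = (\<Sum>j<n. q j * tr (b i * b j))"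
    by (rule trace_sum_scale) (auto intro!: K_mult assms)
  finally show ?thesis by (simp add: mult.commute)
qed

lemma fdisc_nonzero:
  assumes "qbasis K {..<n} b"
  shows "fdisc n b \<noteq> 0"
proof
  assume "fdisc n b = 0"
  then obtain v where v: "v \<in> carrier_vec n" "v \<noteq> 0\<^sub>v n" "gram n b *\<^sub>v v = 0\<^sub>v n"
    unfolding fdisc_def det_0_iff_vec_prod_zero_field[OF gram_carrier] by blast
  define z where "z = (\<Sum>j<n. of_rat (vec_index v j) * b j)"
  have bK: "b j \<in> K" if "j < n" for j using qbasisD(2)[OF assms] that by simp
  have zK: "z \<in> K" unfolding z_def by (intro K_sum K_scale bK) simp
  have "tr (z * b i) = 0" if "i < n" for i
  proof -
    have "tr (b i * z) = (\<Sum>j<n. tr (b i * b j) * vec_index v j)"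
      unfolding z_def by (rule gram_mult_vec[OF bK that])
    also have "\<dots> = vec_index (gram n b *\<^sub>v v) i"
      using v(1) that by (simp add: gram_def scalar_prod_def atLeast0LessThan)
    finally show ?thesis using v(3) that by (simp add: mult.commute)
  qed
  then have "z = 0" using trace_nondegenerate[OF assms zK] by simp
  then have "vec_index v j = 0" if "j < n" for j
    using qbasisD(4)[OF assms, of "\<lambda>j. vec_index v j" j] that by (simp add: z_def)
  then show False using v(1,2) by (auto intro: eq_vecI)
qed

text \<open>A rational relation among the \<open>b j\<close> is a kernel vector of the Gram matrix,
  which a nonzero determinant excludes.\<close>

lemma qbasis_of_fdisc:
  fixes n :: nat
  assumes b: "\<And>j. j < n \<Longrightarrow> b j \<in> K" and n: "n = deg" and nz: "fdisc n b \<noteq> 0"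
  shows "qbasis K {..<n} b"
proof (rule independent_imp_qbasis)
  fix q j assume 0: "(\<Sum>j<n. of_rat (q j) * b j) = 0" and j: "j \<in> {..<n}"
  have "gram n b *\<^sub>v vec n q = 0\<^sub>v n"
  proof (rule eq_vecI)
    fix i assume "i < dim_vec (0\<^sub>v n :: rat vec)"
    then have i: "i < n" by simp
    have "vec_index (gram n b *\<^sub>v vec n q) i = (\<Sum>j<n. tr (b i * b j) * q j)"
      using i by (simp add: gram_def scalar_prod_def atLeast0LessThan)
    also have "\<dots> = tr (b i * (\<Sum>j<n. of_rat (q j) * b j))"
      by (rule gram_mult_vec[OF b i, symmetric])
    finally show "vec_index (gram n b *\<^sub>v vec n q) i = vec_index (0\<^sub>v n) i" using 0 i by (simp add: trace_zero)
  qed (simp add: gram_def)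
  then have "vec n q = 0\<^sub>v n"
    using nz det_0_iff_vec_prod_zero_field[OF gram_carrier[of n b]] vec_carrier[of n q]
    unfolding fdisc_def by blast
  then show "q j = 0" using j by (metis index_vec index_zero_vec(1) lessThan_iff)
qed (use b n in auto)

text \<open>A rational basis of \<open>K\<close> inside \<open>M\<close> whose Gram determinant is minimal in absolute value
  generates \<open>M\<close>, since otherwise reducing a fractional coordinate would decrease it.\<close>

lemma ex_lattice_basis:
  fixes n :: nat
  assumes M: "int_mod.subspace M" "M \<subseteq> K"
    and D: "D > 0" "\<And>x y. x \<in> M \<Longrightarrow> y \<in> M \<Longrightarrow> of_int D * tr (x * y) \<in> \<int>"
    and b0: "qbasis K {..<n} b\<^sub>0" "\<And>j. j < n \<Longrightarrow> b\<^sub>0 j \<in> M"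
  obtains b where "qbasis K {..<n} b" "\<And>j. j < n \<Longrightarrow> b j \<in> M"
    "\<And>x. x \<in> M \<Longrightarrow> \<exists>m. x = (\<Sum>j<n. of_int (m j) * b j)"
proof -
  have n: "n = deg" using card_qbasis[OF b0(1)] by simp
  define P where "P b \<longleftrightarrow> qbasis K {..<n} b \<and> (\<forall>j<n. b j \<in> M)" for b
  \<comment> \<open>The factor D^n clears the denominators of the n rows, so the values are natural
    numbers and a least one exists.\<close>
  define \<mu> where "\<mu> b = nat \<lfloor>of_int D ^ n * \<bar>fdisc n b\<bar>\<rfloor>" for b
  have \<mu>: "of_nat (\<mu> b) = of_int D ^ n * \<bar>fdisc n b\<bar>" if "P b" for b
  proof -
    have "of_int D ^ n * fdisc n b = det (of_int D \<cdot>\<^sub>m gram n b)"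
      by (simp add: fdisc_def gram_def)
    also have "\<dots> \<in> \<int>"
      by (rule det_Ints[of _ n]) (use that D(2) in \<open>auto simp: P_def gram_def\<close>)
    finally have "\<bar>of_int D ^ n * fdisc n b\<bar> \<in> \<int>" by simp
    then have "of_int D ^ n * \<bar>fdisc n b\<bar> \<in> \<int>" using D(1) by (simp add: abs_mult)
    then obtain k where k: "of_int D ^ n * \<bar>fdisc n b\<bar> = of_int k" by (auto elim: Ints_cases)
    have "of_int k \<ge> (0::rat)" unfolding k[symmetric] using D(1) by simp
    then show ?thesis unfolding \<mu>_def k by simp
  qed
  have "P b\<^sub>0" using b0 by (simp add: P_def)
  then obtain b where b: "P b" and min: "\<And>b'. P b' \<Longrightarrow> \<mu> b \<le> \<mu> b'"
    using ex_has_least_nat[of P b\<^sub>0 \<mu>] by blast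
  have qb: "qbasis K {..<n} b" and bM: "\<And>j. j < n \<Longrightarrow> b j \<in> M" using b by (auto simp: P_def)
  have bK: "\<And>j. j < n \<Longrightarrow> b j \<in> K" using bM M by blast
  have "\<exists>m. x = (\<Sum>j<n. of_int (m j) * b j)" if x: "x \<in> M" for x
  proof -
    obtain q where q: "x = (\<Sum>j<n. of_rat (q j) * b j)" using qbasisD(3)[OF qb, of x] x M by blast
    have "q k \<in> \<int>" if k: "k < n" for k
    proof (rule ccontr)
      assume "q k \<notin> \<int>"
      then have fr: "0 < frac (q k)" "frac (q k) < 1" by (auto simp: frac_gt_0_iff frac_lt_1)
      define x' where "x' = x - of_int \<lfloor>q k\<rfloor> * b k"
      have x'M: "x' \<in> M"
        unfolding x'_def using M(1) x bM[OF k]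
        by (simp add: int_mod.subspace_diff int_mod.subspace_scale)
      define q' where "q' = q(k := frac (q k))"
      have x': "x' = (\<Sum>j<n. of_rat (q' j) * b j)"
      proof -
        have "x' = (\<Sum>j<n. of_rat (q j) * b j) - (\<Sum>j<n. of_rat (if j = k then of_int \<lfloor>q k\<rfloor> else 0) * b j)"
          using k by (simp add: x'_def q if_distrib[of of_rat] if_distrib[of "\<lambda>x. x * _"] cong: if_cong)
        also have "\<dots> = (\<Sum>j<n. of_rat (q j - (if j = k then of_int \<lfloor>q k\<rfloor> else 0)) * b j)"
          by (simp add: of_rat_diff left_diff_distrib sum_subtractf)
        also have "\<dots> = (\<Sum>j<n. of_rat (q' j) * b j)"
          by (intro sum.cong) (auto simp: q'_def frac_def)
        finally show ?thesis .
      qed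
      have disc: "fdisc n (b(k := x')) = (frac (q k))\<^sup>2 * fdisc n b"
        using fdisc_replace[OF bK k x'] by (simp add: q'_def)
      have nz: "fdisc n b \<noteq> 0" by (rule fdisc_nonzero[OF qb])
      have "P (b(k := x'))"
        unfolding P_def
      proof
        show "qbasis K {..<n} (b(k := x'))"
          by (rule qbasis_of_fdisc) (use bK x'M M n disc nz fr in auto)
      qed (use bM x'M in auto)
      then have "\<mu> b \<le> \<mu> (b(k := x'))" by (rule min)
      then have "(of_nat (\<mu> b) :: rat) \<le> of_nat (\<mu> (b(k := x')))" by simp
      then have "of_int D ^ n * \<bar>fdisc n b\<bar> \<le> (frac (q k))\<^sup>2 * (of_int D ^ n * \<bar>fdisc n b\<bar>)"
        unfolding \<mu>[OF b] \<mu>[OF \<open>P (b(k := x'))\<close>] disc by (simp add: abs_mult mult.left_commute)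
      moreover have "of_int D ^ n * \<bar>fdisc n b\<bar> > 0" using nz D(1) by simp
      ultimately have "(frac (q k))\<^sup>2 \<ge> 1" by (simp add: mult_le_cancel_right1)
      then show False using fr power_strict_mono[of "frac (q k)" 1 2] by simp
    qed
    then have "\<exists>m. q j = of_int m" if "j < n" for j using that by (auto elim: Ints_cases)
    then obtain m where "\<And>j. j < n \<Longrightarrow> q j = of_int (m j)" by metis
    then show ?thesis using q by (intro exI[of _ m]) simp
  qed
  then show ?thesis using that qb bM by blast
qed

end

section \<open>Integral bases and the discriminant\<close>

lemma algebraic_of_rat_eigen_system:
  fixes g :: "nat \<Rightarrow> complex" and a :: "nat \<Rightarrow> nat \<Rightarrow> rat"
  assumes eq: "\<And>i. i < n \<Longrightarrow> x * g i = (\<Sum>j<n. of_rat (a i j) * g j)"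
    and nz: "i0 < n" "g i0 \<noteq> 0"
  shows "algebraic x"
proof -
  define A where "A = mat n n (\<lambda>(i, j). a i j)"
  have A: "A \<in> carrier_mat n n" by (simp add: A_def)
  define C :: "complex mat" where "C = of_rat_hom.mat_hom A"
  have C: "C \<in> carrier_mat n n" by (simp add: C_def A_def)
  have "C *\<^sub>v vec n g = x \<cdot>\<^sub>v vec n g"
    by (rule eq_vecI) (auto simp: C_def A_def scalar_prod_def eq atLeast0LessThan)
  moreover have "vec n g \<noteq> 0\<^sub>v n"
    using nz by (metis index_vec index_zero_vec(1))
  ultimately have "eigenvector C (vec n g) x"
    using C by (auto simp: eigenvector_def)
  then have "poly (char_poly C) x = 0"
    using eigenvalue_root_char_poly[OF C] eigenvalue_def by blast
  moreover have "char_poly C = map_poly of_rat (char_poly A)"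
    unfolding C_def by (rule of_rat_hom.char_poly_hom[OF A])
  moreover have "char_poly A \<noteq> 0"
    using degree_monic_char_poly[OF A] by auto
  ultimately show ?thesis
    by (intro algebraicI'[of "map_poly of_rat (char_poly A)"]) (auto simp: coeff_map_poly)
qed

text \<open>If u is a root of the polynomial with coefficients \<open>a\<close>, this is the
  coefficient of X^i in its quotient by X - u.\<close>

definition quotient_coeff :: "complex \<Rightarrow> (nat \<Rightarrow> int) \<Rightarrow> nat \<Rightarrow> nat \<Rightarrow> complex" where
  "quotient_coeff u a n i = (\<Sum>k\<in>{i<..n}. of_int (a k) * u ^ (k - Suc i))"

lemma quotient_coeff_step:
  assumes "i < n"
  shows "quotient_coeff u a n i = of_int (a (Suc i)) + u * quotient_coeff u a n (Suc i)"
proof -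
  have "{i<..n} = insert (Suc i) {Suc i<..n}" using assms by auto
  then have "quotient_coeff u a n i = of_int (a (Suc i)) + (\<Sum>k\<in>{Suc i<..n}. of_int (a k) * u ^ (k - Suc i))"
    by (simp add: quotient_coeff_def)
  also have "(\<Sum>k\<in>{Suc i<..n}. of_int (a k) * u ^ (k - Suc i)) = u * quotient_coeff u a n (Suc i)"
    unfolding quotient_coeff_def sum_distrib_left
  proof (intro sum.cong refl)
    fix k assume "k \<in> {Suc i<..n}"
    then have "k - Suc i = Suc (k - Suc (Suc i))" by auto
    then show "of_int (a k) * u ^ (k - Suc i) = u * (of_int (a k) * u ^ (k - Suc (Suc i)))" by simp
  qed
  finally show ?thesis .
qed

lemma quotient_coeff_0:
  "(\<Sum>i\<le>n. of_int (a i) * u ^ i) = of_int (a 0) + u * quotient_coeff u a n 0"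
proof -
  have "{..n} = insert 0 {0<..n}" by auto
  then have "(\<Sum>i\<le>n. of_int (a i) * u ^ i) = of_int (a 0) + (\<Sum>i\<in>{0<..n}. of_int (a i) * u ^ i)"
    by simp
  also have "(\<Sum>i\<in>{0<..n}. of_int (a i) * u ^ i) = u * quotient_coeff u a n 0"
    unfolding quotient_coeff_def sum_distrib_left
  proof (intro sum.cong refl)
    fix k assume "k \<in> {0<..n}"
    then have "k = Suc (k - Suc 0)" by auto
    then show "of_int (a k) * u ^ k = u * (of_int (a k) * u ^ (k - Suc 0))"
      by (metis mult.left_commute power_Suc)
  qed
  finally show ?thesis .
qed

text \<open>Comparing coefficients in the division by X - u writes u b_i as b_(i-1) - a_i, and u b_0
  as -a_0.\<close>

lemma algebraic_int_quotient_coeffs: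
  assumes root: "(\<Sum>i\<le>n. of_int (a i) * u ^ i) = 0" and "i < n"
  shows "algebraic_int (quotient_coeff u a n i)" "algebraic_int (u * quotient_coeff u a n i)"
proof -
  have *: "algebraic_int (quotient_coeff u a n i)" if "i < n" for i
    unfolding quotient_coeff_def by (rule algebraic_int_quotient_coeff[OF root that])
  show "algebraic_int (quotient_coeff u a n i)" using * assms by blast
  show "algebraic_int (u * quotient_coeff u a n i)"
  proof (cases i)
    case 0
    have "u * quotient_coeff u a n i = of_int (- a 0)"
      using quotient_coeff_0[of a u n] root 0 by (simp add: eq_neg_iff_add_eq_0 add.commute)
    then show ?thesis by simp
  next
    case (Suc j)
    then have "u * quotient_coeff u a n i = quotient_coeff u a n j - of_int (a i)"
      using quotient_coeff_step[of j n u a] \<open>i < n\<close> by simp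
    then show ?thesis using *[of j] Suc \<open>i < n\<close> by (simp add: algebraic_int_diff)
  qed
qed

text \<open>The top quotient coefficient is the leading coefficient a_n, so a_n u is
  integral.\<close>

lemma algebraic_denominator:
  fixes u :: complex
  assumes "algebraic u"
  obtains D :: int where "D \<noteq> 0" "algebraic_int (of_int D * u)"
proof -
  obtain n and a :: "nat \<Rightarrow> int" where a:
    "(\<Sum>i\<le>n. of_int (a i) * u ^ i) = 0" "n > 0" "a n \<noteq> 0"
    using primitive_int_relation[OF assms] by metis
  have "{n - 1<..n} = {n}" using a(2) by auto
  then have "quotient_coeff u a n (n - 1) = of_int (a n)"
    using a(2) by (simp add: quotient_coeff_def)
  then show ?thesis using algebraic_int_quotient_coeffs(2)[OF a(1), of "n - 1"] a that[of "a n"]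
    by (simp add: mult.commute)
qed

lemma common_denominator:
  fixes A :: "rat set"
  assumes "finite A"
  obtains D :: int where "D > 0" "\<And>q. q \<in> A \<Longrightarrow> of_int D * q \<in> \<int>"
proof -
  have "\<exists>D::int. D > 0 \<and> (\<forall>q\<in>A. of_int D * q \<in> \<int>)"
    using assms
  proof induction
    case empty
    then show ?case by (intro exI[of _ 1]) simp
  next
    case (insert q A)
    then obtain D :: int where D: "D > 0" "\<forall>q\<in>A. of_int D * q \<in> \<int>" by blast
    obtain a b where "quotient_of q = (a, b)" by fastforce
    then have ab: "b > 0" "q = of_int a / of_int b"
      using quotient_of_denom_pos quotient_of_div by auto
    have "of_int (D * b) * q \<in> \<int>" using ab by simp
    moreover have "of_int (D * b) * r \<in> \<int>" if "r \<in> A" for r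
    proof -
      have "of_int (D * b) * r = of_int b * (of_int D * r)" by simp
      then show ?thesis using D(2) that by (metis Ints_mult Ints_of_int)
    qed
    ultimately show ?case using D(1) ab(1) by (intro exI[of _ "D * b"]) auto
  qed
  then show ?thesis using that by blast
qed

section \<open>Integral elements of K and the integrality of their traces\<close>

context num_field
begin

lemma algebraic_K:
  assumes "x \<in> K" shows "algebraic x"
proof -
  obtain h where h: "bij_betw h {..<deg} B\<^sub>0"
    using ex_bij_betw_nat_finite[OF finite_B0] by (auto simp: deg_def atLeast0LessThan)
  then have b: "qbasis K {..<deg} h"
    using qbasis_reindex[OF h, of K "\<lambda>x. x"] qbasis_B0 by (simp add: o_def)
  obtain q where "\<And>i. i \<in> {..<deg} \<Longrightarrow> x * h i = (\<Sum>j<deg. of_rat (q i j) * h j)"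
    using qbasis_matrix[OF b, of "{..<deg}" "\<lambda>i. x * h i"] qbasisD(2)[OF b] K_mult[OF assms] by metis
  moreover have "h 0 \<noteq> 0"
  proof
    assume "h 0 = 0"
    then have "(\<Sum>j<deg. of_rat (if j = 0 then 1 else 0) * h j) = 0"
      by (intro sum.neutral) auto
    from qbasisD(4)[OF b this, of 0] show False using deg_pos by simp
  qed
  ultimately show ?thesis using deg_pos by (intro algebraic_of_rat_eigen_system[of deg x h q 0]) auto
qed

lemma ex_qbasis_nat: obtains b where "qbasis K {..<deg} b" "b ` {..<deg} = B\<^sub>0"
proof -
  obtain h where h: "bij_betw h {..<deg} B\<^sub>0"
    using ex_bij_betw_nat_finite[OF finite_B0] by (auto simp: deg_def atLeast0LessThan)
  then show ?thesis
    using qbasis_reindex[OF h, of K "\<lambda>x. x"] qbasis_B0 that[of h] by (simp add: o_def bij_betw_def)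
qed

lemma qbasis_scale:
  assumes b: "qbasis K J b" and d: "\<And>j. j \<in> J \<Longrightarrow> d j \<noteq> 0"
  shows "qbasis K J (\<lambda>j. of_int (d j) * b j)"
proof (rule independent_imp_qbasis)
  fix q j assume "(\<Sum>j\<in>J. of_rat (q j) * (of_int (d j) * b j)) = 0" "j \<in> J"
  then show "q j = 0"
    using qbasisD(4)[OF b, of "\<lambda>j. q j * of_int (d j)" j] d[of j] by (simp add: of_rat_mult mult.assoc)
qed (use b card_qbasis[OF b] qbasisD(1,2)[OF b] in \<open>auto intro: K_mult K_of_int\<close>)

abbreviation "\<O> \<equiv> integers_of K"

lemma O_iff: "x \<in> \<O> \<longleftrightarrow> x \<in> K \<and> algebraic_int x"
  by (simp add: integers_of_def)

lemma O_K: "x \<in> \<O> \<Longrightarrow> x \<in> K"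
  and O_add: "x \<in> \<O> \<Longrightarrow> y \<in> \<O> \<Longrightarrow> x + y \<in> \<O>"
  and O_diff: "x \<in> \<O> \<Longrightarrow> y \<in> \<O> \<Longrightarrow> x - y \<in> \<O>"
  and O_neg: "x \<in> \<O> \<Longrightarrow> - x \<in> \<O>"
  and O_mult: "x \<in> \<O> \<Longrightarrow> y \<in> \<O> \<Longrightarrow> x * y \<in> \<O>"
  and O_of_int: "of_int m \<in> \<O>"
  and O_zero: "0 \<in> \<O>" and O_one: "1 \<in> \<O>"
  by (auto simp: O_iff K_add K_diff K_neg K_mult K_of_int K_zero K_one algebraic_int_add algebraic_int_diff
      algebraic_int_mult)

lemma O_sum: "(\<And>i. i \<in> A \<Longrightarrow> f i \<in> \<O>) \<Longrightarrow> sum f A \<in> \<O>"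
  by (simp add: O_iff K_sum algebraic_int_sum)

lemma subspace_O: "int_mod.subspace \<O>"
  by (rule int_mod.subspaceI) (auto simp: O_zero O_add O_mult O_of_int)

text \<open>The integers of K are not yet known to have a finite basis, as that depends on this
  lemma. Instead x acts on the lattice M spanned by the products x^i b, with b in the chosen
  rational basis; in a lattice basis of M its matrix is integral.\<close>

lemma trace_int:
  assumes "x \<in> \<O>"
  shows "tr x \<in> \<int>"
proof -
  obtain m where m: "m > 0" "x ^ m \<in> int_mod.span ((\<lambda>i. x ^ i) ` {..<m})"
    using algebraic_int_power_span assms O_iff by blast
  define S where "S = (\<lambda>(i, b). x ^ i * b) ` ({..<m} \<times> B\<^sub>0)"
  define M where "M = int_mod.span S"
  have fin: "finite S" using finite_B0 by (simp add: S_def)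
  have B0K: "b \<in> K" if "b \<in> B\<^sub>0" for b using qbasisD(2)[OF qbasis_B0] that .
  have SK: "S \<subseteq> K" using assms B0K by (auto simp: S_def O_iff intro!: K_mult K_power)
  have int_sub: "int_mod.subspace K"
    by (rule int_mod.subspaceI) (auto simp: K_zero K_add K_mult K_of_int)
  have MK: "M \<subseteq> K" unfolding M_def by (rule int_mod.span_minimal[OF SK int_sub])
  have xS: "x * s \<in> M" if "s \<in> S" for s
  proof -
    obtain i b where ib: "i < m" "b \<in> B\<^sub>0" "s = x ^ i * b" using \<open>s \<in> S\<close> by (auto simp: S_def)
    have S: "x ^ i * b \<in> S" if "i < m" for i using that ib by (auto simp: S_def)
    show ?thesis
    proof (cases "Suc i < m")
      case True
      have "x * s = x ^ Suc i * b" using ib by simp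
      then show ?thesis using S[OF True] unfolding M_def by (metis int_mod.span_base)
    next
      case False
      then have "Suc i = m" using ib by simp
      then have "x * s = b * x ^ m" using ib by auto
      also have "\<dots> \<in> M"
        unfolding M_def by (rule int_span_mult_left[OF _ m(2)])
          (use S in \<open>auto simp: mult.commute[of b] intro: int_mod.span_base\<close>)
      finally show ?thesis .
    qed
  qed
  have xM: "x * y \<in> M" if "y \<in> M" for y
    using int_span_mult_left[of S x S y] xS that unfolding M_def by blast
  \<comment> \<open>The trace form need not be integral on M. D clears the denominators on the
    finitely many products of generators, hence on all of M.\<close>
  obtain D :: int where D: "D > 0" "\<And>q. q \<in> (\<lambda>(s, t). tr (s * t)) ` (S \<times> S) \<Longrightarrow> of_int D * q \<in> \<int>"
    using common_denominator[of "(\<lambda>(s, t). tr (s * t)) ` (S \<times> S)"] fin by blast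
  have ext: "of_int D * tr (s * y) \<in> \<int>" if s: "s \<in> K" "\<And>t. t \<in> S \<Longrightarrow> of_int D * tr (s * t) \<in> \<int>"
    and y: "y \<in> int_mod.span S" for s y
  proof -
    have "y \<in> K \<and> of_int D * tr (s * y) \<in> \<int>"
      using y
    proof (induction rule: int_mod.span_induct_alt)
      case base
      then show ?case by (simp add: trace_zero K_zero)
    next
      case (step c t y)
      have eq: "s * (of_int c * t + y) = of_int c * (s * t) + s * y" by (simp add: algebra_simps)
      have K: "t \<in> K" "y \<in> K" using step SK by auto
      have "tr (s * (of_int c * t + y)) = of_int c * tr (s * t) + tr (s * y)"
        unfolding eq using s(1) K by (simp add: trace_add trace_int_scale K_mult K_of_int)
      then have "of_int D * tr (s * (of_int c * t + y)) = of_int c * (of_int D * tr (s * t)) + of_int D * tr (s * y)"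
        by (simp add: distrib_left)
      then show ?case using s(2)[OF step(1)] step(2) K by (simp add: K_add K_mult K_of_int)
    qed
    then show ?thesis by blast
  qed
  have DM: "of_int D * tr (y * z) \<in> \<int>" if "y \<in> M" "z \<in> M" for y z
  proof (rule ext)
    fix t assume t: "t \<in> S"
    have "of_int D * tr (t * y) \<in> \<int>"
      by (rule ext) (use D(2) t SK that in \<open>auto simp: M_def\<close>)
    then show "of_int D * tr (y * t) \<in> \<int>" by (simp add: mult.commute)
  qed (use that MK in \<open>auto simp: M_def\<close>)
  obtain b0 where b0: "qbasis K {..<deg} b0" "b0 ` {..<deg} = B\<^sub>0" by (rule ex_qbasis_nat)
  have b0M: "b0 j \<in> M" if "j < deg" for j
  proof -
    have "b0 j \<in> B\<^sub>0" using b0(2) that by blast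
    then have "b0 j \<in> S" unfolding S_def using m(1) by (intro image_eqI[of _ _ "(0, b0 j)"]) auto
    then show ?thesis unfolding M_def by (rule int_mod.span_base)
  qed
  obtain b where b: "qbasis K {..<deg} b" "\<And>j. j < deg \<Longrightarrow> b j \<in> M"
    "\<And>x. x \<in> M \<Longrightarrow> \<exists>m. x = (\<Sum>j<deg. of_int (m j) * b j)"
    using ex_lattice_basis[OF _ MK D(1) DM b0(1) b0M] int_mod.subspace_span M_def by metis
  have "\<forall>j. \<exists>m. j < deg \<longrightarrow> x * b j = (\<Sum>k<deg. of_int (m k) * b k)"
    using b(3) xM b(2) by blast
  then obtain q where q: "\<And>j. j < deg \<Longrightarrow> x * b j = (\<Sum>k<deg. of_int (q j k) * b k)" by metis
  have "tr x = (\<Sum>j<deg. of_int (q j j))"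
    by (rule trace_qbasis[OF b(1)]) (use assms q in \<open>auto simp: O_iff\<close>)
  then show ?thesis by (simp add: Ints_sum)
qed

section \<open>Existence of integral bases and invariance of the discriminant\<close>

definition zbasis :: "(nat \<Rightarrow> complex) \<Rightarrow> bool" where
  "zbasis \<alpha> \<longleftrightarrow> qbasis K {..<deg} \<alpha> \<and> (\<forall>j<deg. \<alpha> j \<in> \<O>) \<and>
     (\<forall>x\<in>\<O>. \<exists>m. x = (\<Sum>j<deg. of_int (m j) * \<alpha> j))"

lemma zbasisD:
  assumes "zbasis \<alpha>"
  shows "qbasis K {..<deg} \<alpha>" "j < deg \<Longrightarrow> \<alpha> j \<in> \<O>" "x \<in> \<O> \<Longrightarrow> \<exists>m. x = (\<Sum>j<deg. of_int (m j) * \<alpha> j)"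
  using assms by (auto simp: zbasis_def)

lemma ex_integral_qbasis: obtains b where "qbasis K {..<deg} b" "\<And>j. j < deg \<Longrightarrow> b j \<in> \<O>"
proof -
  obtain b0 where b0: "qbasis K {..<deg} b0" using ex_qbasis_nat by blast
  have "\<exists>D. j < deg \<longrightarrow> D \<noteq> 0 \<and> algebraic_int (of_int D * b0 j)" for j
    using algebraic_denominator[OF algebraic_K] qbasisD(2)[OF b0, of j] by (metis lessThan_iff)
  then obtain d where "\<And>j. j < deg \<Longrightarrow> d j \<noteq> 0 \<and> algebraic_int (of_int (d j) * b0 j)" by metis
  then show ?thesis
    using qbasis_scale[OF b0, of d] that[of "\<lambda>j. of_int (d j) * b0 j"] qbasisD(2)[OF b0]
    by (simp add: O_iff K_mult K_of_int)
qed

text \<open>Since traces of integers are integral, the lattice argument applies to \<O> itself with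
  D = 1.\<close>

lemma ex_zbasis: obtains \<alpha> where "zbasis \<alpha>"
proof -
  obtain b0 where b0: "qbasis K {..<deg} b0" "\<And>j. j < deg \<Longrightarrow> b0 j \<in> \<O>"
    using ex_integral_qbasis by blast
  have OK: "\<O> \<subseteq> K" by (auto simp: O_iff)
  obtain b where "qbasis K {..<deg} b" "\<And>j. j < deg \<Longrightarrow> b j \<in> \<O>"
    "\<And>x. x \<in> \<O> \<Longrightarrow> \<exists>m. x = (\<Sum>j<deg. of_int (m j) * b j)"
    using ex_lattice_basis[OF subspace_O OK, of 1 deg b0] b0 trace_int O_mult by auto
  then have "zbasis b" unfolding zbasis_def by blast
  then show ?thesis by (rule that)
qed

lemma zbasis_fdisc_multiple:
  assumes "zbasis \<alpha>" "zbasis \<beta>"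
  obtains k :: int where "fdisc deg \<beta> = (of_int k)\<^sup>2 * fdisc deg \<alpha>"
proof -
  have "\<forall>i. \<exists>m. i < deg \<longrightarrow> \<beta> i = (\<Sum>j<deg. of_int (m j) * \<alpha> j)"
    using zbasisD(3)[OF assms(1)] zbasisD(2)[OF assms(2)] by blast
  then obtain m where m: "\<And>i. i < deg \<Longrightarrow> \<beta> i = (\<Sum>j<deg. of_int (m i j) * \<alpha> j)" by metis
  have "fdisc deg \<beta> = (det (mat deg deg (\<lambda>(i, j). of_int (m i j))))\<^sup>2 * fdisc deg \<alpha>"
    using zbasisD(2)[OF assms(1)] m by (intro fdisc_change) (auto simp: O_iff)
  moreover have "det (mat deg deg (\<lambda>(i, j). of_int (m i j) :: rat)) \<in> \<int>"
    by (rule det_Ints[of _ deg]) auto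
  then obtain k where "det (mat deg deg (\<lambda>(i, j). of_int (m i j) :: rat)) = of_int k"
    by (elim Ints_cases)
  ultimately show ?thesis using that[of k] by simp
qed

text \<open>Each discriminant is the other one times an integer square, and as they are nonzero both
  squares are 1.\<close>

lemma zbasis_fdisc_unique:
  assumes "zbasis \<alpha>" "zbasis \<beta>"
  shows "fdisc deg \<alpha> = fdisc deg \<beta>"
proof -
  obtain k :: int where k: "fdisc deg \<beta> = (of_int k)\<^sup>2 * fdisc deg \<alpha>" using zbasis_fdisc_multiple assms by blast
  obtain l :: int where l: "fdisc deg \<alpha> = (of_int l)\<^sup>2 * fdisc deg \<beta>" using zbasis_fdisc_multiple assms by blast
  have "fdisc deg \<alpha> \<noteq> 0" using fdisc_nonzero zbasisD(1)[OF assms(1)] .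
  then have "of_int (l\<^sup>2 * k\<^sup>2) = (1::rat)" using l[unfolded k] by simp
  then have "l\<^sup>2 * k\<^sup>2 = 1" using of_int_eq_1_iff by blast
  then have "k\<^sup>2 dvd 1" by (metis dvd_triv_right)
  then have "k\<^sup>2 = 1" by simp
  then have "(of_int k :: rat)\<^sup>2 = 1" by (metis of_int_1 of_int_power)
  then show ?thesis using k by simp
qed

text \<open>Clearing denominators turns a rational relation into an integral one and an element of K
  into an integral element. Hence independence and spanning over the integers yield a rational
  basis, which fixes the length.\<close>

lemma integral_basis_imp_zbasis:
  assumes "integral_basis K bs"
  shows "length bs = deg" "zbasis ((!) bs)"
proof -
  let ?n = "length bs"
  have bs: "distinct bs" "int_mod.independent (set bs)" "int_mod.span (set bs) = \<O>"
    using assms by (auto simp: integral_basis_def)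
  have bij: "bij_betw ((!) bs) {..<?n} (set bs)" using bij_betw_nth[OF bs(1)] by blast
  have sum: "(\<Sum>j<?n. f (bs ! j) * bs ! j) = (\<Sum>v\<in>set bs. f v * v)" for f :: "complex \<Rightarrow> complex"
    using sum.reindex_bij_betw[OF bij, of "\<lambda>v. f v * v"] .
  have O: "bs ! j \<in> \<O>" if "j < ?n" for j
    using bs(3) int_mod.span_base[of "bs ! j" "set bs"] that by simp
  have span: "\<exists>m. x = (\<Sum>j<?n. of_int (m j) * bs ! j)" if x: "x \<in> \<O>" for x
  proof -
    obtain u where "x = (\<Sum>v\<in>set bs. of_int (u v) * v)"
      using x bs(3) int_mod.span_finite[of "set bs"] by auto
    then show ?thesis using sum[of "\<lambda>v. of_int (u v)"] by (intro exI[of _ "\<lambda>j. u (bs ! j)"]) simp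
  qed
  have qb: "qbasis K {..<?n} ((!) bs)"
    unfolding qbasis_def
  proof (intro conjI ballI allI impI)
    fix x assume x: "x \<in> K"
    obtain D :: int where D: "D \<noteq> 0" "algebraic_int (of_int D * x)"
      using algebraic_denominator[OF algebraic_K[OF x]] by blast
    then have "of_int D * x \<in> \<O>" using x by (simp add: O_iff K_mult K_of_int)
    then obtain m where "of_int D * x = (\<Sum>j<?n. of_int (m j) * bs ! j)" using span by blast
    then have "x = (\<Sum>j<?n. of_int (m j) * bs ! j) / of_int D" using D(1) by (simp add: field_simps)
    also have "\<dots> = (\<Sum>j<?n. of_rat (of_int (m j) / of_int D) * bs ! j)"
      by (simp add: sum_divide_distrib of_rat_divide)
    finally show "\<exists>q. x = (\<Sum>j<?n. of_rat (q j) * bs ! j)"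
      by (intro exI[of _ "\<lambda>j. of_int (m j) / of_int D"])
  next
    fix q j assume q: "(\<Sum>j<?n. of_rat (q j) * bs ! j) = 0" and j: "j \<in> {..<?n}"
    obtain D :: int where D: "D > 0" "\<And>r. r \<in> q ` {..<?n} \<Longrightarrow> of_int D * r \<in> \<int>"
      using common_denominator[of "q ` {..<?n}"] by auto
    then have "\<forall>j. \<exists>m. j < ?n \<longrightarrow> of_int D * q j = of_int m" by (auto elim!: Ints_cases)
    then obtain m where m: "\<And>j. j < ?n \<Longrightarrow> of_int D * q j = of_int (m j)" by metis
    have m': "of_int D * of_rat (q j) = (of_int (m j) :: complex)" if "j < ?n" for j
      using arg_cong[OF m[OF that], of "of_rat :: rat \<Rightarrow> complex"] by (simp add: of_rat_mult)
    define f where "f v = m (the_inv_into {..<?n} ((!) bs) v)" for v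
    have f: "f (bs ! j) = m j" if "j < ?n" for j
      using that bij unfolding f_def bij_betw_def by (simp add: the_inv_into_f_f)
    have "0 = of_int D * (\<Sum>j<?n. of_rat (q j) * bs ! j)" using q by simp
    also have "\<dots> = (\<Sum>j<?n. of_int (m j) * bs ! j)"
      unfolding sum_distrib_left by (intro sum.cong refl) (simp add: m' flip: mult.assoc)
    also have "\<dots> = (\<Sum>j<?n. of_int (f (bs ! j)) * bs ! j)" by (simp add: f)
    also have "\<dots> = (\<Sum>v\<in>set bs. of_int (f v) * v)" by (rule sum)
    finally have "f (bs ! j) = 0"
      using int_mod.independentD[OF bs(2), of "set bs" f "bs ! j"] j by simp
    then show "q j = 0" using f[of j] m[of j] j D(1) by auto
  qed (use O in \<open>auto simp: O_iff\<close>)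
  show len: "?n = deg" using card_qbasis[OF qb] by simp
  show "zbasis ((!) bs)" unfolding zbasis_def using qb O span len by metis
qed

lemma zbasis_imp_integral_basis:
  assumes "zbasis \<alpha>"
  shows "integral_basis K (map \<alpha> [0..<deg])"
proof -
  have inj: "inj_on \<alpha> {..<deg}" using qbasis_inj_on[OF zbasisD(1)[OF assms]] .
  have set: "set (map \<alpha> [0..<deg]) = \<alpha> ` {..<deg}" by (auto simp: atLeast0LessThan)
  have sum: "(\<Sum>v\<in>\<alpha> ` {..<deg}. of_int (u v) * v) = (\<Sum>j<deg. of_int (u (\<alpha> j)) * \<alpha> j)" for u
    using sum.reindex[OF inj] by simp
  have "u v = 0" if "(\<Sum>v\<in>\<alpha> ` {..<deg}. of_int (u v) * v) = 0" "v \<in> \<alpha> ` {..<deg}" for u v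
    using qbasis_int_independent[OF zbasisD(1)[OF assms], of "\<lambda>j. u (\<alpha> j)"] that sum by auto
  then have "int_mod.independent (\<alpha> ` {..<deg})"
    unfolding int_mod.dependent_finite[OF finite_imageI[OF finite_lessThan]] by blast
  moreover have "int_mod.span (\<alpha> ` {..<deg}) = \<O>"
  proof
    show "int_mod.span (\<alpha> ` {..<deg}) \<subseteq> \<O>"
      by (rule int_mod.span_minimal[OF _ subspace_O]) (use zbasisD(2)[OF assms] in auto)
    show "\<O> \<subseteq> int_mod.span (\<alpha> ` {..<deg})"
    proof
      fix x assume "x \<in> \<O>"
      then obtain m where "x = (\<Sum>j<deg. of_int (m j) * \<alpha> j)" using zbasisD(3)[OF assms] by blast
      then show "x \<in> int_mod.span (\<alpha> ` {..<deg})"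
        by (simp only:) (intro int_mod.span_sum int_mod.span_scale int_mod.span_base imageI)
    qed
  qed
  ultimately show ?thesis
    unfolding integral_basis_def set using inj by (simp add: distinct_map atLeast0LessThan)
qed

text \<open>Justifies the definite description behind \<open>field_disc\<close>: the determinant is
  integral, an integral basis exists, and all of them give the same value.\<close>

lemma field_disc:
  assumes "zbasis \<alpha>"
  shows "of_int (field_disc K) = fdisc deg \<alpha>"
proof -
  let ?d = "\<lambda>bs. det (mat (length bs) (length bs) (\<lambda>(i, j). tr (bs ! i * bs ! j)))"
  have d: "?d bs = fdisc deg \<alpha>" if "integral_basis K bs" for bs
  proof -
    have "?d bs = fdisc deg ((!) bs)"
      using integral_basis_imp_zbasis(1)[OF that] by (simp add: fdisc_def gram_def)
    then show ?thesis using zbasis_fdisc_unique[OF integral_basis_imp_zbasis(2)[OF that] assms] by simp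
  qed
  have "fdisc deg \<alpha> \<in> \<int>"
    unfolding fdisc_def by (rule det_Ints[OF gram_carrier])
      (use zbasisD(2)[OF assms] in \<open>auto simp: gram_def intro!: trace_int O_mult\<close>)
  then obtain k where k: "fdisc deg \<alpha> = of_int k" by (auto elim: Ints_cases)
  have "field_disc K = k"
    unfolding field_disc_def
  proof (rule the_equality)
    show "\<exists>bs. integral_basis K bs \<and> of_int k = ?d bs"
      using zbasis_imp_integral_basis[OF assms] d k by metis
    show "k' = k" if "\<exists>bs. integral_basis K bs \<and> of_int k' = ?d bs" for k'
      using that d k by (metis of_int_eq_iff)
  qed
  then show ?thesis using k by simp
qed

lemma field_disc_nonzero: "field_disc K \<noteq> 0"
proof -
  obtain \<alpha> where "zbasis \<alpha>" using ex_zbasis .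
  then show ?thesis using field_disc fdisc_nonzero zbasisD(1) by fastforce
qed

end

section \<open>The radical of the trace form modulo a prime\<close>

declare int_mod.scale_scale [simp del] rat_vs.scale_scale [simp del]

context num_field
begin

definition multiples :: "int \<Rightarrow> complex set" where
  "multiples k = (\<lambda>z. of_int k * z) ` \<O>"

text \<open>For nonzero k this is the intersection of \<O> with k times its dual lattice. For a
  prime k it is the preimage in \<O> of the radical of the trace form modulo k.\<close>

definition trace_divisible :: "int \<Rightarrow> complex set" where
  "trace_divisible k = {x \<in> \<O>. \<forall>z\<in>\<O>. tr (x * z) / of_int k \<in> \<int>}"

lemma multiplesI: "z \<in> \<O> \<Longrightarrow> of_int k * z \<in> multiples k"
  unfolding multiples_def by (rule imageI)

lemma multiplesE:
  assumes "x \<in> multiples k" obtains z where "z \<in> \<O>" "x = of_int k * z"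
  using assms by (auto simp: multiples_def)

lemma multiples_O: "x \<in> multiples k \<Longrightarrow> x \<in> \<O>"
  by (auto simp: multiples_def O_mult O_of_int)

lemma multiples_add: "x \<in> multiples k \<Longrightarrow> y \<in> multiples k \<Longrightarrow> x + y \<in> multiples k"
  by (elim multiplesE) (simp add: O_add multiplesI flip: distrib_left)

lemma multiples_mult: "x \<in> \<O> \<Longrightarrow> y \<in> multiples k \<Longrightarrow> x * y \<in> multiples k"
  by (elim multiplesE) (metis O_mult multiplesI mult.left_commute)

lemma multiples_zero: "0 \<in> multiples k"
  using multiplesI[OF O_zero] by simp

lemma multiples_sum: "(\<And>i. i \<in> A \<Longrightarrow> f i \<in> multiples k) \<Longrightarrow> sum f A \<in> multiples k"
  by (induction A rule: infinite_finite_induct) (auto simp: multiples_zero multiples_add)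

lemma multiples_iff_coordinates:
  assumes \<alpha>: "zbasis \<alpha>" and x: "x = (\<Sum>j<deg. of_int (m j) * \<alpha> j)"
  shows "x \<in> multiples k \<longleftrightarrow> (\<forall>j<deg. k dvd m j)"
proof
  assume "x \<in> multiples k"
  then obtain z where z: "z \<in> \<O>" "x = of_int k * z" by (rule multiplesE)
  then obtain l where "z = (\<Sum>j<deg. of_int (l j) * \<alpha> j)" using zbasisD(3)[OF \<alpha>] by blast
  then have "(\<Sum>j<deg. of_int (m j - k * l j) * \<alpha> j) = (\<Sum>j<deg. of_int (m j) * \<alpha> j) - of_int k * z"
    by (simp add: left_diff_distrib sum_subtractf sum_distrib_left mult.assoc)
  also have "\<dots> = 0" unfolding x[symmetric] z(2) by simp
  finally have "(\<Sum>j<deg. of_int (m j - k * l j) * \<alpha> j) = 0" .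
  from qbasis_int_independent[OF zbasisD(1)[OF \<alpha>] this] show "\<forall>j<deg. k dvd m j" by auto
next
  assume "\<forall>j<deg. k dvd m j"
  then have "\<forall>j. \<exists>l. j < deg \<longrightarrow> m j = k * l" by (meson dvdE)
  then obtain l where l: "\<And>j. j < deg \<Longrightarrow> m j = k * l j" by metis
  have "of_int (m j) * \<alpha> j \<in> multiples k" if "j < deg" for j
    using multiplesI[OF O_mult[OF O_of_int zbasisD(2)[OF \<alpha> that]], of k "l j"] l[OF that]
    by (simp add: mult.assoc)
  then show "x \<in> multiples k" unfolding x by (intro multiples_sum) simp
qed

text \<open>In the coordinates of an integral basis this is Euclid's lemma.\<close>

lemma prime_multiple_cancel:
  assumes p: "Factorial_Ring.prime (p :: int)" and x: "x \<in> \<O>" and kx: "of_int k * x \<in> multiples p" "\<not> p dvd k"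
  shows "x \<in> multiples p"
proof -
  obtain \<alpha> where \<alpha>: "zbasis \<alpha>" using ex_zbasis .
  obtain m where m: "x = (\<Sum>j<deg. of_int (m j) * \<alpha> j)" using zbasisD(3)[OF \<alpha> x] by blast
  then have "of_int k * x = (\<Sum>j<deg. of_int (k * m j) * \<alpha> j)"
    by (simp add: sum_distrib_left mult.assoc)
  from multiples_iff_coordinates[OF \<alpha> this] have "\<forall>j<deg. p dvd k * m j" using kx(1) by simp
  then show ?thesis using multiples_iff_coordinates[OF \<alpha> m] kx(2) p by (simp add: prime_dvd_mult_iff)
qed

lemma trace_divisible_O: "x \<in> trace_divisible k \<Longrightarrow> x \<in> \<O>"
  and trace_divisibleD: "x \<in> trace_divisible k \<Longrightarrow> z \<in> \<O> \<Longrightarrow> tr (x * z) / of_int k \<in> \<int>"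
  by (auto simp: trace_divisible_def)

lemma trace_divisible_diff:
  assumes "x \<in> trace_divisible k" "y \<in> trace_divisible k"
  shows "x - y \<in> trace_divisible k"
  using assms
  by (auto simp: trace_divisible_def O_diff left_diff_distrib trace_diff K_mult O_K diff_divide_distrib)

lemma trace_divisible_mult:
  assumes "x \<in> trace_divisible k" "y \<in> \<O>"
  shows "y * x \<in> trace_divisible k"
proof -
  have "y * x * z = x * (y * z)" for z by simp
  then have "tr (y * x * z) / of_int k \<in> \<int>" if "z \<in> \<O>" for z
    using trace_divisibleD[OF assms(1) O_mult[OF assms(2) that]] by metis
  then show ?thesis using assms by (simp add: trace_divisible_def O_mult)
qed

lemma trace_divisible_iff_basis:
  assumes \<alpha>: "zbasis \<alpha>" and x: "x \<in> \<O>"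
  shows "x \<in> trace_divisible k \<longleftrightarrow> (\<forall>j<deg. tr (x * \<alpha> j) / of_int k \<in> \<int>)"
proof
  assume *: "\<forall>j<deg. tr (x * \<alpha> j) / of_int k \<in> \<int>"
  have "tr (x * z) / of_int k \<in> \<int>" if z: "z \<in> \<O>" for z
  proof -
    obtain m where m: "z = (\<Sum>j<deg. of_int (m j) * \<alpha> j)" using zbasisD(3)[OF \<alpha> z] by blast
    have "x * z = (\<Sum>j<deg. of_rat (of_int (m j)) * (x * \<alpha> j))"
      by (simp add: m sum_distrib_left mult.left_commute)
    also have "tr \<dots> = (\<Sum>j<deg. of_int (m j) * tr (x * \<alpha> j))"
      by (rule trace_sum_scale) (use x zbasisD(2)[OF \<alpha>] in \<open>auto intro: K_mult O_K\<close>)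
    finally have "tr (x * z) / of_int k = (\<Sum>j<deg. of_int (m j) * (tr (x * \<alpha> j) / of_int k))"
      by (simp add: sum_divide_distrib)
    also have "\<dots> \<in> \<int>" using * by (intro Ints_sum Ints_mult) auto
    finally show ?thesis .
  qed
  then show "x \<in> trace_divisible k" using x by (simp add: trace_divisible_def)
qed (use zbasisD(2)[OF \<alpha>] in \<open>auto simp: trace_divisible_def\<close>)

lemma det_two_divisible_rows:
  fixes A :: "rat mat"
  assumes A: "A \<in> carrier_mat n n" and int: "\<And>i j. i < n \<Longrightarrow> j < n \<Longrightarrow> A $$ (i, j) \<in> \<int>"
    and kl: "k < n" "l < n" "k \<noteq> l" and p: "p \<noteq> 0"
    and k: "\<And>j. j < n \<Longrightarrow> A $$ (k, j) / of_int p \<in> \<int>" and l: "\<And>j. j < n \<Longrightarrow> A $$ (l, j) / of_int p \<in> \<int>"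
  shows "det A / of_int (p\<^sup>2) \<in> \<int>"
proof -
  define N where "N = mat n n (\<lambda>(i, j). if i = k \<or> i = l then A $$ (i, j) / of_int p else A $$ (i, j))"
  have N: "N \<in> carrier_mat n n" by (simp add: N_def)
  have "A = multrow k (of_int p) (multrow l (of_int p) N)"
    by (rule eq_matI) (use A p kl in \<open>auto simp: N_def\<close>)
  then have "det A = of_int p * (of_int p * det N)"
    using det_multrow[OF kl(1), of "multrow l (of_int p) N"] det_multrow[OF kl(2) N] N by simp
  moreover have "det N \<in> \<int>"
    by (rule det_Ints[OF N]) (use int k l in \<open>auto simp: N_def\<close>)
  ultimately show ?thesis using p by (simp add: power2_eq_square)
qed

text \<open>Exchanging \<alpha>_k for \<beta> and then \<alpha>_l for \<gamma> multiplies the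
  determinant by the squares of v_k and w_l, both prime to p; w_k = 0 lets \<gamma> keep its
  coordinates after the first exchange. The new Gram matrix has two rows divisible by p.\<close>

lemma two_independent_radical_elements:
  assumes \<alpha>: "zbasis \<alpha>" and p: "Factorial_Ring.prime (p :: int)"
    and \<beta>: "\<beta> \<in> trace_divisible p" "\<beta> = (\<Sum>j<deg. of_int (v j) * \<alpha> j)" "k < deg" "\<not> p dvd v k"
    and \<gamma>: "\<gamma> \<in> trace_divisible p" "\<gamma> = (\<Sum>j<deg. of_int (w j) * \<alpha> j)" "w k = 0" "l < deg" "\<not> p dvd w l"
  shows "p\<^sup>2 dvd field_disc K"
proof -
  have kl: "l \<noteq> k" using \<gamma>(3,5) by auto
  define b where "b = (\<alpha>(k := \<beta>))(l := \<gamma>)"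
  have \<alpha>O: "\<And>j. j < deg \<Longrightarrow> \<alpha> j \<in> \<O>" using zbasisD(2)[OF \<alpha>] .
  have bO: "b j \<in> \<O>" if "j < deg" for j
    using \<alpha>O that trace_divisible_O \<beta>(1) \<gamma>(1) by (simp add: b_def)
  have 1: "fdisc deg (\<alpha>(k := \<beta>)) = (of_int (v k))\<^sup>2 * fdisc deg \<alpha>"
    by (rule fdisc_replace) (use \<alpha>O \<beta> in \<open>auto simp: O_K\<close>)
  have 2: "fdisc deg b = (of_int (w l))\<^sup>2 * fdisc deg (\<alpha>(k := \<beta>))"
    unfolding b_def
  proof (rule fdisc_replace)
    show "\<gamma> = (\<Sum>j<deg. of_rat (of_int (w j)) * (\<alpha>(k := \<beta>)) j)"
      unfolding \<gamma>(2) by (intro sum.cong) (use \<gamma>(3) in auto)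
  qed (use \<alpha>O \<beta> \<gamma> trace_divisible_O in \<open>auto simp: O_K\<close>)
  have "det (gram deg b) / of_int (p\<^sup>2) \<in> \<int>"
  proof (rule det_two_divisible_rows[OF gram_carrier _ \<beta>(3) \<gamma>(4)])
    show "gram deg b $$ (i, j) \<in> \<int>" if "i < deg" "j < deg" for i j
      using that bO by (simp add: gram_def trace_int O_mult)
    show "gram deg b $$ (k, j) / of_int p \<in> \<int>" if "j < deg" for j
      using that bO trace_divisibleD[OF \<beta>(1)] \<beta>(3) kl by (simp add: gram_def b_def)
    show "gram deg b $$ (l, j) / of_int p \<in> \<int>" if "j < deg" for j
      using that bO trace_divisibleD[OF \<gamma>(1)] \<gamma>(4) by (simp add: gram_def b_def)
  qed (use kl p in auto)
  then obtain z where z: "det (gram deg b) / of_int (p\<^sup>2) = of_int z" by (elim Ints_cases)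
  have "fdisc deg b = of_int (p\<^sup>2 * z)"
    using z p by (simp add: fdisc_def field_simps)
  then have "of_int ((w l)\<^sup>2 * (v k)\<^sup>2 * field_disc K) = (of_int (p\<^sup>2 * z) :: rat)"
    using 1 2 field_disc[OF \<alpha>] by simp
  then have "p\<^sup>2 dvd ((w l)\<^sup>2 * (v k)\<^sup>2) * field_disc K" by (metis dvd_triv_left of_int_eq_iff)
  moreover have "Rings.coprime (p\<^sup>2) ((w l)\<^sup>2 * (v k)\<^sup>2)"
    using p \<beta>(4) \<gamma>(5) by (simp add: prime_imp_coprime)
  ultimately show ?thesis using coprime_dvd_mult_right_iff by blast
qed

text \<open>One step of elimination: \<gamma>' has k-th coordinate 0, so if it were nonzero modulo
  p, then \<beta> and \<gamma>' would be two independent elements of the radical and p^2 would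
  divide the discriminant.\<close>

lemma radical_one_dimensional:
  assumes p: "Factorial_Ring.prime (p :: int)" "\<not> p\<^sup>2 dvd field_disc K"
    and \<beta>: "\<beta> \<in> trace_divisible p" "\<beta> \<notin> multiples p" and \<gamma>: "\<gamma> \<in> trace_divisible p"
  obtains t :: int where "\<gamma> - of_int t * \<beta> \<in> multiples p"
proof -
  obtain \<alpha> where \<alpha>: "zbasis \<alpha>" using ex_zbasis .
  obtain v where v: "\<beta> = (\<Sum>j<deg. of_int (v j) * \<alpha> j)"
    using zbasisD(3)[OF \<alpha>] trace_divisible_O[OF \<beta>(1)] by blast
  obtain w where w: "\<gamma> = (\<Sum>j<deg. of_int (w j) * \<alpha> j)"
    using zbasisD(3)[OF \<alpha>] trace_divisible_O[OF \<gamma>] by blast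
  obtain k where k: "k < deg" "\<not> p dvd v k" using multiples_iff_coordinates[OF \<alpha> v] \<beta>(2) by blast
  define \<gamma>' where "\<gamma>' = of_int (v k) * \<gamma> - of_int (w k) * \<beta>"
  define w' where "w' j = v k * w j - w k * v j" for j
  have \<gamma>'1: "\<gamma>' \<in> trace_divisible p"
    unfolding \<gamma>'_def by (intro trace_divisible_diff trace_divisible_mult \<gamma> \<beta> O_of_int)
  have \<gamma>'2: "\<gamma>' = (\<Sum>j<deg. of_int (w' j) * \<alpha> j)"
    unfolding \<gamma>'_def v w w'_def by (simp add: sum_distrib_left sum_subtractf left_diff_distrib mult.assoc)
  have "w' k = 0" by (simp add: w'_def mult.commute)
  have "p dvd w' l" if "l < deg" for l
  proof (rule ccontr)
    assume "\<not> p dvd w' l"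
    from two_independent_radical_elements[OF \<alpha> p(1) \<beta>(1) v k \<gamma>'1 \<gamma>'2 \<open>w' k = 0\<close> that this]
    show False using p(2) by simp
  qed
  then have "\<gamma>' \<in> multiples p" using multiples_iff_coordinates[OF \<alpha> \<gamma>'2] by simp
  \<comment> \<open>Here y becomes an inverse of v_k modulo p, which turns the vanishing of
    \<gamma>' into t = y w_k.\<close>
  have "gcd p (v k) = 1" using k(2) p(1) by (meson coprime_iff_gcd_eq_1 prime_imp_coprime)
  then obtain x y where xy: "x * p + y * v k = 1" using bezout_int[of p "v k"] by auto
  have "\<gamma> - of_int (y * w k) * \<beta> = of_int y * \<gamma>' + of_int p * (of_int x * \<gamma>)"
  proof -
    have "\<gamma> = of_int (x * p + y * v k) * \<gamma>" by (simp add: xy)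
    also have "\<dots> = of_int p * (of_int x * \<gamma>) + of_int y * (of_int (v k) * \<gamma>)" by (simp add: algebra_simps)
    finally show ?thesis by (simp add: \<gamma>'_def algebra_simps)
  qed
  also have "\<dots> \<in> multiples p"
    using \<open>\<gamma>' \<in> multiples p\<close> trace_divisible_O[OF \<gamma>]
    by (intro multiples_add multiples_mult multiplesI O_mult O_of_int) auto
  finally show ?thesis by (rule that)
qed

text \<open>If multiplication by \<open>\<beta>\<close> maps into the line spanned by \<open>\<beta>\<close> modulo \<open>p\<close>, its trace is the
  eigenvalue on that line.\<close>

lemma radical_square:
  assumes p: "Factorial_Ring.prime (p :: int)" and \<beta>: "\<beta> \<in> trace_divisible p"
    and dim: "\<And>\<gamma>. \<gamma> \<in> trace_divisible p \<Longrightarrow> \<exists>t::int. \<gamma> - of_int t * \<beta> \<in> multiples p"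
  shows "\<beta> * \<beta> \<in> multiples p"
proof -
  obtain \<alpha> where \<alpha>: "zbasis \<alpha>" using ex_zbasis .
  have \<beta>O: "\<beta> \<in> \<O>" using trace_divisible_O[OF \<beta>] .
  obtain w where w: "\<beta> = (\<Sum>j<deg. of_int (w j) * \<alpha> j)" using zbasisD(3)[OF \<alpha> \<beta>O] by blast
  have "\<exists>m z. j < deg \<longrightarrow> \<alpha> j * \<beta> = of_int m * \<beta> + of_int p * (\<Sum>k<deg. of_int (z k) * \<alpha> k)" for j
  proof (cases "j < deg")
    case True
    obtain m :: int where "\<alpha> j * \<beta> - of_int m * \<beta> \<in> multiples p"
      using dim[OF trace_divisible_mult[OF \<beta> zbasisD(2)[OF \<alpha> True]]] by blast
    then obtain x where x: "x \<in> \<O>" "\<alpha> j * \<beta> - of_int m * \<beta> = of_int p * x" by (rule multiplesE)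
    then obtain z where "x = (\<Sum>k<deg. of_int (z k) * \<alpha> k)" using zbasisD(3)[OF \<alpha>] by blast
    then show ?thesis using x(2) by (intro exI[of _ m] exI[of _ z]) (simp add: algebra_simps)
  qed simp
  then obtain m z where mz: "\<And>j. j < deg \<Longrightarrow> \<alpha> j * \<beta> = of_int (m j) * \<beta> + of_int p * (\<Sum>k<deg. of_int (z j k) * \<alpha> k)"
    by metis
  \<comment> \<open>Modulo p, multiplication by \<beta> has the matrix with entries m_j w_k, of rank
    at most one and with trace t; also \<beta>^2 is t \<beta> modulo p. As p divides Tr(\<beta>), it
    divides t.\<close>
  define t where "t = (\<Sum>j<deg. m j * w j)"
  have "tr \<beta> = (\<Sum>j<deg. of_int (m j * w j + p * z j j))"
  proof (rule trace_qbasis[OF zbasisD(1)[OF \<alpha>], where q = "\<lambda>j k. of_int (m j * w k + p * z j k)"])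
    fix j assume "j \<in> {..<deg}"
    then have "\<beta> * \<alpha> j = of_int (m j) * \<beta> + of_int p * (\<Sum>k<deg. of_int (z j k) * \<alpha> k)"
      using mz by (simp add: mult.commute)
    also have "\<dots> = (\<Sum>k<deg. of_int (m j) * (of_int (w k) * \<alpha> k) + of_int p * (of_int (z j k) * \<alpha> k))"
      by (simp only: w sum_distrib_left sum.distrib)
    also have "\<dots> = (\<Sum>k<deg. of_rat (of_int (m j * w k + p * z j k)) * \<alpha> k)"
      by (intro sum.cong refl) (simp add: of_rat_add of_rat_mult distrib_right mult.assoc)
    finally show "\<beta> * \<alpha> j = (\<Sum>k<deg. of_rat (of_int (m j * w k + p * z j k)) * \<alpha> k)" .
  qed (use \<beta>O O_K in auto)
  also have "\<dots> = of_int (t + p * (\<Sum>j<deg. z j j))"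
    by (simp add: t_def sum.distrib sum_distrib_left)
  finally have "tr \<beta> = of_int (t + p * (\<Sum>j<deg. z j j))" .
  moreover obtain s where "tr \<beta> / of_int p = of_int s"
    using trace_divisibleD[OF \<beta> O_one] by (auto elim: Ints_cases)
  then have "tr \<beta> = of_int (p * s)" using p by (auto simp: field_simps)
  ultimately have "t + p * (\<Sum>j<deg. z j j) = p * s" using of_int_eq_iff by metis
  then have "t = p * (s - (\<Sum>j<deg. z j j))" by (simp add: algebra_simps)
  then have "of_int t * \<beta> = of_int p * (of_int (s - (\<Sum>j<deg. z j j)) * \<beta>)"
    by (simp only: of_int_mult mult.assoc)
  then have t: "of_int t * \<beta> \<in> multiples p"
    using multiplesI[OF O_mult[OF O_of_int \<beta>O]] by metis
  have "\<beta> * \<beta> = (\<Sum>j<deg. of_int (w j) * (\<alpha> j * \<beta>))"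
    by (subst (1) w) (simp add: sum_distrib_right mult.assoc)
  also have "\<dots> = (\<Sum>j<deg. of_int (m j * w j) * \<beta> + of_int p * (of_int (w j) * (\<Sum>k<deg. of_int (z j k) * \<alpha> k)))"
    by (intro sum.cong refl) (subst mz, simp_all add: algebra_simps)
  also have "\<dots> = of_int t * \<beta> + (\<Sum>j<deg. of_int p * (of_int (w j) * (\<Sum>k<deg. of_int (z j k) * \<alpha> k)))"
    by (simp add: sum.distrib t_def sum_distrib_right)
  also have "\<dots> \<in> multiples p"
    by (intro multiples_add t multiples_sum multiplesI O_mult O_of_int O_sum zbasisD(2)[OF \<alpha>]) auto
  finally show ?thesis .
qed

end

section \<open>The trace pairing\<close>

context num_field
begin

text \<open>The coefficients form row j of the inverse Gram matrix when \<alpha> is an integral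
  basis. Writing it as adjugate over determinant shows that multiplication by the discriminant
  leaves integer coefficients.\<close>

definition dual_basis :: "(nat \<Rightarrow> complex) \<Rightarrow> nat \<Rightarrow> complex" where
  "dual_basis \<alpha> j = (\<Sum>k<deg. of_rat (adj_mat (gram deg \<alpha>) $$ (j, k) / of_int (field_disc K)) * \<alpha> k)"

lemma field_disc_dual_basis_O:
  assumes \<alpha>: "zbasis \<alpha>" and j: "j < deg"
  shows "of_int (field_disc K) * dual_basis \<alpha> j \<in> \<O>"
proof -
  have adj: "adj_mat (gram deg \<alpha>) $$ (j, k) \<in> \<int>" if "k < deg" for k
  proof -
    have "det (mat_delete (gram deg \<alpha>) k j) \<in> \<int>"
    proof (rule det_Ints)
      show "mat_delete (gram deg \<alpha>) k j \<in> carrier_mat (deg - 1) (deg - 1)"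
        by (rule mat_delete_carrier[OF gram_carrier])
      show "mat_delete (gram deg \<alpha>) k j $$ (r, s) \<in> \<int>" if "r < deg - 1" "s < deg - 1" for r s
        using that zbasisD(2)[OF \<alpha>] by (auto simp: mat_delete_def gram_def intro!: trace_int O_mult)
    qed
    moreover have "adj_mat (gram deg \<alpha>) $$ (j, k) = cofactor (gram deg \<alpha>) k j"
      using that j carrier_matD[OF gram_carrier[of deg \<alpha>]] by (simp add: adj_mat_def)
    ultimately show ?thesis by (simp add: cofactor_def)
  qed
  have "of_int (field_disc K) * dual_basis \<alpha> j = (\<Sum>k<deg. of_rat (adj_mat (gram deg \<alpha>) $$ (j, k)) * \<alpha> k)"
    using field_disc_nonzero by (simp add: dual_basis_def sum_distrib_left of_rat_divide)
  also have "\<dots> \<in> \<O>"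
  proof (rule O_sum)
    fix k assume "k \<in> {..<deg}"
    then have "adj_mat (gram deg \<alpha>) $$ (j, k) \<in> \<int>" "\<alpha> k \<in> \<O>" using adj zbasisD(2)[OF \<alpha>] by auto
    then show "of_rat (adj_mat (gram deg \<alpha>) $$ (j, k)) * \<alpha> k \<in> \<O>"
      by (auto elim!: Ints_cases simp: O_mult O_of_int)
  qed
  finally show ?thesis .
qed

lemma dual_basis_K: "zbasis \<alpha> \<Longrightarrow> dual_basis \<alpha> j \<in> K"
  unfolding dual_basis_def by (intro K_sum K_scale) (auto dest: zbasisD(2) O_K)

lemma trace_dual_basis:
  assumes \<alpha>: "zbasis \<alpha>" and ij: "j < deg" "i < deg"
  shows "tr (dual_basis \<alpha> j * \<alpha> i) = (if i = j then 1 else 0)"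
proof -
  let ?d = "of_int (field_disc K) :: rat"
  have "dual_basis \<alpha> j * \<alpha> i = (\<Sum>k<deg. of_rat (adj_mat (gram deg \<alpha>) $$ (j, k) / ?d) * (\<alpha> k * \<alpha> i))"
    by (simp add: dual_basis_def sum_distrib_right mult.assoc)
  also have "tr \<dots> = (\<Sum>k<deg. (adj_mat (gram deg \<alpha>) $$ (j, k) / ?d) * tr (\<alpha> k * \<alpha> i))"
    by (rule trace_sum_scale) (use zbasisD(2)[OF \<alpha>] ij in \<open>auto intro: K_mult O_K\<close>)
  also have "\<dots> = (\<Sum>k<deg. adj_mat (gram deg \<alpha>) $$ (j, k) * tr (\<alpha> k * \<alpha> i)) / ?d"
    by (simp add: sum_divide_distrib)
  also have "(\<Sum>k<deg. adj_mat (gram deg \<alpha>) $$ (j, k) * tr (\<alpha> k * \<alpha> i)) = (adj_mat (gram deg \<alpha>) * gram deg \<alpha>) $$ (j, i)"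
    using ij carrier_matD[OF adj_mat(1)[OF gram_carrier[of deg \<alpha>]]] carrier_matD[OF gram_carrier[of deg \<alpha>]]
    by (simp add: scalar_prod_def atLeast0LessThan) (simp add: gram_def)
  also have "\<dots> = (if i = j then ?d else 0)"
    using ij adj_mat(3)[OF gram_carrier[of deg \<alpha>]] field_disc[OF \<alpha>] by (auto simp: fdisc_def)
  finally show ?thesis using field_disc_nonzero by simp
qed

lemma trace_ext:
  assumes b: "qbasis K J b" and "x \<in> K" "y \<in> K" "\<And>j. j \<in> J \<Longrightarrow> tr (x * b j) = tr (y * b j)"
  shows "x = y"
proof -
  have "x - y = 0"
    by (rule trace_nondegenerate[OF b])
      (use assms qbasisD(2)[OF b] in \<open>auto simp: K_diff left_diff_distrib trace_diff K_mult\<close>)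
  then show ?thesis by simp
qed

lemma dual_basis_expansion:
  assumes \<alpha>: "zbasis \<alpha>" and x: "x \<in> K"
  shows "x = (\<Sum>j<deg. of_rat (tr (x * \<alpha> j)) * dual_basis \<alpha> j)"
proof (rule trace_ext[OF zbasisD(1)[OF \<alpha>] x])
  show "(\<Sum>j<deg. of_rat (tr (x * \<alpha> j)) * dual_basis \<alpha> j) \<in> K"
    by (intro K_sum K_scale dual_basis_K[OF \<alpha>])
  fix i assume i: "i \<in> {..<deg}"
  have "(\<Sum>j<deg. of_rat (tr (x * \<alpha> j)) * dual_basis \<alpha> j) * \<alpha> i = (\<Sum>j<deg. of_rat (tr (x * \<alpha> j)) * (dual_basis \<alpha> j * \<alpha> i))"
    by (simp add: sum_distrib_right mult.assoc)
  also have "tr \<dots> = (\<Sum>j<deg. tr (x * \<alpha> j) * tr (dual_basis \<alpha> j * \<alpha> i))"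
    by (rule trace_sum_scale) (use zbasisD(2)[OF \<alpha>] i in \<open>auto intro: K_mult O_K dual_basis_K[OF \<alpha>]\<close>)
  also have "\<dots> = (\<Sum>j<deg. if i = j then tr (x * \<alpha> j) else 0)"
    by (intro sum.cong) (use i in \<open>auto simp: trace_dual_basis[OF \<alpha>]\<close>)
  finally show "tr (x * \<alpha> i) = tr ((\<Sum>j<deg. of_rat (tr (x * \<alpha> j)) * dual_basis \<alpha> j) * \<alpha> i)"
    using i by simp
qed

lemma rat_linear_sum:
  assumes "rat_linear_on K f" "\<And>i. i \<in> A \<Longrightarrow> g i \<in> K"
  shows "f (\<Sum>i\<in>A. of_rat (q i) * g i) = (\<Sum>i\<in>A. of_rat (q i) * f (g i))"
proof -
  have "f 0 = 0" using assms(1) K_zero unfolding rat_linear_on_def by (metis mult_zero_left of_rat_0)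
  then show ?thesis
    using assms
    by (induction A rule: infinite_finite_induct) (auto simp: rat_linear_on_def K_sum K_scale)
qed

text \<open>If l expresses the integral basis in terms of \<open>B\<^sub>0\<close>, the transpose of
  l expresses the dual basis of \<open>B\<^sub>0\<close> in terms of the dual integral basis.
  Swapping the two sums moves l from one factor to the other.\<close>

lemma trace_pairing_dual_basis:
  assumes \<alpha>: "zbasis \<alpha>" and f: "rat_linear_on K f"
  shows "trace_pairing K (\<lambda>x. x) f = (\<Sum>j<deg. dual_basis \<alpha> j * f (\<alpha> j))"
proof -
  have B0K: "b \<in> K" if "b \<in> B\<^sub>0" for b using qbasisD(2)[OF qbasis_B0] that .
  have \<alpha>K: "\<alpha> j \<in> K" if "j < deg" for j using zbasisD(2)[OF \<alpha>] that O_K by blast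
  obtain l where l: "\<And>j. j \<in> {..<deg} \<Longrightarrow> \<alpha> j = (\<Sum>b\<in>B\<^sub>0. of_rat (l j b) * b)"
    using qbasis_matrix[OF qbasis_B0, of "{..<deg}" \<alpha>] \<alpha>K by auto
  define a where "a b = (\<Sum>j<deg. of_rat (l j b) * dual_basis \<alpha> j)" for b
  have aK: "a b \<in> K" for b unfolding a_def by (intro K_sum K_scale dual_basis_K[OF \<alpha>])
  have tr_a: "tr (a b * b') = (if b' = b then 1 else 0)" if b: "b \<in> B\<^sub>0" "b' \<in> B\<^sub>0" for b b'
  proof -
    obtain s where s: "b' = (\<Sum>i<deg. of_rat (s i) * \<alpha> i)"
      using qbasisD(3)[OF zbasisD(1)[OF \<alpha>] B0K[OF b(2)]] by blast
    have "tr (dual_basis \<alpha> j * b') = s j" if j: "j < deg" for j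
    proof -
      have "dual_basis \<alpha> j * b' = (\<Sum>i<deg. of_rat (s i) * (dual_basis \<alpha> j * \<alpha> i))"
        by (simp add: s sum_distrib_left mult.left_commute)
      also have "tr \<dots> = (\<Sum>i<deg. s i * tr (dual_basis \<alpha> j * \<alpha> i))"
        by (rule trace_sum_scale) (auto intro: K_mult dual_basis_K[OF \<alpha>] \<alpha>K)
      also have "\<dots> = (\<Sum>i<deg. if i = j then s i else 0)"
        by (intro sum.cong) (use j in \<open>auto simp: trace_dual_basis[OF \<alpha>]\<close>)
      finally show ?thesis using j by simp
    qed
    moreover have "tr (a b * b') = (\<Sum>j<deg. l j b * tr (dual_basis \<alpha> j * b'))"
    proof -
      have "a b * b' = (\<Sum>j<deg. of_rat (l j b) * (dual_basis \<alpha> j * b'))"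
        by (simp add: a_def sum_distrib_right mult.assoc)
      also have "tr \<dots> = (\<Sum>j<deg. l j b * tr (dual_basis \<alpha> j * b'))"
        by (rule trace_sum_scale) (auto intro: K_mult dual_basis_K[OF \<alpha>] B0K b)
      finally show ?thesis .
    qed
    ultimately have "tr (a b * b') = (\<Sum>j<deg. s j * l j b)" by (simp add: mult.commute)
    \<comment> \<open>Substituting the expansion of \<alpha>_j into that of b' returns b', so s is
      inverse to l by uniqueness of coordinates.\<close>
    also have "\<dots> = (if b' = b then 1 else 0)"
    proof (rule qbasis_unique[OF qbasis_B0 _ b(1)])
      have "(\<Sum>c\<in>B\<^sub>0. of_rat (\<Sum>j<deg. s j * l j c) * c) = (\<Sum>j<deg. of_rat (s j) * (\<Sum>c\<in>B\<^sub>0. of_rat (l j c) * c))"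
        unfolding of_rat_sum sum_distrib_left sum_distrib_right of_rat_mult
        by (subst sum.swap) (simp add: mult.assoc)
      also have "\<dots> = (\<Sum>j<deg. of_rat (s j) * \<alpha> j)" using l by simp
      also have "\<dots> = b'" using s by simp
      also have "\<dots> = (\<Sum>c\<in>B\<^sub>0. of_rat (if b' = c then 1 else 0) * c)"
        using b(2) finite_B0 by (simp add: if_distrib[of of_rat] if_distrib[of "\<lambda>x. x * _"] cong: if_cong)
      finally show "(\<Sum>c\<in>B\<^sub>0. of_rat (\<Sum>j<deg. s j * l j c) * c) = (\<Sum>c\<in>B\<^sub>0. of_rat (if b' = c then 1 else 0) * c)" .
    qed
    finally show ?thesis .
  qed
  have dual: "trace_dual K B\<^sub>0 b = a b" if b: "b \<in> B\<^sub>0" for b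
    unfolding trace_dual_def
  proof (rule the_equality)
    show "a b \<in> K \<and> (\<forall>b'\<in>B\<^sub>0. tr (a b * b') = (if b' = b then 1 else 0))"
      using aK tr_a b by blast
    fix x assume "x \<in> K \<and> (\<forall>b'\<in>B\<^sub>0. tr (x * b') = (if b' = b then 1 else 0))"
    then show "x = a b" by (intro trace_ext[OF qbasis_B0]) (use aK tr_a b in auto)
  qed
  have "trace_pairing K (\<lambda>x. x) f = (\<Sum>b\<in>B\<^sub>0. a b * f b)"
    by (simp add: trace_pairing_def Let_def dual)
  also have "\<dots> = (\<Sum>j<deg. dual_basis \<alpha> j * (\<Sum>b\<in>B\<^sub>0. of_rat (l j b) * f b))"
    unfolding a_def sum_distrib_left sum_distrib_right
    by (subst sum.swap) (simp add: mult.assoc mult.left_commute)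
  also have "\<dots> = (\<Sum>j<deg. dual_basis \<alpha> j * f (\<alpha> j))"
  proof (intro sum.cong refl)
    fix j assume "j \<in> {..<deg}"
    then have "f (\<alpha> j) = (\<Sum>b\<in>B\<^sub>0. of_rat (l j b) * f b)"
      by (subst l) (use rat_linear_sum[OF f, of B\<^sub>0 "\<lambda>b. b"] B0K in auto)
    then show "dual_basis \<alpha> j * (\<Sum>b\<in>B\<^sub>0. of_rat (l j b) * f b) = dual_basis \<alpha> j * f (\<alpha> j)" by simp
  qed
  finally show "trace_pairing K (\<lambda>x. x) f = (\<Sum>j<deg. dual_basis \<alpha> j * f (\<alpha> j))" .
qed

end

section \<open>The pairing of an isometry that preserves integers, and its denominator at simple
  primes\<close>

locale integral_isometry = K: num_field K + L: num_field L for K L +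
  fixes \<phi> :: "complex \<Rightarrow> complex"
  assumes isometry: "trace_isometry K L \<phi>"
    and image_integers: "\<phi> ` integers_of K = integers_of L"
begin

lemma linear: "rat_linear_on K \<phi>"
  and trace_preserving: "x \<in> K \<Longrightarrow> y \<in> K \<Longrightarrow> L.tr (\<phi> x * \<phi> y) = K.tr (x * y)"
  using isometry by (auto simp: trace_isometry_def)

lemma phi_L: "x \<in> K \<Longrightarrow> \<phi> x \<in> L"
  using isometry by (auto simp: trace_isometry_def bij_betw_def)

lemma phi_O: "x \<in> K.\<O> \<Longrightarrow> \<phi> x \<in> L.\<O>"
  using image_integers by blast

lemma phi_add: "x \<in> K \<Longrightarrow> y \<in> K \<Longrightarrow> \<phi> (x + y) = \<phi> x + \<phi> y"
  using linear by (simp add: rat_linear_on_def)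

lemma phi_int: "x \<in> K \<Longrightarrow> \<phi> (of_int m * x) = of_int m * \<phi> x"
  using linear unfolding rat_linear_on_def by (metis of_rat_of_int_eq)

definition c :: complex where "c = trace_pairing K (\<lambda>x. x) \<phi>"

lemma c_dual_basis: "K.zbasis \<alpha> \<Longrightarrow> c = (\<Sum>j<K.deg. K.dual_basis \<alpha> j * \<phi> (\<alpha> j))"
  unfolding c_def by (rule K.trace_pairing_dual_basis[OF _ linear])

lemma algebraic_int_mult_c:
  assumes \<alpha>: "K.zbasis \<alpha>" and m: "\<And>j. j < K.deg \<Longrightarrow> of_int m * K.dual_basis \<alpha> j \<in> K.\<O>"
  shows "algebraic_int (of_int m * c)"
proof -
  have "of_int m * c = (\<Sum>j<K.deg. (of_int m * K.dual_basis \<alpha> j) * \<phi> (\<alpha> j))"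
    by (simp add: c_dual_basis[OF \<alpha>] sum_distrib_left mult.assoc)
  also have "algebraic_int \<dots>"
  proof (rule algebraic_int_sum)
    fix j assume "j \<in> {..<K.deg}"
    then have "of_int m * K.dual_basis \<alpha> j \<in> K.\<O>" "\<phi> (\<alpha> j) \<in> L.\<O>"
      using m phi_O K.zbasisD(2)[OF \<alpha>] by auto
    then show "algebraic_int (of_int m * K.dual_basis \<alpha> j * \<phi> (\<alpha> j))"
      unfolding K.O_iff L.O_iff using algebraic_int_mult by blast
  qed
  finally show ?thesis .
qed

lemma algebraic_int_disc_c: "algebraic_int (of_int (field_disc K) * c)"
proof -
  obtain \<alpha> where \<alpha>: "K.zbasis \<alpha>" using K.ex_zbasis .
  then show ?thesis by (intro algebraic_int_mult_c K.field_disc_dual_basis_O)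
qed

text \<open>\<phi> does not respect products, but the condition refers only to the trace form and to
  the set of integers, and \<phi> preserves both.\<close>

lemma phi_trace_divisible:
  assumes "x \<in> K.\<O>"
  shows "x \<in> K.trace_divisible k \<longleftrightarrow> \<phi> x \<in> L.trace_divisible k"
proof -
  have "(\<forall>z\<in>L.\<O>. L.tr (\<phi> x * z) / of_int k \<in> \<int>) \<longleftrightarrow> (\<forall>z\<in>K.\<O>. L.tr (\<phi> x * \<phi> z) / of_int k \<in> \<int>)"
    unfolding image_integers[symmetric] by blast
  also have "\<dots> \<longleftrightarrow> (\<forall>z\<in>K.\<O>. K.tr (x * z) / of_int k \<in> \<int>)"
    using trace_preserving assms by (simp add: K.O_K)
  finally show ?thesis using assms phi_O by (simp add: K.trace_divisible_def L.trace_divisible_def)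
qed

text \<open>The square is computed in each field separately: \<phi> carries the line in K to the
  line spanned by \<phi>(\<beta>) in L, where the eigenvalue argument applies again. The two factors
  p so obtained cancel the p^2 in the denominator of the square.\<close>

lemma phi_radical_square:
  assumes p: "Factorial_Ring.prime (p :: int)" "\<not> p\<^sup>2 dvd field_disc K"
    and \<beta>: "\<beta> \<in> K.trace_divisible p" "\<beta> \<notin> K.multiples p"
  shows "algebraic_int (\<beta> * \<phi> \<beta> / of_int p)"
proof -
  have \<beta>O: "\<beta> \<in> K.\<O>" using \<beta> K.trace_divisible_O by blast
  have "\<beta> * \<beta> \<in> K.multiples p"
    by (rule K.radical_square[OF p(1) \<beta>(1)]) (metis K.radical_one_dimensional[OF p \<beta>])
  then obtain x where x: "x \<in> K.\<O>" "\<beta> * \<beta> = of_int p * x" by (rule K.multiplesE)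
  have "\<phi> \<beta> * \<phi> \<beta> \<in> L.multiples p"
  proof (rule L.radical_square[OF p(1)])
    show "\<phi> \<beta> \<in> L.trace_divisible p" using phi_trace_divisible[OF \<beta>O] \<beta>(1) by simp
    fix \<gamma> assume \<gamma>: "\<gamma> \<in> L.trace_divisible p"
    then obtain \<gamma>' where \<gamma>': "\<gamma>' \<in> K.\<O>" "\<gamma> = \<phi> \<gamma>'"
      using L.trace_divisible_O image_integers by blast
    then have "\<gamma>' \<in> K.trace_divisible p" using phi_trace_divisible \<gamma> by simp
    then obtain t :: int where "\<gamma>' - of_int t * \<beta> \<in> K.multiples p"
      using K.radical_one_dimensional[OF p \<beta>] by blast
    then obtain z where z: "z \<in> K.\<O>" "\<gamma>' - of_int t * \<beta> = of_int p * z" by (rule K.multiplesE)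
    then have "\<gamma>' = of_int t * \<beta> + of_int p * z" by (simp add: algebra_simps)
    then have "\<gamma> = of_int t * \<phi> \<beta> + of_int p * \<phi> z"
      using \<gamma>'(2) \<beta>O z(1) by (simp add: phi_add phi_int K.O_K K.K_mult K.K_of_int)
    then have "\<gamma> - of_int t * \<phi> \<beta> = of_int p * \<phi> z" by simp
    then show "\<exists>t::int. \<gamma> - of_int t * \<phi> \<beta> \<in> L.multiples p"
      using L.multiplesI[OF phi_O[OF z(1)]] by metis
  qed
  then obtain y where y: "y \<in> L.\<O>" "\<phi> \<beta> * \<phi> \<beta> = of_int p * y" by (rule L.multiplesE)
  have "(\<beta> * \<phi> \<beta> / of_int p)\<^sup>2 = (\<beta> * \<beta>) * (\<phi> \<beta> * \<phi> \<beta>) / (of_int p * of_int p)"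
    by (simp add: power2_eq_square)
  also have "\<dots> = x * y" using p(1) by (auto simp: x(2) y(2))
  finally have "algebraic_int ((\<beta> * \<phi> \<beta> / of_int p)\<^sup>2)"
    using x(1) y(1) by (simp add: algebraic_int_mult K.O_iff L.O_iff)
  then show ?thesis by (rule algebraic_int_of_square)
qed

text \<open>The elements \<beta>_j = d \<alpha>_j^* lie in the radical, so each is t_j b plus a
  multiple of p. The combination of the \<alpha>_j with these same coefficients t_j lies in the
  radical too, which leaves only b \<phi>(b) / p as a possibly non-integral term of m c.\<close>

lemma algebraic_int_simple_prime:
  assumes p: "Factorial_Ring.prime p" "p dvd field_disc K" "\<not> p\<^sup>2 dvd field_disc K"
  shows "algebraic_int (of_int (field_disc K div p) * c)"
proof -
  obtain \<alpha> where \<alpha>: "K.zbasis \<alpha>" using K.ex_zbasis .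
  define d where "d = field_disc K"
  define m where "m = d div p"
  have d: "d = p * m" using p(2) by (simp add: d_def m_def)
  have p0: "p \<noteq> 0" using p(1) by auto
  have \<alpha>O: "\<alpha> j \<in> K.\<O>" if "j < K.deg" for j using K.zbasisD(2)[OF \<alpha>] that .
  define \<beta> where "\<beta> j = of_int d * K.dual_basis \<alpha> j" for j
  have \<beta>O: "\<beta> j \<in> K.\<O>" if "j < K.deg" for j
    using K.field_disc_dual_basis_O[OF \<alpha> that] by (simp add: \<beta>_def d_def)
  have \<beta>R: "\<beta> j \<in> K.trace_divisible p" if j: "j < K.deg" for j
    unfolding K.trace_divisible_iff_basis[OF \<alpha> \<beta>O[OF j]]
  proof (intro allI impI)
    fix i assume i: "i < K.deg"
    have "K.tr (\<beta> j * \<alpha> i) = of_int d * (if i = j then 1 else 0)"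
      using i j unfolding \<beta>_def mult.assoc
      by (subst K.trace_int_scale) (auto simp: K.trace_dual_basis[OF \<alpha>] K.K_mult K.dual_basis_K[OF \<alpha>] K.O_K \<alpha>O)
    then show "K.tr (\<beta> j * \<alpha> i) / of_int p \<in> \<int>" using p0 by (simp add: d)
  qed
  show ?thesis
  proof (cases "\<forall>j<K.deg. \<beta> j \<in> K.multiples p")
    case True
    have "algebraic_int (of_int m * c)"
    proof (rule algebraic_int_mult_c[OF \<alpha>])
      fix j assume "j < K.deg"
      then obtain z where "z \<in> K.\<O>" "\<beta> j = of_int p * z" using True K.multiplesE by metis
      then show "of_int m * K.dual_basis \<alpha> j \<in> K.\<O>" using p0 by (simp add: \<beta>_def d mult.assoc)
    qed
    then show ?thesis by (simp add: m_def d_def)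
  next
    case False
    then obtain k where k: "k < K.deg" "\<beta> k \<notin> K.multiples p" by blast
    define b where "b = \<beta> k"
    have b: "b \<in> K.trace_divisible p" "b \<notin> K.multiples p" using k \<beta>R by (auto simp: b_def)
    have bO: "b \<in> K.\<O>" using K.trace_divisible_O b by blast
    have dim: "\<exists>t::int. \<exists>z\<in>K.\<O>. x = of_int t * b + of_int p * z" if x: "x \<in> K.trace_divisible p" for x
    proof -
      obtain t :: int where "x - of_int t * b \<in> K.multiples p"
        using K.radical_one_dimensional[OF p(1,3) b x] by blast
      then obtain z where "z \<in> K.\<O>" "x - of_int t * b = of_int p * z" by (rule K.multiplesE)
      then show ?thesis by (intro exI[of _ t] bexI[of _ z]) (auto simp: algebra_simps)
    qed
    have "\<forall>j. \<exists>t z. j < K.deg \<longrightarrow> z \<in> K.\<O> \<and> \<beta> j = of_int t * b + of_int p * z"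
      using dim \<beta>R by blast
    then obtain t z where tz: "\<And>j. j < K.deg \<Longrightarrow> z j \<in> K.\<O>"
      "\<And>j. j < K.deg \<Longrightarrow> \<beta> j = of_int (t j) * b + of_int p * z j" by metis
    \<comment> \<open>Chosen so that modulo p the sum of the \<beta>_j \<phi>(\<alpha>_j) becomes b
      \<phi>(\<tau>).\<close>
    define \<tau> where "\<tau> = (\<Sum>j<K.deg. of_int (t j) * \<alpha> j)"
    have \<tau>O: "\<tau> \<in> K.\<O>" unfolding \<tau>_def by (intro K.O_sum K.O_mult K.O_of_int \<alpha>O) simp
    have "\<tau> \<in> K.trace_divisible p"
      unfolding K.trace_divisible_iff_basis[OF \<alpha> \<tau>O]
    proof (intro allI impI)
      fix i assume i: "i < K.deg"
      have "\<exists>g. j < K.deg \<longrightarrow> K.tr (\<alpha> i * \<alpha> j) = of_int g" for j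
        using K.trace_int[OF K.O_mult[OF \<alpha>O[OF i] \<alpha>O]] by (metis Ints_cases)
      then obtain g where g: "\<And>j. j < K.deg \<Longrightarrow> K.tr (\<alpha> i * \<alpha> j) = of_int (g j)" by metis
      have "of_int d * \<alpha> i = of_int d * (\<Sum>j<K.deg. of_rat (K.tr (\<alpha> i * \<alpha> j)) * K.dual_basis \<alpha> j)"
        using K.dual_basis_expansion[OF \<alpha> K.O_K[OF \<alpha>O[OF i]]] by simp
      also have "\<dots> = (\<Sum>j<K.deg. of_int (g j) * \<beta> j)"
        unfolding sum_distrib_left \<beta>_def by (intro sum.cong refl) (simp add: g mult.left_commute)
      also have "\<dots> = (\<Sum>j<K.deg. of_int (g j * t j) * b + of_int p * (of_int (g j) * z j))"
        by (intro sum.cong refl) (simp add: tz(2) algebra_simps)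
      also have "\<dots> = of_int (\<Sum>j<K.deg. g j * t j) * b + of_int p * (\<Sum>j<K.deg. of_int (g j) * z j)"
        by (simp add: sum.distrib sum_distrib_left sum_distrib_right)
      \<comment> \<open>The coefficient of b is Tr(\<tau> \<alpha>_i). Since d = p m, this multiple
        of b is divisible by p although b is not, so p divides the trace.\<close>
      finally have "of_int (\<Sum>j<K.deg. g j * t j) * b = of_int p * (of_int m * \<alpha> i - (\<Sum>j<K.deg. of_int (g j) * z j))"
        by (simp add: d algebra_simps)
      also have "\<dots> \<in> K.multiples p"
        by (intro K.multiplesI K.O_diff K.O_mult K.O_sum K.O_of_int \<alpha>O i tz) simp
      finally have dvd: "p dvd (\<Sum>j<K.deg. g j * t j)"
        using K.prime_multiple_cancel[OF p(1) bO] b(2) by blast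
      have "\<tau> * \<alpha> i = (\<Sum>j<K.deg. of_rat (of_int (t j)) * (\<alpha> i * \<alpha> j))"
        by (simp add: \<tau>_def sum_distrib_left mult.left_commute mult.commute[of _ "\<alpha> i"])
      also have "K.tr \<dots> = (\<Sum>j<K.deg. of_int (t j) * K.tr (\<alpha> i * \<alpha> j))"
        by (rule K.trace_sum_scale) (use i \<alpha>O K.O_K in \<open>simp add: K.K_mult\<close>)
      also have "\<dots> = of_int (\<Sum>j<K.deg. g j * t j)"
        by (simp add: g) (simp add: mult.commute)
      finally show "K.tr (\<tau> * \<alpha> i) / of_int p \<in> \<int>" using dvd p0 by (elim dvdE) simp
    qed
    then obtain s :: int and y where y: "y \<in> K.\<O>" "\<tau> = of_int s * b + of_int p * y" using dim by blast
    have "of_int p * (of_int m * c) = (\<Sum>j<K.deg. \<beta> j * \<phi> (\<alpha> j))"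
      by (simp add: c_dual_basis[OF \<alpha>] d \<beta>_def sum_distrib_left mult.assoc)
    also have "\<dots> = (\<Sum>j<K.deg. b * (of_rat (of_int (t j)) * \<phi> (\<alpha> j)) + of_int p * (z j * \<phi> (\<alpha> j)))"
      by (intro sum.cong refl) (simp add: tz(2) algebra_simps)
    also have "\<dots> = b * (\<Sum>j<K.deg. of_rat (of_int (t j)) * \<phi> (\<alpha> j)) + of_int p * (\<Sum>j<K.deg. z j * \<phi> (\<alpha> j))"
      by (simp only: sum.distrib sum_distrib_left)
    also have "(\<Sum>j<K.deg. of_rat (of_int (t j)) * \<phi> (\<alpha> j)) = \<phi> \<tau>"
      unfolding \<tau>_def using K.rat_linear_sum[OF linear, of "{..<K.deg}" \<alpha> "\<lambda>j. of_int (t j)"] K.O_K \<alpha>O by simp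
    also have "\<phi> \<tau> = of_int s * \<phi> b + of_int p * \<phi> y"
      unfolding y(2) using bO y(1) by (simp add: phi_add phi_int K.O_K K.K_mult K.K_of_int)
    also have "b * (of_int s * \<phi> b + of_int p * \<phi> y) + of_int p * (\<Sum>j<K.deg. z j * \<phi> (\<alpha> j)) =
        of_int p * (of_int s * (b * \<phi> b / of_int p) + b * \<phi> y + (\<Sum>j<K.deg. z j * \<phi> (\<alpha> j)))"
      using p0 by (simp add: algebra_simps)
    finally have "of_int m * c = of_int s * (b * \<phi> b / of_int p) + b * \<phi> y + (\<Sum>j<K.deg. z j * \<phi> (\<alpha> j))"
      using p0 by simp
    also have "algebraic_int \<dots>"
      by (intro algebraic_int_add algebraic_int_mult algebraic_int_sum phi_radical_square[OF p(1,3) b])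
        (use bO y(1) tz(1) phi_O \<alpha>O in \<open>auto simp: K.O_iff L.O_iff\<close>)
    finally show ?thesis by (simp add: m_def d_def)
  qed
qed

end

section \<open>Traces modulo a prime along a filtration\<close>

definition int_comb :: "complex set \<Rightarrow> (complex \<Rightarrow> int) \<Rightarrow> complex" where
  "int_comb B m = (\<Sum>b\<in>B. of_int (m b) * b)"

lemma int_comb_diff: "int_comb B m - int_comb B m' = int_comb B (\<lambda>b. m b - m' b)"
  by (simp add: int_comb_def left_diff_distrib sum_subtractf)

lemma int_comb_add: "int_comb B m + int_comb B m' = int_comb B (\<lambda>b. m b + m' b)"
  by (simp add: int_comb_def distrib_right sum.distrib)

lemma int_comb_scale: "of_int k * int_comb B m = int_comb B (\<lambda>b. k * m b)"
  by (simp add: int_comb_def sum_distrib_left mult.assoc)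

lemma int_comb_zero: "int_comb B (\<lambda>b. 0) = 0"
  by (simp add: int_comb_def)

lemma int_comb_cong: "(\<And>b. b \<in> B \<Longrightarrow> m b = m' b) \<Longrightarrow> int_comb B m = int_comb B m'"
  by (simp add: int_comb_def)

lemma int_comb_mem: "int_mod.subspace W \<Longrightarrow> B \<subseteq> W \<Longrightarrow> int_comb B m \<in> W"
  unfolding int_comb_def by (intro int_mod.subspace_sum int_mod.subspace_scale) auto

lemma int_comb_union:
  "finite B \<Longrightarrow> finite B' \<Longrightarrow> B \<inter> B' = {} \<Longrightarrow> int_comb (B \<union> B') m = int_comb B m + int_comb B' m"
  by (simp add: int_comb_def sum.union_disjoint)

lemma int_comb_delta: "finite B \<Longrightarrow> b \<in> B \<Longrightarrow> int_comb B (\<lambda>b'. if b' = b then 1 else 0) = b"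
  by (simp add: int_comb_def if_distrib[of of_int] if_distrib[of "\<lambda>x. x * _"] cong: if_cong)

text \<open>A family that is a basis of \<open>W / U\<close> over the field with \<open>p\<close> elements, when \<open>p W \<subseteq> U \<subseteq> W\<close>.\<close>

definition residue_independent :: "nat \<Rightarrow> complex set \<Rightarrow> complex set \<Rightarrow> bool" where
  "residue_independent p U B \<longleftrightarrow> finite B \<and> (\<forall>m. int_comb B m \<in> U \<longrightarrow> (\<forall>b\<in>B. int p dvd m b))"

definition residue_basis :: "nat \<Rightarrow> complex set \<Rightarrow> complex set \<Rightarrow> complex set \<Rightarrow> bool" where
  "residue_basis p W U B \<longleftrightarrow> residue_independent p U B \<and> B \<subseteq> W \<and> (\<forall>w\<in>W. \<exists>m. w - int_comb B m \<in> U)"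

lemma residue_basisD:
  assumes "residue_basis p W U B"
  shows "finite B" "B \<subseteq> W" "int_comb B m \<in> U \<Longrightarrow> b \<in> B \<Longrightarrow> int p dvd m b" "w \<in> W \<Longrightarrow> \<exists>m. w - int_comb B m \<in> U"
  using assms by (auto simp: residue_basis_def residue_independent_def)

text \<open>A count: sending coefficients on C in the range 0, ..., p - 1 to the reduced coordinates
  over B is injective, so p^|C| is at most p^|B|.\<close>

lemma card_residue_independent_le:
  assumes p: "p > 1" and W: "int_mod.subspace W" and U: "int_mod.subspace U"
    and pW: "\<And>w. w \<in> W \<Longrightarrow> of_nat p * w \<in> U"
    and B: "residue_basis p W U B" and C: "residue_independent p U C" "C \<subseteq> W"
  shows "card C \<le> card B"
proof -
  let ?R = "{0..<int p}"
  have "\<exists>x. int_comb C m - int_comb B x \<in> U" for m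
    using residue_basisD(4)[OF B int_comb_mem[OF W C(2)]] .
  then obtain x where x: "\<And>m. int_comb C m - int_comb B (x m) \<in> U" by metis
  define F where "F m = restrict (\<lambda>b. x m b mod int p) B" for m
  have finC: "finite C" using C by (simp add: residue_independent_def)
  have "inj_on F (C \<rightarrow>\<^sub>E ?R)"
  proof (rule inj_onI)
    fix m m' assume m: "m \<in> C \<rightarrow>\<^sub>E ?R" "m' \<in> C \<rightarrow>\<^sub>E ?R" "F m = F m'"
    have "int p dvd x m b - x m' b" if "b \<in> B" for b
      using fun_cong[OF m(3), of b] that by (simp add: F_def mod_eq_dvd_iff)
    then have "\<forall>b. \<exists>k. b \<in> B \<longrightarrow> x m b - x m' b = int p * k" by (meson dvdE)
    then obtain k where k: "\<And>b. b \<in> B \<Longrightarrow> x m b - x m' b = int p * k b" by metis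
    have "int_comb B (x m) - int_comb B (x m') = of_nat p * int_comb B k"
      using int_comb_scale[of "int p" B k] k int_comb_cong[of B "\<lambda>b. x m b - x m' b"] by (simp add: int_comb_diff)
    then have 1: "int_comb B (x m) - int_comb B (x m') \<in> U"
      using pW int_comb_mem[OF W residue_basisD(2)[OF B]] by simp
    have "int_comb C (\<lambda>c. m c - m' c) =
      (int_comb C m - int_comb B (x m)) - (int_comb C m' - int_comb B (x m')) + (int_comb B (x m) - int_comb B (x m'))"
      by (simp flip: int_comb_diff)
    also have "\<dots> \<in> U"
      by (rule int_mod.subspace_add[OF U int_mod.subspace_diff[OF U x[of m] x[of m']] 1])
    finally have "int p dvd m c - m' c" if "c \<in> C" for c
      using C(1) that by (auto simp: residue_independent_def)
    then have "m c mod int p = m' c mod int p" if "c \<in> C" for c using that by (simp add: mod_eq_dvd_iff)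
    moreover have "m c \<in> ?R" "m' c \<in> ?R" if "c \<in> C" for c using m(1,2) that by auto
    ultimately have "m c = m' c" if "c \<in> C" for c using that by (metis atLeastLessThan_iff mod_pos_pos_trivial)
    then show "m = m'" using m(1,2) by (intro PiE_ext) auto
  qed
  moreover have "F ` (C \<rightarrow>\<^sub>E ?R) \<subseteq> B \<rightarrow>\<^sub>E ?R"
    using p by (auto simp: F_def)
  moreover have "finite (B \<rightarrow>\<^sub>E ?R)" using residue_basisD(1)[OF B] by (intro finite_PiE) auto
  ultimately have "card (C \<rightarrow>\<^sub>E ?R) \<le> card (B \<rightarrow>\<^sub>E ?R)" by (rule card_inj_on_le)
  then have "p ^ card C \<le> p ^ card B" using finC residue_basisD(1)[OF B] by (simp add: card_PiE)
  then show ?thesis using p power_increasing_iff by blast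
qed

text \<open>Since p W lies in V, a combination over B with coefficients divisible by p vanishes in W
  / V, and what remains is a relation over B'. The sets are disjoint because elements of B lie
  outside U.\<close>

lemma residue_basis_compose:
  assumes U: "int_mod.subspace U" and V: "int_mod.subspace V" "V \<subseteq> U"
    and pW: "\<And>w. w \<in> W \<Longrightarrow> of_nat p * w \<in> V" and W: "int_mod.subspace W" "U \<subseteq> W" and p: "p > 1"
    and B: "residue_basis p W U B" and B': "residue_basis p U V B'"
  shows "B \<inter> B' = {}" "residue_basis p W V (B \<union> B')"
proof -
  have fin: "finite B" "finite B'" using residue_basisD(1) B B' by auto
  have BU: "b \<notin> U" if "b \<in> B" for b
  proof
    assume "b \<in> U"
    then have "int_comb B (\<lambda>b'. if b' = b then 1 else 0) \<in> U" using int_comb_delta[OF fin(1) that] by simp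
    from residue_basisD(3)[OF B this that] show False using p by simp
  qed
  then show disj: "B \<inter> B' = {}" using residue_basisD(2)[OF B'] by blast
  have "\<exists>m. w - int_comb (B \<union> B') m \<in> V" if w: "w \<in> W" for w
  proof -
    obtain m where m: "w - int_comb B m \<in> U" using residue_basisD(4)[OF B w] by blast
    obtain m' where m': "w - int_comb B m - int_comb B' m' \<in> V" using residue_basisD(4)[OF B' m] by blast
    define k where "k b = (if b \<in> B then m b else m' b)" for b
    have "int_comb B k = int_comb B m" by (rule int_comb_cong) (simp add: k_def)
    moreover have "int_comb B' k = int_comb B' m'" by (rule int_comb_cong) (use disj in \<open>auto simp: k_def\<close>)
    ultimately have "w - int_comb (B \<union> B') k = w - int_comb B m - int_comb B' m'"
      using int_comb_union[OF fin disj, of k] by simp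
    with m' have "w - int_comb (B \<union> B') k \<in> V" by (simp only:)
    then show ?thesis by blast
  qed
  moreover have "residue_independent p V (B \<union> B')"
    unfolding residue_independent_def
  proof (intro conjI allI impI)
    fix m assume mV: "int_comb (B \<union> B') m \<in> V"
    have B'U: "int_comb B' m \<in> U" using int_comb_mem[OF U residue_basisD(2)[OF B']] .
    have "int_comb B m = int_comb (B \<union> B') m - int_comb B' m" using int_comb_union[OF fin disj, of m] by simp
    also have "\<dots> \<in> U" using mV V(2) B'U U by (auto intro: int_mod.subspace_diff)
    finally have 1: "int p dvd m b" if "b \<in> B" for b using residue_basisD(3)[OF B] that by blast
    then have "\<forall>b. \<exists>k. b \<in> B \<longrightarrow> m b = int p * k" by (meson dvdE)
    then obtain k where k: "\<And>b. b \<in> B \<Longrightarrow> m b = int p * k b" by metis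
    have "int_comb B m = of_nat p * int_comb B k"
      using int_comb_scale[of "int p" B k] k int_comb_cong[of B m] by simp
    then have "int_comb B m \<in> V" using pW int_comb_mem[OF W(1) residue_basisD(2)[OF B]] by simp
    then have "int_comb (B \<union> B') m - int_comb B m \<in> V" using mV V(1) by (intro int_mod.subspace_diff)
    then have "int_comb B' m \<in> V" using int_comb_union[OF fin disj, of m] by simp
    then show "\<forall>b\<in>B \<union> B'. int p dvd m b" using 1 residue_basisD(3)[OF B'] by blast
  qed (use fin in auto)
  ultimately show "residue_basis p W V (B \<union> B')"
    using residue_basisD(2)[OF B] residue_basisD(2)[OF B'] W(2) by (auto simp: residue_basis_def)
qed

text \<open>A relation rather than a function: t is an integer representing the trace of
  multiplication by x on W / U, and it depends modulo p only on x, while the integer itself depends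
  on the basis and the matrix chosen.\<close>

definition residue_trace :: "nat \<Rightarrow> complex set \<Rightarrow> complex set \<Rightarrow> complex \<Rightarrow> int \<Rightarrow> bool" where
  "residue_trace p W U x t \<longleftrightarrow> (\<exists>B n. residue_basis p W U B \<and>
     (\<forall>b\<in>B. x * b - int_comb B (n b) \<in> U) \<and> t = (\<Sum>b\<in>B. n b b))"

lemma residue_trace_add:
  assumes U: "int_mod.subspace U" and V: "int_mod.subspace V" "V \<subseteq> U"
    and pW: "\<And>w. w \<in> W \<Longrightarrow> of_nat p * w \<in> V" and W: "int_mod.subspace W" "U \<subseteq> W" and p: "p > 1"
    and t: "residue_trace p W U x t" and s: "residue_trace p U V x s"
  shows "residue_trace p W V x (t + s)"
proof -
  obtain B n where B: "residue_basis p W U B" "\<And>b. b \<in> B \<Longrightarrow> x * b - int_comb B (n b) \<in> U" "t = (\<Sum>b\<in>B. n b b)"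
    using t by (auto simp: residue_trace_def)
  obtain B' n' where B': "residue_basis p U V B'" "\<And>b. b \<in> B' \<Longrightarrow> x * b - int_comb B' (n' b) \<in> V" "s = (\<Sum>b\<in>B'. n' b b)"
    using s by (auto simp: residue_trace_def)
  have fin: "finite B" "finite B'" using residue_basisD(1) B(1) B'(1) by auto
  note comp = residue_basis_compose[OF U V pW W p B(1) B'(1)]
  have "\<forall>b. \<exists>k. b \<in> B \<longrightarrow> x * b - int_comb B (n b) - int_comb B' k \<in> V"
    using residue_basisD(4)[OF B'(1) B(2)] by blast
  then obtain k where k: "\<And>b. b \<in> B \<Longrightarrow> x * b - int_comb B (n b) - int_comb B' (k b) \<in> V" by metis
  \<comment> \<open>A block triangular integer matrix: elements of B' have no component along B, so
    its trace is the sum of the traces of the diagonal blocks.\<close>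
  define N where "N b b' = (if b \<in> B then if b' \<in> B then n b b' else k b b' else if b' \<in> B then 0 else n' b b')" for b b'
  have BB': "b \<notin> B" if "b \<in> B'" for b using comp(1) that by blast
  have "x * b - int_comb (B \<union> B') (N b) \<in> V" if "b \<in> B \<union> B'" for b
  proof (cases "b \<in> B")
    case True
    have "int_comb B (N b) = int_comb B (n b)" "int_comb B' (N b) = int_comb B' (k b)"
      using True BB' by (auto intro!: int_comb_cong simp: N_def)
    then show ?thesis using k[OF True] int_comb_union[OF fin comp(1), of "N b"] by (simp add: algebra_simps)
  next
    case False
    then have b: "b \<in> B'" using that by blast
    have "int_comb B (N b) = int_comb B (\<lambda>b. 0)" "int_comb B' (N b) = int_comb B' (n' b)"
      using False BB' by (auto intro!: int_comb_cong simp: N_def)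
    then show ?thesis using B'(2)[OF b] int_comb_union[OF fin comp(1), of "N b"] by (simp add: int_comb_zero)
  qed
  moreover have "(\<Sum>b\<in>B \<union> B'. N b b) = t + s"
    using fin comp(1) BB' by (simp add: sum.union_disjoint B(3) B'(3) N_def)
  ultimately show ?thesis using comp(2) unfolding residue_trace_def by metis
qed

section \<open>Residue bases inside the integers, and the field trace modulo p\<close>

context num_field
begin

lemma subspace_multiples: "int_mod.subspace (multiples k)"
  by (rule int_mod.subspaceI) (auto simp: multiples_zero multiples_add multiples_mult O_of_int)

lemma residue_basis_zbasis:
  assumes \<alpha>: "zbasis \<alpha>"
  shows "residue_basis p \<O> (multiples (int p)) (\<alpha> ` {..<deg})" "card (\<alpha> ` {..<deg}) = deg"
proof -
  have inj: "inj_on \<alpha> {..<deg}" using qbasis_inj_on[OF zbasisD(1)[OF \<alpha>]] .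
  have comb: "int_comb (\<alpha> ` {..<deg}) m = (\<Sum>j<deg. of_int (m (\<alpha> j)) * \<alpha> j)" for m
    unfolding int_comb_def using sum.reindex[OF inj] by simp
  have "\<exists>m. w - int_comb (\<alpha> ` {..<deg}) m \<in> multiples (int p)" if "w \<in> \<O>" for w
  proof -
    obtain m where "w = (\<Sum>j<deg. of_int (m j) * \<alpha> j)" using zbasisD(3)[OF \<alpha> \<open>w \<in> \<O>\<close>] by blast
    moreover have "int_comb (\<alpha> ` {..<deg}) (\<lambda>v. m (the_inv_into {..<deg} \<alpha> v)) = (\<Sum>j<deg. of_int (m j) * \<alpha> j)"
      unfolding comb using inj by (intro sum.cong) (auto simp: the_inv_into_f_f)
    ultimately show ?thesis
      by (intro exI[of _ "\<lambda>v. m (the_inv_into {..<deg} \<alpha> v)"]) (simp add: multiples_zero)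
  qed
  moreover have "int p dvd m b" if "int_comb (\<alpha> ` {..<deg}) m \<in> multiples (int p)" "b \<in> \<alpha> ` {..<deg}" for m b
    using that multiples_iff_coordinates[OF \<alpha> comb] by auto
  ultimately show "residue_basis p \<O> (multiples (int p)) (\<alpha> ` {..<deg})"
    unfolding residue_basis_def residue_independent_def using zbasisD(2)[OF \<alpha>] by auto
  show "card (\<alpha> ` {..<deg}) = deg" using card_image[OF inj] by simp
qed

lemma card_residue_independent_le_deg:
  assumes "p > 1" "residue_independent p U C" "C \<subseteq> \<O>" "multiples (int p) \<subseteq> U"
  shows "card C \<le> deg"
proof -
  obtain \<alpha> where \<alpha>: "zbasis \<alpha>" using ex_zbasis .
  have "residue_independent p (multiples (int p)) C"
    using assms(2,4) unfolding residue_independent_def by blast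
  then show ?thesis
    using card_residue_independent_le[OF assms(1) subspace_O subspace_multiples _ residue_basis_zbasis(1)[OF \<alpha>] _ assms(3)]
      residue_basis_zbasis(2)[OF \<alpha>] multiplesI[of _ "int p"] by simp
qed

lemma card_residue_basis:
  assumes "p > 1" "residue_basis p \<O> (multiples (int p)) B"
  shows "card B = deg"
proof -
  obtain \<alpha> where \<alpha>: "zbasis \<alpha>" using ex_zbasis .
  have "card (\<alpha> ` {..<deg}) \<le> card B"
    by (rule card_residue_independent_le[OF assms(1) subspace_O subspace_multiples _ assms(2)])
      (use residue_basis_zbasis(1)[OF \<alpha>, of p] multiplesI[of _ "int p"] in \<open>auto simp: residue_basis_def\<close>)
  moreover have "card B \<le> deg"
    by (rule card_residue_independent_le_deg[OF assms(1)]) (use assms(2) in \<open>auto simp: residue_basis_def\<close>)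
  ultimately show ?thesis using residue_basis_zbasis(2)[OF \<alpha>] by simp
qed

text \<open>A largest independent family exists because sizes are bounded by \<open>deg\<close>.
  Adding w to it produces a relation in which the coefficient of w is prime to p, and inverting that
  coefficient modulo p expresses w.\<close>

lemma ex_residue_basis:
  assumes p: "Factorial_Ring.prime p" and U: "int_mod.subspace U" "multiples (int p) \<subseteq> U"
    and W: "int_mod.subspace W" "W \<subseteq> \<O>"
  obtains B where "residue_basis p W U B"
proof -
  have p1: "p > 1" using p prime_gt_1_nat by blast
  have pW: "of_int (int p) * w \<in> U" if "w \<in> W" for w
    using U(2) W(2) that multiplesI by blast
  define Q where "Q C \<longleftrightarrow> residue_independent p U C \<and> C \<subseteq> W" for C
  have "Q {}" by (simp add: Q_def residue_independent_def)
  moreover have "card C < Suc deg" if "Q C" for C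
    using card_residue_independent_le_deg[OF p1, of U C] that U(2) W(2) unfolding Q_def
    by (metis less_Suc_eq_le subset_trans)
  ultimately obtain C where C: "Q C" and max: "\<And>C'. Q C' \<Longrightarrow> card C' \<le> card C"
    using ex_has_greatest_nat[of Q "{}" card "Suc deg"] by blast
  have fin: "finite C" and indep: "residue_independent p U C" and CW: "C \<subseteq> W"
    using C by (auto simp: Q_def residue_independent_def)
  have "\<exists>m. w - int_comb C m \<in> U" if w: "w \<in> W" for w
  proof (cases "w \<in> C")
    case True
    then show ?thesis
      using int_comb_delta[OF fin True] int_mod.subspace_0[OF U(1)] by (metis diff_self)
  next
    case False
    have "\<not> Q (insert w C)"
    proof
      assume "Q (insert w C)"
      from max[OF this] show False using False fin by simp
    qed
    then obtain m where m: "int_comb (insert w C) m \<in> U" "\<not> (\<forall>b\<in>insert w C. int p dvd m b)"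
      using fin w CW by (auto simp: Q_def residue_independent_def)
    have comb: "int_comb (insert w C) m = of_int (m w) * w + int_comb C m"
      using False fin by (simp add: int_comb_def)
    have ndvd: "\<not> int p dvd m w"
    proof
      assume dvd: "int p dvd m w"
      then obtain k where "m w = int p * k" by (elim dvdE)
      then have "of_int (m w) * w = of_int k * (of_int (int p) * w)" by simp
      also have "\<dots> \<in> U" by (rule int_mod.subspace_scale[OF U(1) pW[OF w]])
      finally have "int_comb (insert w C) m - of_int (m w) * w \<in> U"
        using m(1) U(1) by (intro int_mod.subspace_diff)
      then have "int_comb C m \<in> U" unfolding comb by simp
      then show False using indep m(2) dvd by (auto simp: residue_independent_def)
    qed
    then have "gcd (int p) (m w) = 1" using p by (meson coprime_iff_gcd_eq_1 prime_imp_coprime prime_nat_int_transfer)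
    then obtain x y where xy: "x * int p + y * m w = 1" using bezout_int[of "int p" "m w"] by auto
    have "w - int_comb C (\<lambda>c. - y * m c) = of_int (x * int p + y * m w) * w - of_int (- y) * int_comb C m"
      unfolding xy by (simp only: int_comb_scale of_int_1 mult_1)
    also have "\<dots> = of_int x * (of_int (int p) * w) + of_int y * int_comb (insert w C) m"
      unfolding comb by (simp add: algebra_simps)
    also have "\<dots> \<in> U"
      by (rule int_mod.subspace_add[OF U(1) int_mod.subspace_scale[OF U(1) pW[OF w]] int_mod.subspace_scale[OF U(1) m(1)]])
    finally show ?thesis by blast
  qed
  then have "residue_basis p W U C" using indep CW by (simp add: residue_basis_def)
  then show ?thesis by (rule that)
qed

text \<open>Infinite descent: the coefficients of an integral relation are all divisible by p, and
  dividing by p gives a relation again. So every power of p divides them and they vanish.\<close>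

lemma residue_basis_imp_qbasis:
  assumes p: "p > 1" and B: "residue_basis p \<O> (multiples (int p)) B"
  shows "qbasis K B (\<lambda>b. b)"
proof (rule independent_imp_qbasis)
  show fin: "finite B" using residue_basisD(1)[OF B] .
  show "b \<in> K" if "b \<in> B" for b using residue_basisD(2)[OF B] that O_K by blast
  show "card B = deg" by (rule card_residue_basis[OF p B])
  fix q b assume 0: "(\<Sum>b\<in>B. of_rat (q b) * b) = 0" and b: "b \<in> B"
  obtain D :: int where D: "D > 0" "\<And>r. r \<in> q ` B \<Longrightarrow> of_int D * r \<in> \<int>"
    using common_denominator[of "q ` B"] fin by auto
  then have "\<forall>b. \<exists>m. b \<in> B \<longrightarrow> of_int D * q b = of_int m" by (auto elim!: Ints_cases)
  then obtain m where m: "\<And>b. b \<in> B \<Longrightarrow> of_int D * q b = of_int (m b)" by metis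
  have m': "of_int D * of_rat (q b) = (of_int (m b) :: complex)" if "b \<in> B" for b
    using arg_cong[OF m[OF that], of "of_rat :: rat \<Rightarrow> complex"] by (simp add: of_rat_mult)
  have "int_comb B m = of_int D * (\<Sum>b\<in>B. of_rat (q b) * b)"
    unfolding int_comb_def sum_distrib_left by (intro sum.cong refl) (simp add: m' flip: mult.assoc)
  then have m0: "int_comb B m = 0" using 0 by simp
  have "\<exists>m'. int_comb B m' = 0 \<and> (\<forall>b\<in>B. m b = int p ^ k * m' b)" for k
  proof (induction k)
    case 0
    then show ?case using m0 by (intro exI[of _ m]) simp
  next
    case (Suc k)
    then obtain m' where m': "int_comb B m' = 0" "\<forall>b\<in>B. m b = int p ^ k * m' b" by blast
    then have "\<forall>b\<in>B. int p dvd m' b" using residue_basisD(3)[OF B, of m'] multiples_zero by simp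
    then have "\<forall>b. \<exists>l. b \<in> B \<longrightarrow> m' b = int p * l" by (meson dvdE)
    then obtain l where l: "\<And>b. b \<in> B \<Longrightarrow> m' b = int p * l b" by metis
    have "of_int (int p) * int_comb B l = 0"
      using m'(1) int_comb_cong[of B m', OF l] by (simp only: int_comb_scale)
    then have "int_comb B l = 0" using p by simp
    then show ?case using m'(2) l by (intro exI[of _ l]) simp
  qed
  then have dvd: "int p ^ k dvd m b" for k using b by (metis dvd_triv_left)
  have "m b = 0"
  proof (rule ccontr)
    assume nz: "m b \<noteq> 0"
    have "int p ^ nat \<bar>m b\<bar> \<le> \<bar>m b\<bar>" using dvd[of "nat \<bar>m b\<bar>"] nz zdvd_imp_le[of "int p ^ nat \<bar>m b\<bar>" "\<bar>m b\<bar>"] by simp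
    moreover have "nat \<bar>m b\<bar> < p ^ nat \<bar>m b\<bar>" using p by (intro power_gt_expt) simp
    then have "int (nat \<bar>m b\<bar>) < int (p ^ nat \<bar>m b\<bar>)" by (simp only: of_nat_less_iff)
    ultimately show False by simp
  qed
  then show "q b = 0" using m[OF b] D(1) by simp
qed

text \<open>The index of the lattice spanned by \<open>B\<close> in \<open>\<O>\<close> is prime to \<open>p\<close>.\<close>

lemma residue_basis_denominator:
  assumes p: "p > 1" and B: "residue_basis p \<O> (multiples (int p)) B" and w: "w \<in> \<O>"
  obtains s :: int and u where "\<not> int p dvd s" "of_int s * w = int_comb B u"
proof -
  have q: "qbasis K B (\<lambda>b. b)" by (rule residue_basis_imp_qbasis[OF p B])
  obtain r where r: "w = (\<Sum>b\<in>B. of_rat (r b) * b)" using qbasisD(3)[OF q O_K[OF w]] by blast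
  obtain D :: int where D: "D > 0" "\<And>x. x \<in> r ` B \<Longrightarrow> of_int D * x \<in> \<int>"
    using common_denominator[of "r ` B"] qbasisD(1)[OF q] by auto
  then have "\<forall>b. \<exists>m. b \<in> B \<longrightarrow> of_int D * r b = of_int m" by (auto elim!: Ints_cases)
  then obtain m where m: "\<And>b. b \<in> B \<Longrightarrow> of_int D * r b = of_int (m b)" by metis
  have m': "of_int D * of_rat (r b) = (of_int (m b) :: complex)" if "b \<in> B" for b
    using arg_cong[OF m[OF that], of "of_rat :: rat \<Rightarrow> complex"] by (simp add: of_rat_mult)
  have "of_int D * w = int_comb B m"
    unfolding r int_comb_def sum_distrib_left by (intro sum.cong refl) (simp add: m' flip: mult.assoc)
  then have "\<exists>k m. k > 0 \<and> of_nat k * w = int_comb B m"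
    using D(1) by (intro exI[of _ "nat D"] exI[of _ m]) simp
  then obtain k where k: "k > 0 \<and> (\<exists>m. of_nat k * w = int_comb B m)"
    and least: "\<And>l. l > 0 \<and> (\<exists>m. of_nat l * w = int_comb B m) \<Longrightarrow> k \<le> l"
    using ex_has_least_nat[of "\<lambda>k. k > 0 \<and> (\<exists>m. of_nat k * w = int_comb B m)" _ "\<lambda>k. k"] by blast
  then obtain m where m: "of_nat k * w = int_comb B m" by blast
  \<comment> \<open>If p divided the least denominator, all coordinates would be divisible by p and
    k / p would be a smaller one.\<close>
  have "\<not> p dvd k"
  proof
    assume "p dvd k"
    then obtain l where l: "k = p * l" by (elim dvdE)
    then have "int_comb B m = of_int (int p) * (of_int (int l) * w)" using m by (simp add: mult.assoc)
    also have "\<dots> \<in> multiples (int p)" using w by (intro multiplesI O_mult O_of_int)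
    finally have "int p dvd m b" if "b \<in> B" for b using residue_basisD(3)[OF B] that by blast
    then have "\<forall>b. \<exists>l. b \<in> B \<longrightarrow> m b = int p * l" by (meson dvdE)
    then obtain n where n: "\<And>b. b \<in> B \<Longrightarrow> m b = int p * n b" by metis
    have "of_int (int p) * int_comb B n = int_comb B m" unfolding int_comb_scale by (rule int_comb_cong) (simp add: n)
    then have "of_nat p * (of_nat l * w) = of_nat p * int_comb B n" using m l by (simp add: mult.assoc)
    then have "of_nat l * w = int_comb B n" using p by simp
    then have "k \<le> l" using least[of l] k l by auto
    then show False using l k p by simp
  qed
  then have "\<not> int p dvd int k" by simp
  then show ?thesis using that[of "int k" m] m by simp
qed

text \<open>B is a rational basis but need not generate \<O>, so the error terms p w_b have
  denominators in B. These are prime to p, hence harmless modulo p once cleared.\<close>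

lemma residue_trace_field_trace:
  assumes p: "Factorial_Ring.prime p" and x: "x \<in> \<O>" and t: "residue_trace p \<O> (multiples (int p)) x t"
  obtains k :: int where "tr x = of_int (t + int p * k)"
proof -
  have p1: "p > 1" using p prime_gt_1_nat by blast
  obtain B n where B: "residue_basis p \<O> (multiples (int p)) B"
    "\<And>b. b \<in> B \<Longrightarrow> x * b - int_comb B (n b) \<in> multiples (int p)" "t = (\<Sum>b\<in>B. n b b)"
    using t by (auto simp: residue_trace_def)
  have q: "qbasis K B (\<lambda>b. b)" by (rule residue_basis_imp_qbasis[OF p1 B(1)])
  have fin: "finite B" using residue_basisD(1)[OF B(1)] .
  have "\<forall>b. \<exists>w s u. b \<in> B \<longrightarrow> w \<in> \<O> \<and> x * b = int_comb B (n b) + of_int (int p) * w \<and> \<not> int p dvd s \<and> of_int s * w = int_comb B u"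
  proof
    fix b
    show "\<exists>w s u. b \<in> B \<longrightarrow> w \<in> \<O> \<and> x * b = int_comb B (n b) + of_int (int p) * w \<and> \<not> int p dvd s \<and> of_int s * w = int_comb B u"
    proof (cases "b \<in> B")
      case True
      obtain w where w: "w \<in> \<O>" "x * b - int_comb B (n b) = of_int (int p) * w" using B(2)[OF True] by (rule multiplesE)
      obtain s :: int and u where "\<not> int p dvd s" "of_int s * w = int_comb B u"
        using residue_basis_denominator[OF p1 B(1) w(1)] .
      moreover have "x * b = int_comb B (n b) + of_int (int p) * w" using w(2) by (simp add: algebra_simps)
      ultimately show ?thesis using w(1) by (intro exI[of _ w] exI[of _ s] exI[of _ u]) simp
    qed simp
  qed
  then have "\<exists>w s u. \<forall>b. b \<in> B \<longrightarrow> w b \<in> \<O> \<and> x * b = int_comb B (n b) + of_int (int p) * w b \<and>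
      \<not> int p dvd s b \<and> of_int (s b) * w b = int_comb B (u b)"
    by (simp only: choice_iff)
  then obtain w s u where wsu: "\<And>b. b \<in> B \<Longrightarrow> x * b = int_comb B (n b) + of_int (int p) * w b"
    "\<And>b. b \<in> B \<Longrightarrow> \<not> int p dvd s b" "\<And>b. b \<in> B \<Longrightarrow> of_int (s b) * w b = int_comb B (u b)" by blast
  \<comment> \<open>A common denominator for all rows, still prime to p, making the whole matrix of
    S x integral.\<close>
  define S where "S = prod s B"
  have pS: "\<not> int p dvd S" unfolding S_def using fin p wsu(2) prime_dvd_prod_iff[OF fin, of "int p" s] by auto
  define T where "T b = prod s (B - {b})" for b
  have ST: "S = T b * s b" if "b \<in> B" for b
    unfolding S_def T_def using prod.remove[OF fin that, of s] by (metis mult.commute)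
  have "tr (of_int S * x) = (\<Sum>b\<in>B. of_int (S * n b b + int p * (T b * u b b)))"
  proof (rule trace_qbasis[OF q, where q = "\<lambda>b b'. of_int (S * n b b' + int p * (T b * u b b'))"])
    fix b assume b: "b \<in> B"
    have "of_int S * x * b = of_int S * int_comb B (n b) + of_int (int p) * (of_int (T b) * (of_int (s b) * w b))"
      unfolding mult.assoc[of "of_int S" x] wsu(1)[OF b] unfolding ST[OF b] of_int_mult by (simp add: algebra_simps)
    also have "\<dots> = int_comb B (\<lambda>b'. S * n b b' + int p * (T b * u b b'))"
      unfolding wsu(3)[OF b] int_comb_scale int_comb_add ..
    finally show "of_int S * x * b = (\<Sum>b'\<in>B. of_rat (of_int (S * n b b' + int p * (T b * u b b'))) * b')"
      by (simp only: int_comb_def of_rat_of_int_eq)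
  qed (use x in \<open>auto intro: K_mult K_of_int O_K\<close>)
  then have "of_int S * tr x = of_int (S * t + int p * (\<Sum>b\<in>B. T b * u b b))"
    using x by (simp add: trace_int_scale O_K B(3) sum.distrib sum_distrib_left)
  moreover obtain z where z: "tr x = of_int z" using trace_int[OF x] by (elim Ints_cases)
  moreover have "of_int (S * z) = of_int S * tr x" unfolding z by (rule of_int_mult)
  ultimately have "of_int (S * z) = (of_int (S * t + int p * (\<Sum>b\<in>B. T b * u b b)) :: rat)" by (simp only:)
  then have "S * z = S * t + int p * (\<Sum>b\<in>B. T b * u b b)" by (simp only: of_int_eq_iff)
  then have "S * (z - t) = int p * (\<Sum>b\<in>B. T b * u b b)" by (simp only: right_diff_distrib)
  then have "int p dvd S * (z - t)" by (metis dvd_triv_left)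
  moreover have "Factorial_Ring.prime (int p)" using p by (simp only: prime_nat_int_transfer)
  ultimately have "int p dvd z - t" using pS by (metis prime_dvd_multD)
  then obtain k where "z - t = int p * k" by (elim dvdE)
  then have "z = t + int p * k" by simp
  then show ?thesis using z that by blast
qed

end

section \<open>Prime ideals\<close>

text \<open>By Bezout. Applied to the coefficients of a primitive polynomial it would put 1 into a
  prime ideal containing them.\<close>

lemma Gcd_mem_subspace:
  assumes "finite A" "\<And>a. a \<in> A \<Longrightarrow> of_int a \<in> P" "int_mod.subspace P"
  shows "of_int (Gcd A) \<in> P"
  using assms
proof (induction A)
  case empty
  then show ?case by (simp add: int_mod.subspace_0)
next
  case (insert a A)
  obtain x y where "x * a + y * Gcd A = gcd a (Gcd A)" using bezout_int by blast
  then have "of_int (Gcd (insert a A)) = of_int x * of_int a + of_int y * (of_int (Gcd A) :: complex)"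
    by (metis Gcd_insert of_int_add of_int_mult)
  then show ?case using insert by (simp add: int_mod.subspace_add int_mod.subspace_scale)
qed

section \<open>Ideals of the ring of integers as submodules, and their products\<close>

context num_field
begin

abbreviation "R \<equiv> integer_ring K"

lemma integer_ring_simps [simp]:
  "carrier R = \<O>" "x \<otimes>\<^bsub>R\<^esub> y = x * y" "\<one>\<^bsub>R\<^esub> = 1" "\<zero>\<^bsub>R\<^esub> = 0" "x \<oplus>\<^bsub>R\<^esub> y = x + y"
  by (simp_all add: integer_ring_def complex_ring_def)

lemma cring_integer_ring: "cring R"
proof (intro cringI abelian_groupI comm_monoidI)
  fix x assume "x \<in> carrier R"
  then show "\<exists>y\<in>carrier R. y \<oplus>\<^bsub>R\<^esub> x = \<zero>\<^bsub>R\<^esub>"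
    by (intro bexI[of _ "- x"]) (auto simp: O_neg)
qed (auto simp: algebra_simps O_add O_mult O_zero O_one)

lemma ideal_iff:
  "ideal I R \<longleftrightarrow> I \<subseteq> \<O> \<and> int_mod.subspace I \<and> (\<forall>x\<in>I. \<forall>r\<in>\<O>. r * x \<in> I)"
proof
  interpret cring R by (rule cring_integer_ring)
  assume I: "ideal I R"
  have "I \<subseteq> \<O>" using ideal.Icarr[OF I] by auto
  moreover have *: "r * x \<in> I" if "x \<in> I" "r \<in> \<O>" for x r using ideal.I_l_closed[OF I, of x r] that by simp
  moreover have "int_mod.subspace I"
    using additive_subgroup.zero_closed[OF ideal.axioms(1)[OF I]] additive_subgroup.a_closed[OF ideal.axioms(1)[OF I]] * O_of_int
    by (intro int_mod.subspaceI) auto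
  ultimately show "I \<subseteq> \<O> \<and> int_mod.subspace I \<and> (\<forall>x\<in>I. \<forall>r\<in>\<O>. r * x \<in> I)" by blast
next
  interpret cring R by (rule cring_integer_ring)
  assume I: "I \<subseteq> \<O> \<and> int_mod.subspace I \<and> (\<forall>x\<in>I. \<forall>r\<in>\<O>. r * x \<in> I)"
  have neg: "\<ominus>\<^bsub>R\<^esub> x = - x" if "x \<in> I" for x
    using that I by (intro minus_equality) (auto simp: O_neg)
  show "ideal I R"
  proof (rule idealI)
    show "ring R" by (rule ring_axioms)
    show "subgroup I (add_monoid R)"
    proof (rule subgroup.intro)
      fix x assume "x \<in> I"
      then have "\<ominus>\<^bsub>R\<^esub> x \<in> I" using neg I int_mod.subspace_neg by simp
      then show "inv\<^bsub>add_monoid R\<^esub> x \<in> I" by (simp only: a_inv_def)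
    qed (use I in \<open>auto simp: int_mod.subspace_add int_mod.subspace_0\<close>)
    show "x \<otimes>\<^bsub>R\<^esub> a \<in> I" "a \<otimes>\<^bsub>R\<^esub> x \<in> I" if "a \<in> I" "x \<in> carrier R" for a x
      using I that by (simp_all add: mult.commute)
  qed
qed

lemma idealD:
  assumes "ideal I R"
  shows "I \<subseteq> \<O>" "int_mod.subspace I" "x \<in> I \<Longrightarrow> r \<in> \<O> \<Longrightarrow> r * x \<in> I"
  using assms by (auto simp: ideal_iff)

lemma ideal_multiples: "ideal (multiples k) R"
  unfolding ideal_iff using subspace_multiples multiples_O multiples_mult by blast

lemma PIdl_of_nat: "PIdl\<^bsub>R\<^esub> (of_nat p) = multiples (int p)"
  by (auto simp: cgenideal_def multiples_def mult.commute)

abbreviation ideal_mult (infixl "\<bullet>" 70) where "I \<bullet> J \<equiv> ideal_prod R I J"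

lemma ideal_multI: "x \<in> I \<Longrightarrow> y \<in> J \<Longrightarrow> x * y \<in> I \<bullet> J"
  using ideal_prod.prod[of x I y J R] by simp

lemma ideal_mult_subset:
  assumes "int_mod.subspace X" "\<And>x y. x \<in> I \<Longrightarrow> y \<in> J \<Longrightarrow> x * y \<in> X"
  shows "I \<bullet> J \<subseteq> X"
proof
  fix s assume "s \<in> I \<bullet> J"
  then show "s \<in> X"
    by (induction rule: ideal_prod.induct) (use assms in \<open>auto simp: int_mod.subspace_add\<close>)
qed

lemma ideal_ideal_mult: "ideal I R \<Longrightarrow> ideal J R \<Longrightarrow> ideal (I \<bullet> J) R"
  by (rule ring.ideal_prod_is_ideal[OF cring.axioms(1)[OF cring_integer_ring]])

abbreviation "M \<equiv> ideals_set R"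

lemma comm_monoid_ideals: "comm_monoid M"
  by (rule cring.ideals_set_is_comm_monoid[OF cring_integer_ring])

lemma ideals_set_simps [simp]:
  "carrier M = {I. ideal I R}" "I \<otimes>\<^bsub>M\<^esub> J = I \<bullet> J" "\<one>\<^bsub>M\<^esub> = \<O>"
  by (simp_all add: ideals_set_def)

lemma ideal_mult_assoc: "ideal I R \<Longrightarrow> ideal J R \<Longrightarrow> ideal N R \<Longrightarrow> I \<bullet> J \<bullet> N = I \<bullet> (J \<bullet> N)"
  using monoid.m_assoc[OF comm_monoid.axioms(1)[OF comm_monoid_ideals], of I J N] by simp

lemma ideal_mult_commute: "ideal I R \<Longrightarrow> ideal J R \<Longrightarrow> I \<bullet> J = J \<bullet> I"
  using comm_monoid.m_comm[OF comm_monoid_ideals, of I J] by simp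

end

section \<open>A prime ideal over p, its finite residue field and its valuation ring\<close>

locale prime_over = num_field +
  fixes P :: "complex set" and p :: nat
  assumes prime_P: "primeideal P R" and prime_p: "Factorial_Ring.prime p" and p_P: "of_nat p \<in> P"
begin

lemma ideal_P: "ideal P R"
  using prime_P by (rule primeideal.axioms(1))

lemmas subspace_P = idealD(2)[OF ideal_P]

lemma P_O: "x \<in> P \<Longrightarrow> x \<in> \<O>"
  using idealD(1)[OF ideal_P] by blast

lemma P_add: "x \<in> P \<Longrightarrow> y \<in> P \<Longrightarrow> x + y \<in> P"
  and P_diff: "x \<in> P \<Longrightarrow> y \<in> P \<Longrightarrow> x - y \<in> P"
  and P_neg: "x \<in> P \<Longrightarrow> - x \<in> P"
  and P_zero: "0 \<in> P"
  and P_sum: "(\<And>i. i \<in> A \<Longrightarrow> f i \<in> P) \<Longrightarrow> sum f A \<in> P"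
  by (rule int_mod.subspace_add[OF subspace_P] int_mod.subspace_diff[OF subspace_P] int_mod.subspace_neg[OF subspace_P]
      int_mod.subspace_0[OF subspace_P] int_mod.subspace_sum[OF subspace_P]; assumption)+

lemma P_mult: "r \<in> \<O> \<Longrightarrow> x \<in> P \<Longrightarrow> r * x \<in> P"
  by (rule idealD(3)[OF ideal_P])

lemma P_prime: "x \<in> \<O> \<Longrightarrow> y \<in> \<O> \<Longrightarrow> x * y \<in> P \<Longrightarrow> x \<in> P \<or> y \<in> P"
  using primeideal.I_prime[OF prime_P, of x y] by simp

lemma one_not_P: "1 \<notin> P"
proof
  assume "1 \<in> P"
  then have "x \<in> P" if "x \<in> \<O>" for x using P_mult[OF that, of 1] by simp
  then have "P = carrier R" using P_O by auto
  then show False using primeideal.I_notcarr[OF prime_P] by simp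
qed

lemma p_gt_1: "p > 1"
  using prime_p prime_gt_1_nat by blast

lemma multiples_P: "multiples (int p) \<subseteq> P"
  using P_mult[OF _ p_P] by (auto simp: multiples_def mult.commute)

lemma P_power: "z \<in> \<O> \<Longrightarrow> z ^ k \<in> P \<Longrightarrow> z \<in> P"
proof (induction k)
  case (Suc k)
  have "z ^ k \<in> \<O>" using Suc(2) by (induction k) (auto simp: O_one O_mult)
  then show ?case using P_prime[OF Suc(2), of "z ^ k"] Suc by auto
qed (simp add: one_not_P)

lemma of_int_P_iff: "of_int m \<in> P \<longleftrightarrow> int p dvd m"
proof
  assume m: "of_int m \<in> P"
  show "int p dvd m"
  proof (rule ccontr)
    assume "\<not> int p dvd m"
    then have "gcd (int p) m = 1" using prime_p by (meson coprime_iff_gcd_eq_1 prime_imp_coprime prime_nat_int_transfer)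
    then obtain x y where xy: "x * int p + y * m = 1" using bezout_int[of "int p" m] by auto
    have "of_int (x * int p + y * m) = of_int x * of_nat p + of_int y * (of_int m :: complex)" by simp
    also have "\<dots> \<in> P" by (intro P_add P_mult O_of_int p_P m)
    finally show False using one_not_P xy by simp
  qed
next
  assume "int p dvd m"
  then obtain k where "m = int p * k" by (elim dvdE)
  then show "of_int m \<in> P" using P_mult[OF O_of_int p_P, of k] by (simp add: mult.commute)
qed

definition B :: "complex set" where
  "B = (SOME B. residue_basis p \<O> P B)"

lemma basis_B: "residue_basis p \<O> P B"
proof -
  obtain B' where "residue_basis p \<O> P B'"
    using ex_residue_basis[OF prime_p subspace_P multiples_P subspace_O] by blast
  then show ?thesis unfolding B_def by (rule someI)
qed

lemma finite_B: "finite B" and B_O: "b \<in> B \<Longrightarrow> b \<in> \<O>"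
  using residue_basisD(1,2)[OF basis_B] by auto

lemma B_not_P: "b \<in> B \<Longrightarrow> b \<notin> P"
proof
  assume b: "b \<in> B" "b \<in> P"
  then have "int_comb B (\<lambda>b'. if b' = b then 1 else 0) \<in> P" using int_comb_delta[OF finite_B] by simp
  from residue_basisD(3)[OF basis_B this b(1)] show False using p_gt_1 by simp
qed

text \<open>Reduced to 0, ..., p - 1 and extensional on \<open>B\<close>, the coordinates in the
  residue field become a function of the class modulo P. This gives each class the canonical
  representative \<open>rep\<close>.\<close>

definition coords :: "complex \<Rightarrow> complex \<Rightarrow> int" where
  "coords w = (SOME m. m \<in> B \<rightarrow>\<^sub>E {0..<int p} \<and> w - int_comb B m \<in> P)"

lemma coords_unique:
  assumes m: "m \<in> B \<rightarrow>\<^sub>E {0..<int p}" "m' \<in> B \<rightarrow>\<^sub>E {0..<int p}" and "w - int_comb B m \<in> P" "w - int_comb B m' \<in> P"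
  shows "m = m'"
proof (rule PiE_ext[OF m])
  fix b assume b: "b \<in> B"
  have "int_comb B (\<lambda>b. m b - m' b) = (w - int_comb B m') - (w - int_comb B m)"
    by (simp flip: int_comb_diff)
  also have "\<dots> \<in> P" by (rule P_diff[OF assms(4,3)])
  finally have "int p dvd m b - m' b" using residue_basisD(3)[OF basis_B] b by blast
  then have "m b mod int p = m' b mod int p" by (simp add: mod_eq_dvd_iff)
  moreover have "m b \<in> {0..<int p}" "m' b \<in> {0..<int p}" using PiE_mem[OF m(1) b] PiE_mem[OF m(2) b] .
  ultimately show "m b = m' b" by (simp add: mod_pos_pos_trivial)
qed

lemma coords:
  assumes w: "w \<in> \<O>"
  shows "coords w \<in> B \<rightarrow>\<^sub>E {0..<int p}" "w - int_comb B (coords w) \<in> P"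
proof -
  obtain m where m: "w - int_comb B m \<in> P" using residue_basisD(4)[OF basis_B w] by blast
  define m' where "m' = restrict (\<lambda>b. m b mod int p) B"
  have "m' \<in> B \<rightarrow>\<^sub>E {0..<int p}" using p_gt_1 by (auto simp: m'_def)
  moreover have "w - int_comb B m' \<in> P"
  proof -
    have "int_comb B m - int_comb B m' = int_comb B (\<lambda>b. int p * (m b div int p))"
      unfolding int_comb_diff by (rule int_comb_cong) (simp add: m'_def minus_mod_eq_mult_div)
    also have "\<dots> = int_comb B (\<lambda>b. m b div int p) * of_nat p"
      using int_comb_scale[of "int p" B "\<lambda>b. m b div int p"] by (simp add: mult.commute)
    also have "\<dots> \<in> P" using B_O by (intro P_mult p_P int_comb_mem subspace_O) auto
    finally have "(w - int_comb B m) + (int_comb B m - int_comb B m') \<in> P" using m by (intro P_add)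
    then show ?thesis by simp
  qed
  ultimately have "coords w \<in> B \<rightarrow>\<^sub>E {0..<int p} \<and> w - int_comb B (coords w) \<in> P"
    unfolding coords_def by (intro someI[of "\<lambda>m. m \<in> B \<rightarrow>\<^sub>E {0..<int p} \<and> w - int_comb B m \<in> P" m']) simp
  then show "coords w \<in> B \<rightarrow>\<^sub>E {0..<int p}" "w - int_comb B (coords w) \<in> P" by auto
qed

lemma coords_eqI:
  assumes "w \<in> \<O>" "w' \<in> \<O>" "w - w' \<in> P"
  shows "coords w = coords w'"
proof (rule coords_unique[OF coords(1)[OF assms(1)] coords(1)[OF assms(2)] coords(2)[OF assms(1)]])
  have "(w - w') + (w' - int_comb B (coords w')) \<in> P" using assms(3) coords(2)[OF assms(2)] by (rule P_add)
  then show "w - int_comb B (coords w') \<in> P" by simp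
qed

definition rep :: "complex \<Rightarrow> complex" where "rep w = int_comb B (coords w)"

lemma rep_O: "rep w \<in> \<O>"
  unfolding rep_def using B_O by (intro int_comb_mem subspace_O) auto

lemma rep: "w \<in> \<O> \<Longrightarrow> w - rep w \<in> P"
  using coords(2) by (simp add: rep_def)

lemma rep_eqI: "w \<in> \<O> \<Longrightarrow> w' \<in> \<O> \<Longrightarrow> w - w' \<in> P \<Longrightarrow> rep w = rep w'"
  by (simp add: rep_def coords_eqI)

lemma rep_rep: "w \<in> \<O> \<Longrightarrow> rep (rep w) = rep w"
proof -
  assume w: "w \<in> \<O>"
  have "- (w - rep w) \<in> P" using rep[OF w] by (rule P_neg)
  then show ?thesis by (intro rep_eqI[OF rep_O w]) simp
qed

lemma reps: "rep ` \<O> = int_comb B ` (B \<rightarrow>\<^sub>E {0..<int p})" and inj_int_comb: "inj_on (int_comb B) (B \<rightarrow>\<^sub>E {0..<int p})"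
proof -
  have *: "coords (int_comb B m) = m" if "m \<in> B \<rightarrow>\<^sub>E {0..<int p}" for m
  proof -
    have "int_comb B m \<in> \<O>" using B_O by (intro int_comb_mem subspace_O) auto
    from coords_unique[OF coords(1)[OF this] that coords(2)[OF this]] show ?thesis by (simp add: P_zero)
  qed
  then show "inj_on (int_comb B) (B \<rightarrow>\<^sub>E {0..<int p})" by (metis inj_onI)
  show "rep ` \<O> = int_comb B ` (B \<rightarrow>\<^sub>E {0..<int p})"
  proof
    show "rep ` \<O> \<subseteq> int_comb B ` (B \<rightarrow>\<^sub>E {0..<int p})" using coords(1) by (auto simp: rep_def)
    show "int_comb B ` (B \<rightarrow>\<^sub>E {0..<int p}) \<subseteq> rep ` \<O>"
    proof
      fix x assume "x \<in> int_comb B ` (B \<rightarrow>\<^sub>E {0..<int p})"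
      then obtain m where m: "m \<in> B \<rightarrow>\<^sub>E {0..<int p}" "x = int_comb B m" by blast
      then have "x = rep x" using * by (simp add: rep_def)
      moreover have "x \<in> \<O>" unfolding m(2) using B_O by (intro int_comb_mem subspace_O) auto
      ultimately show "x \<in> rep ` \<O>" by blast
    qed
  qed
qed

lemma finite_reps: "finite (rep ` \<O>)" and card_reps: "card (rep ` \<O>) = p ^ card B"
  unfolding reps using finite_B card_image[OF inj_int_comb] by (auto simp: card_PiE intro!: finite_imageI finite_PiE)

text \<open>A finite domain is a field: two powers of z agree modulo P, and cancelling the smaller
  one shows that a power of z is an inverse. Being a power, it also stays outside P.\<close>

lemma ex_inverse_mod_P:
  assumes z: "z \<in> \<O>" "z \<notin> P"
  obtains z' where "z' \<in> \<O>" "z * z' - 1 \<in> P" "z' \<notin> P"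
proof -
  have zk: "z ^ k \<in> \<O>" for k using z(1) by (induction k) (auto simp: O_one O_mult)
  have "\<not> inj (\<lambda>k. rep (z ^ k))"
  proof
    assume "inj (\<lambda>k. rep (z ^ k))"
    then have "infinite (range (\<lambda>k. rep (z ^ k)))" by (simp add: finite_image_iff)
    moreover have "range (\<lambda>k. rep (z ^ k)) \<subseteq> rep ` \<O>" using zk by auto
    ultimately show False using finite_reps finite_subset by blast
  qed
  then obtain i j where ij: "rep (z ^ i) = rep (z ^ j)" "i < j"
    unfolding inj_def by (metis linorder_neqE_nat)
  have "(z ^ j - rep (z ^ j)) - (z ^ i - rep (z ^ i)) \<in> P" by (intro P_diff rep zk)
  then have "z ^ j - z ^ i \<in> P" using ij(1) by simp
  moreover have "z ^ j - z ^ i = z ^ i * (z ^ (j - i) - 1)"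
    using ij(2) by (simp add: right_diff_distrib flip: power_add)
  moreover have "z ^ i \<notin> P" using P_power[OF z(1)] z(2) by blast
  ultimately have "z ^ (j - i) - 1 \<in> P" using P_prime[OF zk O_diff[OF zk O_one]] by metis
  moreover have "z ^ (j - i) = z * z ^ (j - i - 1)" using ij(2) by (metis Suc_diff_1 power_Suc zero_less_diff)
  ultimately have "z * z ^ (j - i - 1) - 1 \<in> P" by simp
  moreover have "z ^ (j - i - 1) \<notin> P" using P_power[OF z(1)] z(2) by blast
  ultimately show ?thesis using that[of "z ^ (j - i - 1)"] zk by blast
qed

text \<open>Let \<open>k\<close> be the residue field, with \<open>\<Sum>\<^sub>b \<lambda>\<^sub>b(w) b = w\<close> for \<open>w \<in> k\<close>. Substituting \<open>v = u\<^sup>-\<^sup>1 b\<close>,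
  \<open>\<Sum>\<^sub>u u Tr(u\<^sup>-\<^sup>1) = \<Sum>\<^sub>b \<Sum>\<^sub>u u \<lambda>\<^sub>b(u\<^sup>-\<^sup>1 b) = \<Sum>\<^sub>v v\<^sup>-\<^sup>1 \<Sum>\<^sub>b b \<lambda>\<^sub>b(v) = \<Sum>\<^sub>v 1 = -1\<close> over the units of \<open>k\<close>,
  so the trace of \<open>k\<close> does not vanish.\<close>

lemma residue_trace_nonzero:
  obtains r where "r \<in> \<O>" "\<not> int p dvd (\<Sum>b\<in>B. coords (r * b) b)"
proof (rule ccontr)
  note witness = that
  assume "\<not> thesis"
  then have tr0: "int p dvd (\<Sum>b\<in>B. coords (r * b) b)" if "r \<in> \<O>" for r using that witness by blast
  \<comment> \<open>Representatives of the units of the residue field.\<close>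
  define U where "U = rep ` \<O> - P"
  have UO: "u \<in> \<O>" "u \<notin> P" if "u \<in> U" for u using that rep_O by (auto simp: U_def)
  have "\<exists>z'. z \<in> U \<longrightarrow> z' \<in> \<O> \<and> z * z' - 1 \<in> P \<and> z' \<notin> P" for z
    using ex_inverse_mod_P UO by metis
  then obtain iv where iv: "\<And>z. z \<in> U \<Longrightarrow> iv z \<in> \<O>" "\<And>z. z \<in> U \<Longrightarrow> z * iv z - 1 \<in> P" "\<And>z. z \<in> U \<Longrightarrow> iv z \<notin> P"
    by metis
  have repU: "rep w \<in> U" if "w \<in> \<O>" "w \<notin> P" for w
    using that P_add[OF rep[OF that(1)], of "rep w"] by (auto simp: U_def)
  define g where "g b u = rep (iv u * b)" for b u
  have gU: "g b u \<in> U" if "b \<in> B" "u \<in> U" for b u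
    unfolding g_def using that iv B_O B_not_P P_prime by (intro repU O_mult) blast+
  have gP: "u * g b u - b \<in> P" if "b \<in> B" "u \<in> U" for b u
  proof -
    have "u * g b u - b = b * (u * iv u - 1) - u * (iv u * b - g b u)" by (simp add: algebra_simps)
    also have "\<dots> \<in> P"
      unfolding g_def using that by (intro P_diff[OF P_mult P_mult] rep O_mult B_O iv UO)
    finally show ?thesis .
  qed
  \<comment> \<open>The map u to b / u on units is its own inverse, which justifies the substitution
    in the double sum.\<close>
  have gg: "g b (g b u) = u" if b: "b \<in> B" and u: "u \<in> U" for b u
  proof -
    let ?v = "g b u"
    have v: "?v \<in> U" using gU b u .
    have "iv ?v * b - u = u * (?v * iv ?v - 1) - iv ?v * (u * ?v - b)" by (simp add: algebra_simps)
    also have "\<dots> \<in> P" using v by (intro P_diff[OF P_mult P_mult] iv UO(1)[OF u] gP[OF b u])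
    finally have "g b ?v = rep u" unfolding g_def[of b "g b u"]
      using iv v UO(1)[OF u] B_O[OF b] by (intro rep_eqI O_mult)
    also have "\<dots> = u" using u rep_rep by (auto simp: U_def)
    finally show ?thesis .
  qed
  have bij: "bij_betw (g b) U U" if "b \<in> B" for b
    by (rule bij_betw_byWitness[of _ "g b"]) (use gg gU that in auto)
  define S where "S = (\<Sum>u\<in>U. u * of_int (\<Sum>b\<in>B. coords (iv u * b) b))"
  have "S \<in> P"
    unfolding S_def by (intro P_sum P_mult UO(1) of_int_P_iff[THEN iffD2] tr0 iv(1))
  have "S = (\<Sum>b\<in>B. \<Sum>u\<in>U. u * of_int (coords (iv u * b) b))"
    unfolding S_def of_int_sum sum_distrib_left by (rule sum.swap)
  also have "\<dots> = (\<Sum>b\<in>B. \<Sum>u\<in>U. u * of_int (coords (g b u) b))"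
  proof (intro sum.cong refl)
    fix b u assume "b \<in> B" "u \<in> U"
    then have "coords (iv u * b) = coords (g b u)"
      unfolding g_def using iv B_O by (intro coords_eqI rep rep_O O_mult)
    then show "u * of_int (coords (iv u * b) b) = u * of_int (coords (g b u) b)" by simp
  qed
  also have "\<dots> = (\<Sum>b\<in>B. \<Sum>u\<in>U. g b u * of_int (coords u b))"
  proof (rule sum.cong[OF refl])
    fix b assume b: "b \<in> B"
    have "(\<Sum>u\<in>U. u * of_int (coords (g b u) b)) = (\<Sum>u\<in>U. g b (g b u) * of_int (coords (g b u) b))"
      using gg[OF b] by simp
    also have "\<dots> = (\<Sum>u\<in>U. g b u * of_int (coords u b))"
      by (rule sum.reindex_bij_betw[OF bij[OF b]])
    finally show "(\<Sum>u\<in>U. u * of_int (coords (g b u) b)) = (\<Sum>u\<in>U. g b u * of_int (coords u b))" .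
  qed
  also have "\<dots> = (\<Sum>u\<in>U. \<Sum>b\<in>B. g b u * of_int (coords u b))" by (rule sum.swap)
  finally have S: "S = (\<Sum>u\<in>U. \<Sum>b\<in>B. g b u * of_int (coords u b))" .
  have "(\<Sum>b\<in>B. g b u * of_int (coords u b)) - 1 \<in> P" if u: "u \<in> U" for u
  proof -
    have "(\<Sum>b\<in>B. g b u * of_int (coords u b)) - iv u * rep u = (\<Sum>b\<in>B. of_int (coords u b) * (g b u - iv u * b))"
      by (simp add: rep_def int_comb_def sum_distrib_left sum_subtractf algebra_simps)
    also have "\<dots> \<in> P"
    proof (intro P_sum P_mult O_of_int)
      fix b assume b: "b \<in> B"
      have "- (iv u * b - rep (iv u * b)) \<in> P" using iv(1)[OF u] B_O[OF b] by (intro P_neg rep O_mult)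
      then show "g b u - iv u * b \<in> P" by (simp add: g_def)
    qed
    finally have "(\<Sum>b\<in>B. g b u * of_int (coords u b)) - iv u * u \<in> P"
      using u rep_rep by (auto simp: U_def)
    from P_add[OF this iv(2)[OF u]] show ?thesis by (simp add: mult.commute)
  qed
  then have "(\<Sum>u\<in>U. (\<Sum>b\<in>B. g b u * of_int (coords u b)) - 1) \<in> P" by (rule P_sum)
  then have "S - of_nat (card U) \<in> P" by (simp add: S sum_subtractf)
  from P_diff[OF \<open>S \<in> P\<close> this] have "of_int (int (card U)) \<in> P" by simp
  then have dvd: "p dvd card U" unfolding of_int_P_iff by simp
  \<comment> \<open>Exactly one representative is not a unit, so there are p^|B| - 1 units, a number
    not divisible by p.\<close>
  have "rep ` \<O> \<inter> P = {rep 0}"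
  proof
    show "rep ` \<O> \<inter> P \<subseteq> {rep 0}"
    proof
      fix x assume x: "x \<in> rep ` \<O> \<inter> P"
      then have "rep x = rep 0" by (intro rep_eqI) (auto simp: rep_O O_zero)
      then show "x \<in> {rep 0}" using x rep_rep by auto
    qed
    have "0 - (0 - rep 0) \<in> P" by (intro P_diff P_zero rep O_zero)
    then show "{rep 0} \<subseteq> rep ` \<O> \<inter> P" using O_zero by auto
  qed
  then have "card (rep ` \<O>) = card U + 1"
    unfolding U_def using finite_reps by (metis card_Diff_subset_Int Diff_Int2 card_Int_Diff card_1_singleton_iff add.commute One_nat_def finite.emptyI finite_insert)
  then have "p ^ card B = card U + 1" by (simp add: card_reps)
  moreover have "card B \<noteq> 0"
  proof
    assume "card B = 0"
    then have "B = {}" using finite_B by simp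
    then have "rep 1 = 0" by (simp add: rep_def int_comb_def)
    then show False using rep[OF O_one] one_not_P by simp
  qed
  then have "p dvd p ^ card B" by (simp add: dvd_power)
  ultimately have "p dvd 1" using dvd by (metis dvd_add_right_iff)
  then show False using p_gt_1 by simp
qed

text \<open>The localisation of \<open>\<O>\<close> at \<open>P\<close> is a valuation ring: write a primitive integer polynomial
  vanishing at \<open>u = a / b\<close> as \<open>(X - u) \<Sum>\<^sub>i b\<^sub>i X\<^sup>i\<close>. All \<open>b\<^sub>i\<close> and \<open>u b\<^sub>i\<close> are integral, and not all of
  them lie in \<open>P\<close> since its coefficients are \<open>b\<^bsub>i-1\<^esub> - u b\<^sub>i\<close>.\<close>

lemma local_divisibility:
  assumes ab: "a \<in> \<O>" "b \<in> \<O>"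
  obtains s z where "s \<in> \<O>" "s \<notin> P" "z \<in> \<O>" "s * a = b * z" | s z where "s \<in> \<O>" "s \<notin> P" "z \<in> \<O>" "s * b = a * z"
proof (cases "b = 0")
  case True
  then show ?thesis using that(2)[of 1 0] O_one one_not_P O_zero by simp
next
  case b0: False
  define u where "u = a / b"
  have uK: "u \<in> K" unfolding u_def using ab by (intro K_divide O_K)
  have ub: "u * b = a" using b0 by (simp add: u_def)
  obtain n and f :: "nat \<Rightarrow> int" where f: "(\<Sum>i\<le>n. of_int (f i) * u ^ i) = 0" "Gcd (f ` {..n}) = 1" "n > 0"
    using primitive_int_relation[OF algebraic_K[OF uK]] by metis
  let ?q = "quotient_coeff u f n"
  have qK: "?q i \<in> K" for i
    unfolding quotient_coeff_def using uK by (intro K_sum K_mult K_of_int K_power)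
  have qO: "?q i \<in> \<O>" "u * ?q i \<in> \<O>" if "i < n" for i
    using algebraic_int_quotient_coeffs[OF f(1) that] qK uK by (simp_all add: O_iff K_mult)
  have "\<exists>i<n. ?q i \<notin> P \<or> u * ?q i \<notin> P"
  proof (rule ccontr)
    assume "\<not> ?thesis"
    then have qP: "?q i \<in> P" "u * ?q i \<in> P" if "i < n" for i using that by auto
    have "of_int (f i) \<in> P" if "i \<le> n" for i
    proof (cases i)
      case 0
      have "of_int (f i) = - (u * ?q 0)" using quotient_coeff_0[of f u n] f(1) 0 by (simp add: eq_neg_iff_add_eq_0)
      then show ?thesis using qP(2)[of 0] f(3) P_neg by simp
    next
      case (Suc j)
      then have j: "j < n" using that by simp
      have "of_int (f i) = ?q j - u * ?q (Suc j)" using quotient_coeff_step[OF j, of u f] Suc by simp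
      moreover have "u * ?q (Suc j) \<in> P"
      proof (cases "Suc j < n")
        case False
        then have "{Suc j<..n} = {}" by auto
        then show ?thesis by (simp add: quotient_coeff_def P_zero)
      qed (rule qP)
      ultimately show ?thesis using qP(1)[OF j] by (simp add: P_diff)
    qed
    then have "of_int (Gcd (f ` {..n})) \<in> P" by (intro Gcd_mem_subspace subspace_P) auto
    then show False using f(2) one_not_P by simp
  qed
  then obtain i where i: "i < n" "?q i \<notin> P \<or> u * ?q i \<notin> P" by blast
  \<comment> \<open>Whichever of b_i and u b_i lies outside P serves as s, and it decides the
    direction of divisibility.\<close>
  show ?thesis
  proof (cases "?q i \<in> P")
    case False
    have "?q i * a = b * (u * ?q i)" unfolding ub[symmetric] by simp
    then show ?thesis using that(1) qO[OF i(1)] False by blast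
  next
    case True
    have "u * ?q i * b = a * ?q i" unfolding ub[symmetric] by simp
    then show ?thesis using that(2) qO[OF i(1)] True i(2) by blast
  qed
qed

end

section \<open>Tame ramification\<close>

text \<open>This colon ideal has two uses: with X = P it provides a cofactor of P in p \<O>, and
  with X = {y} it collects the denominators of y / p.\<close>

lemma (in num_field) ideal_colon: "ideal {z \<in> \<O>. \<forall>x\<in>X. z * x \<in> multiples k} R"
  unfolding ideal_iff
proof (intro conjI ballI)
  show "int_mod.subspace {z \<in> \<O>. \<forall>x\<in>X. z * x \<in> multiples k}"
  proof (rule int_mod.subspaceI)
    show "of_int m * z \<in> {z \<in> \<O>. \<forall>x\<in>X. z * x \<in> multiples k}"
      if "z \<in> {z \<in> \<O>. \<forall>x\<in>X. z * x \<in> multiples k}" for m z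
      using that multiples_mult[OF O_of_int[of m]] by (simp add: O_mult O_of_int mult.assoc)
  qed (auto simp: O_zero O_add multiples_zero distrib_right multiples_add)
  fix z r assume "z \<in> {z \<in> \<O>. \<forall>x\<in>X. z * x \<in> multiples k}" "r \<in> \<O>"
  then show "r * z \<in> {z \<in> \<O>. \<forall>x\<in>X. z * x \<in> multiples k}"
    using multiples_mult[of r] by (simp add: O_mult mult.assoc)
qed auto

context prime_over
begin

text \<open>In a valuation ring one element of a finite set divides all the others. By induction the
  new element is compared with the generator found so far, and s collects the factors outside
  P.\<close>

lemma ex_local_generator:
  assumes "finite G" "G \<noteq> {}" "G \<subseteq> \<O>"
  shows "\<exists>\<pi>\<in>G. \<exists>s\<in>\<O>. s \<notin> P \<and> (\<forall>g\<in>G. \<exists>z\<in>\<O>. s * g = \<pi> * z)"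
  using assms
proof (induction G rule: finite_ne_induct)
  case (singleton x)
  then show ?case using O_one one_not_P by (intro bexI[of _ x] bexI[of _ 1]) (auto intro!: bexI[of _ 1])
next
  case (insert h G)
  then obtain \<pi> s where \<pi>: "\<pi> \<in> G" "s \<in> \<O>" "s \<notin> P" "\<forall>g\<in>G. \<exists>z\<in>\<O>. s * g = \<pi> * z" by blast
  have h\<pi>: "h \<in> \<O>" "\<pi> \<in> \<O>" using insert \<pi> by auto
  show ?case
  proof (rule local_divisibility[OF h\<pi>])
    fix t z assume t: "t \<in> \<O>" "t \<notin> P" "z \<in> \<O>" "t * h = \<pi> * z"
    have "\<exists>z\<in>\<O>. t * s * g = \<pi> * z" if g: "g \<in> insert h G" for g
    proof (cases "g = h")
      case True
      have "t * s * h = \<pi> * (s * z)" unfolding mult.commute[of t s] mult.assoc t(4) by (rule mult.left_commute)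
      then show ?thesis using True O_mult[OF \<pi>(2) t(3)] by (intro bexI[of _ "s * z"]) simp_all
    next
      case False
      then have "g \<in> G" using g by simp
      then obtain w where w: "w \<in> \<O>" "s * g = \<pi> * w" using bspec[OF \<pi>(4)] by metis
      have "t * s * g = \<pi> * (t * w)" unfolding mult.assoc w(2) by (rule mult.left_commute)
      then show ?thesis using O_mult[OF t(1) w(1)] by (intro bexI[of _ "t * w"])
    qed
    moreover have "t * s \<notin> P" using P_prime[OF t(1) \<pi>(2)] t(2) \<pi>(3) by blast
    ultimately show ?thesis
      using \<pi>(1) O_mult[OF t(1) \<pi>(2)] by (intro bexI[of _ \<pi>] bexI[of _ "t * s"]) auto
  next
    fix t z assume t: "t \<in> \<O>" "t \<notin> P" "z \<in> \<O>" "t * \<pi> = h * z"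
    have "\<exists>z\<in>\<O>. t * s * g = h * z" if g: "g \<in> insert h G" for g
    proof (cases "g = h")
      case True
      have "t * s * h = h * (t * s)" by (simp add: mult.commute)
      then show ?thesis using True O_mult[OF t(1) \<pi>(2)] by (intro bexI[of _ "t * s"]) simp_all
    next
      case False
      then have "g \<in> G" using g by simp
      then obtain w where w: "w \<in> \<O>" "s * g = \<pi> * w" using bspec[OF \<pi>(4)] by metis
      have "t * s * g = (t * \<pi>) * w" by (simp add: mult.assoc w(2))
      also have "\<dots> = h * (z * w)" by (simp add: t(4) mult.assoc)
      finally show ?thesis using O_mult[OF t(3) w(1)] by (intro bexI[of _ "z * w"])
    qed
    moreover have "t * s \<notin> P" using P_prime[OF t(1) \<pi>(2)] t(2) \<pi>(3) by blast
    ultimately show ?thesis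
      using O_mult[OF t(1) \<pi>(2)] by (intro bexI[of _ h] bexI[of _ "t * s"]) auto
  qed
qed

lemma of_nat_p_O: "of_nat p \<in> \<O>"
  using O_of_int[of "int p"] by simp

lemma p_nonzero: "(of_nat p :: complex) \<noteq> 0"
  using p_gt_1 by simp

text \<open>Locally P is generated by one \<pi>: some s outside P maps P into \<pi> \<O>. Then s p /
  \<pi> lies in the colon ideal Q, so s p lies in P Q, and inverting s modulo P brings p itself into
  P Q.\<close>

lemma ex_complement:
  obtains Q where "ideal Q R" "P \<bullet> Q = multiples (int p)"
proof -
  define Q where "Q = {z \<in> \<O>. \<forall>x\<in>P. z * x \<in> multiples (int p)}"
  have Q: "ideal Q R" unfolding Q_def by (rule ideal_colon)
  have sub: "P \<bullet> Q \<subseteq> multiples (int p)"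
    by (rule ideal_mult_subset[OF subspace_multiples]) (auto simp: Q_def mult.commute)
  \<comment> \<open>Together with p, lifts of a basis of P / p \<O> generate P, so a finite set
    suffices for the local generator.\<close>
  obtain C where C: "residue_basis p P (multiples (int p)) C"
    using ex_residue_basis[OF prime_p subspace_multiples subset_refl subspace_P idealD(1)[OF ideal_P]] by blast
  have fin: "finite (insert (of_nat p) C)" using residue_basisD(1)[OF C] by simp
  have GP: "insert (of_nat p) C \<subseteq> P" using residue_basisD(2)[OF C] p_P by blast
  have GO: "insert (of_nat p) C \<subseteq> \<O>" using GP P_O by blast
  obtain \<pi> s where \<pi>: "\<pi> \<in> insert (of_nat p) C" "s \<in> \<O>" "s \<notin> P"
    "\<And>g. g \<in> insert (of_nat p) C \<Longrightarrow> \<exists>z\<in>\<O>. s * g = \<pi> * z"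
    using ex_local_generator[OF fin insert_not_empty GO] by blast
  have \<pi>P: "\<pi> \<in> P" using \<pi>(1) GP by blast
  obtain t where t: "t \<in> \<O>" "s * of_nat p = \<pi> * t" using \<pi>(4)[of "of_nat p"] by blast
  have s0: "s \<noteq> 0" using \<pi>(3) P_zero by blast
  have \<pi>0: "\<pi> \<noteq> 0" using t(2) s0 p_nonzero by auto
  have sP: "\<exists>z\<in>\<O>. s * x = \<pi> * z" if x: "x \<in> P" for x
  proof -
    obtain m where "x - int_comb C m \<in> multiples (int p)" using residue_basisD(4)[OF C x] by blast
    then obtain w where w: "w \<in> \<O>" "x - int_comb C m = of_int (int p) * w" by (rule multiplesE)
    have "\<forall>c. \<exists>z. c \<in> C \<longrightarrow> z \<in> \<O> \<and> s * c = \<pi> * z" using \<pi>(4) by blast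
    then obtain z where z: "\<And>c. c \<in> C \<Longrightarrow> z c \<in> \<O> \<and> s * c = \<pi> * z c" by metis
    have "x = int_comb C m + of_nat p * w" using w(2) by (simp add: algebra_simps)
    then have "s * x = s * int_comb C m + (s * of_nat p) * w" by (simp add: distrib_left mult.assoc)
    also have "s * int_comb C m = (\<Sum>c\<in>C. of_int (m c) * (s * c))"
      by (simp add: int_comb_def sum_distrib_left mult.left_commute)
    also have "\<dots> = \<pi> * (\<Sum>c\<in>C. of_int (m c) * z c)"
      using z by (simp add: sum_distrib_left mult.left_commute)
    also have "(s * of_nat p) * w = \<pi> * (t * w)" by (simp add: t(2) mult.assoc)
    finally have "s * x = \<pi> * ((\<Sum>c\<in>C. of_int (m c) * z c) + t * w)" by (simp add: distrib_left)
    moreover have "(\<Sum>c\<in>C. of_int (m c) * z c) + t * w \<in> \<O>"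
      using z t(1) w(1) by (intro O_add O_sum O_mult O_of_int) auto
    ultimately show ?thesis by blast
  qed
  have tQ: "t \<in> Q"
  proof -
    have "t * x \<in> multiples (int p)" if x: "x \<in> P" for x
    proof -
      obtain z where z: "z \<in> \<O>" "s * x = \<pi> * z" using sP[OF x] by blast
      have "\<pi> * (t * x) = (s * of_nat p) * x" by (simp add: t(2) mult.assoc)
      also have "\<dots> = of_nat p * (s * x)" by (simp add: mult.assoc mult.left_commute)
      also have "\<dots> = \<pi> * (of_int (int p) * z)" by (simp add: z(2) mult.left_commute)
      finally have "t * x = of_int (int p) * z" using \<pi>0 by simp
      then show ?thesis using multiplesI[OF z(1)] by metis
    qed
    then show ?thesis using t(1) by (simp add: Q_def)
  qed
  have PQ: "ideal (P \<bullet> Q) R" by (rule ideal_ideal_mult[OF ideal_P Q])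
  have sp: "s * of_nat p \<in> P \<bullet> Q" unfolding t(2) by (rule ideal_multI[OF \<pi>P tQ])
  obtain s' where s': "s' \<in> \<O>" "s * s' - 1 \<in> P" using ex_inverse_mod_P[OF \<pi>(2,3)] by blast
  \<comment> \<open>With s s' - 1 in P and p in Q, their product covers the difference between p and
    s' s p.\<close>
  have "of_nat p \<in> Q"
    using P_O of_nat_p_O multiplesI[of _ "int p"] by (auto simp: Q_def)
  then have "(s * s' - 1) * of_nat p \<in> P \<bullet> Q" by (rule ideal_multI[OF s'(2)])
  moreover have "s' * (s * of_nat p) \<in> P \<bullet> Q" by (rule idealD(3)[OF PQ sp s'(1)])
  ultimately have "s' * (s * of_nat p) - (s * s' - 1) * of_nat p \<in> P \<bullet> Q"
    using idealD(2)[OF PQ] by (intro int_mod.subspace_diff)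
  then have "of_nat p \<in> P \<bullet> Q" by (simp add: algebra_simps)
  then have "z * of_nat p \<in> P \<bullet> Q" if "z \<in> \<O>" for z using that by (rule idealD(3)[OF PQ])
  then have "multiples (int p) \<subseteq> P \<bullet> Q" by (simp add: multiples_def image_subset_iff mult.commute)
  then show ?thesis using that Q sub by blast
qed

section \<open>Powers of P and their successive quotients\<close>

abbreviation Pow :: "nat \<Rightarrow> complex set" where "Pow i \<equiv> P [^]\<^bsub>M\<^esub> i"

lemma ideal_Pow: "ideal (Pow i) R"
  using monoid.nat_pow_closed[OF comm_monoid.axioms(1)[OF comm_monoid_ideals], of P i] ideal_P by simp

lemma Pow_0: "Pow 0 = \<O>" and Pow_Suc: "Pow (Suc i) = Pow i \<bullet> P"
  using monoid.nat_pow_0[OF comm_monoid.axioms(1)[OF comm_monoid_ideals], of P]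
    monoid.nat_pow_Suc[OF comm_monoid.axioms(1)[OF comm_monoid_ideals], of P i] by simp_all

lemma Pow_add: "Pow (i + j) = Pow i \<bullet> Pow j"
  using monoid.nat_pow_mult[OF comm_monoid.axioms(1)[OF comm_monoid_ideals], of P i j] ideal_P by simp

lemmas Pow_O = idealD(1)[OF ideal_Pow]
lemmas subspace_Pow = idealD(2)[OF ideal_Pow]

lemma ideal_mult_subset_left:
  assumes I: "ideal I R" and J: "ideal J R"
  shows "I \<bullet> J \<subseteq> I"
proof (rule ideal_mult_subset[OF idealD(2)[OF I]])
  fix x y assume "x \<in> I" "y \<in> J"
  then have "y * x \<in> I" using idealD(1)[OF J] by (intro idealD(3)[OF I]) auto
  then show "x * y \<in> I" by (simp add: mult.commute)
qed

lemma Pow_Suc_subset: "Pow (Suc i) \<subseteq> Pow i"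
  unfolding Pow_Suc by (rule ideal_mult_subset_left[OF ideal_Pow ideal_P])

lemma Pow_antimono: "i \<le> j \<Longrightarrow> Pow j \<subseteq> Pow i"
  by (rule lift_Suc_antimono_le[of Pow]) (rule Pow_Suc_subset)

text \<open>z is invertible modulo P, and the error in inverting it multiplies \<pi> into the next
  power.\<close>

lemma Pow_cancel:
  assumes "\<pi> \<in> Pow i" "z \<in> \<O>" "z \<notin> P" "z * \<pi> \<in> Pow (Suc i)"
  shows "\<pi> \<in> Pow (Suc i)"
proof -
  obtain z' where z': "z' \<in> \<O>" "z * z' - 1 \<in> P" using ex_inverse_mod_P[OF assms(2,3)] by blast
  have "\<pi> * (z * z' - 1) \<in> Pow (Suc i)" unfolding Pow_Suc using assms(1) z'(2) by (rule ideal_multI)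
  moreover have "z' * (z * \<pi>) \<in> Pow (Suc i)" by (rule idealD(3)[OF ideal_Pow assms(4) z'(1)])
  ultimately have "z' * (z * \<pi>) - \<pi> * (z * z' - 1) \<in> Pow (Suc i)"
    using subspace_Pow by (intro int_mod.subspace_diff)
  then show ?thesis by (simp add: algebra_simps)
qed

text \<open>P^i / P^(i+1) is a line over the residue field, spanned by any \<pi> outside P^(i+1). If
  local divisibility gives s \<pi> = w z, then z lies outside P, since otherwise \<pi> would lie in
  the next power.\<close>

lemma Pow_local_principal:
  assumes \<pi>: "\<pi> \<in> Pow i" "\<pi> \<notin> Pow (Suc i)" and w: "w \<in> Pow i"
  obtains y where "y \<in> \<O>" "w - \<pi> * y \<in> Pow (Suc i)"
proof -
  have red: "w - \<pi> * y \<in> Pow (Suc i)" if "\<pi> * y = w * z" "z - 1 \<in> P" for y z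
  proof -
    have "w * (z - 1) \<in> Pow (Suc i)" unfolding Pow_Suc using w that(2) by (rule ideal_multI)
    then have "- (w * (z - 1)) \<in> Pow (Suc i)" using subspace_Pow by (intro int_mod.subspace_neg)
    then show ?thesis by (simp add: that(1) algebra_simps)
  qed
  have wO: "w \<in> \<O>" "\<pi> \<in> \<O>" using w \<pi> Pow_O by auto
  show ?thesis
  proof (rule local_divisibility[OF wO])
    fix s z assume s: "s \<in> \<O>" "s \<notin> P" "z \<in> \<O>" "s * w = \<pi> * z"
    obtain s' where s': "s' \<in> \<O>" "s * s' - 1 \<in> P" using ex_inverse_mod_P[OF s(1,2)] by blast
    have "\<pi> * (z * s') = (\<pi> * z) * s'" by (simp only: mult.assoc)
    also have "\<dots> = w * (s * s')" unfolding s(4)[symmetric] by (simp only: ac_simps)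
    finally have eq: "\<pi> * (z * s') = w * (s * s')" .
    then show ?thesis using that[OF O_mult[OF s(3) s'(1)] red[OF eq s'(2)]] by simp
  next
    fix s z assume s: "s \<in> \<O>" "s \<notin> P" "z \<in> \<O>" "s * \<pi> = w * z"
    have "z \<notin> P"
    proof
      assume "z \<in> P"
      then have "s * \<pi> \<in> Pow (Suc i)" unfolding s(4) Pow_Suc using w by (intro ideal_multI)
      then show False using Pow_cancel[OF \<pi>(1) s(1,2)] \<pi>(2) by blast
    qed
    then obtain z' where z': "z' \<in> \<O>" "z * z' - 1 \<in> P" using ex_inverse_mod_P[OF s(3)] by blast
    have "\<pi> * (s * z') = (s * \<pi>) * z'" by (simp only: ac_simps)
    also have "\<dots> = w * (z * z')" by (simp only: s(4) mult.assoc)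
    finally have eq: "\<pi> * (s * z') = w * (z * z')" .
    then show ?thesis using that[OF O_mult[OF s(1) z'(1)] red[OF eq z'(2)]] by simp
  qed
qed

section \<open>The filtration by powers of P up to an exponent e with P^e dividing p\<close>

context
  fixes e :: nat and a :: "complex set"
  assumes a: "ideal a R" and Pow_a: "Pow e \<bullet> a = multiples (int p)"
begin

lemma multiples_Pow: "i \<le> e \<Longrightarrow> multiples (int p) \<subseteq> Pow i"
  using Pow_antimono[of i e] ideal_mult_subset_left[OF ideal_Pow[of e] a] unfolding Pow_a by blast

text \<open>If P^i = P^(i+1), multiplying by the cofactor of P^i gives p \<O> = P (p \<O>), and
  division by p puts 1 into P.\<close>

lemma ex_uniformizer:
  assumes i: "i < e"
  obtains \<pi> where "\<pi> \<in> Pow i" "\<pi> \<notin> Pow (Suc i)"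
proof -
  have "\<not> Pow i \<subseteq> Pow (Suc i)"
  proof
    assume "Pow i \<subseteq> Pow (Suc i)"
    then have eq: "Pow (Suc i) = Pow i" using Pow_Suc_subset by blast
    define N where "N = Pow (e - i) \<bullet> a"
    have N: "ideal N R" unfolding N_def by (rule ideal_ideal_mult[OF ideal_Pow a])
    have iN: "Pow i \<bullet> N = multiples (int p)"
      unfolding N_def ideal_mult_assoc[OF ideal_Pow ideal_Pow a, symmetric] Pow_add[symmetric]
      using i Pow_a by simp
    have "multiples (int p) = P \<bullet> Pow i \<bullet> N"
      using iN eq ideal_mult_commute[OF ideal_Pow[of i] ideal_P] unfolding Pow_Suc by simp
    also have "\<dots> = P \<bullet> multiples (int p)"
      using ideal_mult_assoc[OF ideal_P ideal_Pow N] iN by simp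
    also have "\<dots> \<subseteq> (\<lambda>x. of_nat p * x) ` P"
    proof (rule ideal_mult_subset)
      show "int_mod.subspace ((\<lambda>x. of_nat p * x) ` P)"
        by (rule int_mod.subspaceI)
          (auto simp: P_zero mult.left_commute simp flip: distrib_left intro!: imageI P_add P_mult O_of_int image_eqI[of 0 _ 0])
      fix x y assume x: "x \<in> P" and "y \<in> multiples (int p)"
      then obtain z where z: "z \<in> \<O>" "y = of_int (int p) * z" by (elim multiplesE)
      then have "x * y = of_nat p * (z * x)" by simp
      then show "x * y \<in> (\<lambda>x. of_nat p * x) ` P" using P_mult[OF z(1) x] by blast
    qed
    finally have "of_int (int p) * 1 \<in> (\<lambda>x. of_nat p * x) ` P" using multiplesI[OF O_one, of "int p"] by blast
    then show False using p_nonzero one_not_P by auto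
  qed
  then show ?thesis using that by blast
qed

text \<open>Each of the e steps of the filtration adds at least one dimension, within the
  \<open>deg\<close> dimensions of \<O> / p \<O>. The bound makes the \<open>GREATEST\<close> in the
  ramification index a true maximum.\<close>

lemma exponent_le_deg: "e \<le> deg"
proof -
  have "\<exists>C. residue_basis p \<O> (Pow i) C \<and> i \<le> card C" if "i \<le> e" for i
    using that
  proof (induction i)
    case 0
    have "residue_basis p \<O> (Pow 0) {}"
      by (simp add: residue_basis_def residue_independent_def Pow_0 int_comb_def)
    then show ?case by blast
  next
    case (Suc i)
    then obtain C where C: "residue_basis p \<O> (Pow i) C" "i \<le> card C" by auto
    obtain C' where C': "residue_basis p (Pow i) (Pow (Suc i)) C'"
      using ex_residue_basis[OF prime_p subspace_Pow multiples_Pow subspace_Pow Pow_O] Suc(2) by blast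
    have "C' \<noteq> {}"
    proof
      assume "C' = {}"
      then have "Pow i \<subseteq> Pow (Suc i)" using residue_basisD(4)[OF C'] by (auto simp: int_comb_def)
      then show False using ex_uniformizer[of i] Suc(2) by auto
    qed
    then have "card C' \<ge> 1" using residue_basisD(1)[OF C'] by (simp add: Suc_le_eq card_gt_0_iff)
    have pW: "of_nat p * w \<in> Pow (Suc i)" if "w \<in> \<O>" for w
      using multiples_Pow[OF Suc(2)] multiplesI[OF that, of "int p"] by auto
    have comp: "C \<inter> C' = {}" "residue_basis p \<O> (Pow (Suc i)) (C \<union> C')"
      using residue_basis_compose[OF subspace_Pow subspace_Pow Pow_Suc_subset pW subspace_O Pow_O p_gt_1 C(1) C'] by blast+
    have "card (C \<union> C') = card C + card C'"
      by (rule card_Un_disjoint[OF residue_basisD(1)[OF C(1)] residue_basisD(1)[OF C'] comp(1)])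
    then show ?case using comp(2) C(2) \<open>card C' \<ge> 1\<close> by (intro exI[of _ "C \<union> C'"]) simp
  qed
  then obtain C where C: "residue_basis p \<O> (Pow e) C" "e \<le> card C" by blast
  have "card C \<le> deg"
    by (rule card_residue_independent_le_deg[OF p_gt_1 _ _ multiples_Pow[OF order_refl]])
      (use C(1) in \<open>auto simp: residue_basis_def\<close>)
  then show ?thesis using C(2) by simp
qed

text \<open>Multiplication by \<pi> identifies the residue field with P^i / P^(i+1) compatibly with
  x, and modulo P the elements x and r agree. The sum is the trace of r on the residue field in the
  basis B.\<close>

lemma residue_trace_graded_piece:
  assumes i: "i < e" and x: "x \<in> \<O>" "r \<in> \<O>" "x - r \<in> P"
  shows "residue_trace p (Pow i) (Pow (Suc i)) x (\<Sum>b\<in>B. coords (r * b) b)"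
proof -
  obtain \<pi> where \<pi>: "\<pi> \<in> Pow i" "\<pi> \<notin> Pow (Suc i)" using ex_uniformizer[OF i] .
  have \<pi>0: "\<pi> \<noteq> 0" using \<pi>(2) int_mod.subspace_0[OF subspace_Pow] by metis
  have P\<pi>: "z * \<pi> \<in> Pow (Suc i)" if "z \<in> P" for z
    unfolding Pow_Suc using ideal_multI[OF \<pi>(1) that] by (simp add: mult.commute)
  let ?C = "(\<lambda>b. b * \<pi>) ` B"
  have inj: "inj_on (\<lambda>b. b * \<pi>) B" using \<pi>0 by (auto intro: inj_onI)
  have comb: "int_comb ?C m = int_comb B (\<lambda>b. m (b * \<pi>)) * \<pi>" for m
    by (simp add: int_comb_def sum.reindex[OF inj] sum_distrib_right mult.assoc)
  have combO: "int_comb B m \<in> \<O>" for m using B_O by (intro int_comb_mem subspace_O) auto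
  define n where "n c c' = coords (r * (c / \<pi>)) (c' / \<pi>)" for c c'
  have "residue_basis p (Pow i) (Pow (Suc i)) ?C"
    unfolding residue_basis_def residue_independent_def
  proof (intro conjI allI impI ballI)
    show "finite ?C" using finite_B by simp
    show "?C \<subseteq> Pow i" using idealD(3)[OF ideal_Pow \<pi>(1)] B_O by auto
    fix m c assume m: "int_comb ?C m \<in> Pow (Suc i)" and "c \<in> ?C"
    then obtain b where b: "b \<in> B" "c = b * \<pi>" by blast
    have "int_comb B (\<lambda>b. m (b * \<pi>)) \<in> P"
    proof (rule ccontr)
      assume "int_comb B (\<lambda>b. m (b * \<pi>)) \<notin> P"
      from Pow_cancel[OF \<pi>(1) combO this] m \<pi>(2) show False unfolding comb by blast
    qed
    from residue_basisD(3)[OF basis_B this b(1)] show "int p dvd m c" by (simp add: b(2))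
  next
    fix w assume "w \<in> Pow i"
    then obtain y where y: "y \<in> \<O>" "w - \<pi> * y \<in> Pow (Suc i)" using Pow_local_principal[OF \<pi>] by blast
    obtain m where m: "y - int_comb B m \<in> P" using residue_basisD(4)[OF basis_B y(1)] by blast
    have "w - int_comb ?C (\<lambda>c. m (c / \<pi>)) = (w - \<pi> * y) + (y - int_comb B m) * \<pi>"
      unfolding comb using \<pi>0 by (simp add: algebra_simps)
    also have "\<dots> \<in> Pow (Suc i)" using subspace_Pow y(2) P\<pi>[OF m] by (rule int_mod.subspace_add)
    finally show "\<exists>m. w - int_comb ?C m \<in> Pow (Suc i)" by blast
  qed
  moreover have "x * c - int_comb ?C (n c) \<in> Pow (Suc i)" if c: "c \<in> ?C" for c
  proof -
    obtain b where b: "b \<in> B" "c = b * \<pi>" using c by blast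
    have "int_comb ?C (n c) = int_comb B (coords (r * b)) * \<pi>"
      unfolding comb using \<pi>0 by (simp add: n_def b(2))
    then have "x * c - int_comb ?C (n c) = (b * (x - r) + (r * b - int_comb B (coords (r * b)))) * \<pi>"
      by (simp add: b(2) algebra_simps)
    also have "\<dots> \<in> Pow (Suc i)"
      using B_O[OF b(1)] x by (intro P\<pi> P_add P_mult coords(2) O_mult)
    finally show ?thesis .
  qed
  moreover have "(\<Sum>b\<in>B. coords (r * b) b) = (\<Sum>c\<in>?C. n c c)"
    using \<pi>0 by (simp add: sum.reindex[OF inj] n_def)
  ultimately show ?thesis
    unfolding residue_trace_def by (intro exI[of _ ?C] exI[of _ n] conjI ballI) assumption+
qed

text \<open>Each of the e quotients P^i / P^(i+1) contributes the trace of r. The last quotient,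
  from P^e to p \<O>, contributes 0 because x lies in a.\<close>

lemma residue_trace_multiplicity:
  assumes x: "x \<in> a" "r \<in> \<O>" "x - r \<in> P"
  shows "residue_trace p \<O> (multiples (int p)) x (int e * (\<Sum>b\<in>B. coords (r * b) b))"
proof -
  let ?t = "\<Sum>b\<in>B. coords (r * b) b"
  have xO: "x \<in> \<O>" using x(1) idealD(1)[OF a] by blast
  have step: "residue_trace p \<O> (Pow i) x (int i * ?t)" if "i \<le> e" for i
    using that
  proof (induction i)
    case 0
    have "residue_basis p \<O> (Pow 0) {}"
      by (simp add: residue_basis_def residue_independent_def Pow_0 int_comb_def)
    then show ?case unfolding residue_trace_def by (intro exI[of _ "{}"]) simp
  next
    case (Suc i)
    have pW: "of_nat p * w \<in> Pow (Suc i)" if "w \<in> \<O>" for w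
      using multiples_Pow[OF Suc(2)] multiplesI[OF that, of "int p"] by auto
    have "residue_trace p \<O> (Pow (Suc i)) x (int i * ?t + ?t)"
      by (rule residue_trace_add[OF subspace_Pow subspace_Pow Pow_Suc_subset pW subspace_O Pow_O p_gt_1])
        (use Suc residue_trace_graded_piece[OF _ xO x(2,3)] in auto)
    then show ?case by (simp add: algebra_simps)
  qed
  obtain C where C: "residue_basis p (Pow e) (multiples (int p)) C"
    using ex_residue_basis[OF prime_p subspace_multiples subset_refl subspace_Pow Pow_O] by blast
  \<comment> \<open>The zero matrix describes x here, as P^e times a is p \<O>.\<close>
  have "x * c - int_comb C (\<lambda>c. 0) \<in> multiples (int p)" if "c \<in> C" for c
  proof -
    have "c * x \<in> Pow e \<bullet> a" using residue_basisD(2)[OF C] that x(1) by (intro ideal_multI) auto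
    then show ?thesis by (simp add: Pow_a int_comb_zero mult.commute)
  qed
  then have last: "residue_trace p (Pow e) (multiples (int p)) x 0"
    unfolding residue_trace_def using C by (intro exI[of _ C] exI[of _ "\<lambda>b c. 0"]) simp
  have "residue_trace p \<O> (multiples (int p)) x (int e * ?t + 0)"
    by (rule residue_trace_add[OF subspace_Pow subspace_multiples multiples_Pow _ subspace_O Pow_O p_gt_1 step last])
      (use multiplesI[of _ "int p"] in auto)
  then show ?thesis by simp
qed

end

text \<open>With the exponent e maximal, a cofactor a inside P would itself be divisible by P: from
  P Q = p \<O>, the ideal Q / p inverts P, and a = P (Q a / p) would let P^(e+1) divide p
  \<O>.\<close>

lemma ramification_index_complement:
  obtains a where "ideal a R" "Pow (ramification_index K P p) \<bullet> a = multiples (int p)" "\<not> a \<subseteq> P"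
proof -
  define D where "D e \<longleftrightarrow> (\<exists>a. ideal a R \<and> Pow e \<bullet> a = multiples (int p))" for e
  have "ramification_index K P p = (GREATEST e. D e)"
    unfolding ramification_index_def factor_def PIdl_of_nat D_def by (simp add: eq_commute conj_commute Bex_def)
  moreover have bound: "e \<le> deg" if "D e" for e
    using that exponent_le_deg unfolding D_def by blast
  have "\<O> \<bullet> multiples (int p) = multiples (int p)"
    using monoid.l_one[OF comm_monoid.axioms(1)[OF comm_monoid_ideals], of "multiples (int p)"] ideal_multiples by simp
  then have "D 0" unfolding D_def Pow_0 using ideal_multiples by blast
  then have "D (GREATEST e. D e)" by (rule GreatestI_nat[OF _ bound])
  ultimately have De: "D (ramification_index K P p)" and max: "\<And>e. D e \<Longrightarrow> e \<le> ramification_index K P p"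
    using Greatest_le_nat[of D _ deg] bound by auto
  obtain a where a: "ideal a R" "Pow (ramification_index K P p) \<bullet> a = multiples (int p)"
    using De unfolding D_def by blast
  have "\<not> a \<subseteq> P"
  proof
    assume aP: "a \<subseteq> P"
    obtain Q where Q: "ideal Q R" "P \<bullet> Q = multiples (int p)" using ex_complement .
    have Qa: "ideal (Q \<bullet> a) R" by (rule ideal_ideal_mult[OF Q(1) a(1)])
    \<comment> \<open>The quotient of Q a by p.\<close>
    define a' where "a' = {z \<in> \<O>. of_nat p * z \<in> Q \<bullet> a}"
    have a': "ideal a' R"
      unfolding ideal_iff
    proof (intro conjI ballI)
      show "int_mod.subspace a'"
        by (rule int_mod.subspaceI)
          (use idealD(2)[OF Qa] in \<open>auto simp: a'_def O_zero O_add O_mult O_of_int distrib_left mult.left_commute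
            int_mod.subspace_0 int_mod.subspace_add int_mod.subspace_scale\<close>)
      fix z r assume "z \<in> a'" "r \<in> \<O>"
      then show "r * z \<in> a'"
        using idealD(3)[OF Qa, of "of_nat p * z" r] by (simp add: a'_def O_mult mult.left_commute)
    qed (auto simp: a'_def)
    have scale: "int_mod.subspace ((\<lambda>x. of_nat p * x) ` I)" if I: "int_mod.subspace I" for I
    proof (rule int_mod.subspaceI)
      show "0 \<in> (\<lambda>x. of_nat p * x) ` I" using int_mod.subspace_0[OF I] by force
      show "x + y \<in> (\<lambda>x. of_nat p * x) ` I" if "x \<in> (\<lambda>x. of_nat p * x) ` I" "y \<in> (\<lambda>x. of_nat p * x) ` I" for x y
        using that int_mod.subspace_add[OF I] by (auto simp flip: distrib_left)
      show "of_int k * x \<in> (\<lambda>x. of_nat p * x) ` I" if "x \<in> (\<lambda>x. of_nat p * x) ` I" for k x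
        using that int_mod.subspace_scale[OF I] by (auto simp: mult.left_commute)
    qed
    have cancel: "x \<in> I" if "of_nat p * x \<in> (\<lambda>x. of_nat p * x) ` I" for x :: complex and I
      using that p_nonzero by auto
    have PQa: "P \<bullet> (Q \<bullet> a) = multiples (int p) \<bullet> a"
      using ideal_mult_assoc[OF ideal_P Q(1) a(1)] Q(2) by simp
    have "P \<bullet> a' = a"
    proof
      show "P \<bullet> a' \<subseteq> a"
      proof (rule ideal_mult_subset[OF idealD(2)[OF a(1)]])
        fix x z assume x: "x \<in> P" and z: "z \<in> a'"
        have "multiples (int p) \<bullet> a \<subseteq> (\<lambda>x. of_nat p * x) ` a"
        proof (rule ideal_mult_subset[OF scale[OF idealD(2)[OF a(1)]]])
          fix x y assume "x \<in> multiples (int p)" "y \<in> a"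
          then show "x * y \<in> (\<lambda>x. of_nat p * x) ` a"
            using idealD(3)[OF a(1)] by (auto elim!: multiplesE simp: mult.assoc)
        qed
        moreover have "x * (of_nat p * z) \<in> multiples (int p) \<bullet> a"
          unfolding PQa[symmetric] using ideal_multI[OF x, of "of_nat p * z" "Q \<bullet> a"] z by (simp add: a'_def)
        ultimately have "of_nat p * (x * z) \<in> (\<lambda>x. of_nat p * x) ` a" by (auto simp: mult.left_commute)
        then show "x * z \<in> a" by (rule cancel)
      qed
      show "a \<subseteq> P \<bullet> a'"
      proof
        fix y assume y: "y \<in> a"
        have Pa': "ideal (P \<bullet> a') R" by (rule ideal_ideal_mult[OF ideal_P a'])
        \<comment> \<open>This is where a inside P enters: Q a lies in Q P = p \<O>, so dividing its
          elements by p stays integral.\<close>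
        have Qsub: "Q \<bullet> a \<subseteq> multiples (int p)"
        proof (rule ideal_mult_subset[OF subspace_multiples])
          fix x y assume "x \<in> Q" "y \<in> a"
          then have "y * x \<in> P \<bullet> Q" using aP by (intro ideal_multI) auto
          then show "x * y \<in> multiples (int p)" by (simp add: Q(2) mult.commute)
        qed
        have "P \<bullet> (Q \<bullet> a) \<subseteq> (\<lambda>x. of_nat p * x) ` (P \<bullet> a')"
        proof (rule ideal_mult_subset[OF scale[OF idealD(2)[OF Pa']]])
          fix x w assume x: "x \<in> P" and w: "w \<in> Q \<bullet> a"
          then obtain z where z: "z \<in> \<O>" "w = of_int (int p) * z" using Qsub by (blast elim: multiplesE)
          then have "z \<in> a'" using w by (simp add: a'_def)
          then have "x * z \<in> P \<bullet> a'" by (rule ideal_multI[OF x])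
          then show "x * w \<in> (\<lambda>x. of_nat p * x) ` (P \<bullet> a')" by (auto simp: z(2) mult.left_commute)
        qed
        moreover have "of_int (int p) * 1 * y \<in> multiples (int p) \<bullet> a"
          by (rule ideal_multI[OF multiplesI[OF O_one] y])
        ultimately have "of_nat p * y \<in> (\<lambda>x. of_nat p * x) ` (P \<bullet> a')" unfolding PQa by auto
        then show "y \<in> P \<bullet> a'" by (rule cancel)
      qed
    qed
    then have "Pow (Suc (ramification_index K P p)) \<bullet> a' = multiples (int p)"
      unfolding Pow_Suc ideal_mult_assoc[OF ideal_Pow ideal_P a'] using a(2) by simp
    then have "D (Suc (ramification_index K P p))" unfolding D_def using a' by blast
    from max[OF this] show False by simp
  qed
  then show ?thesis by (rule that[OF a])
qed

text \<open>For s outside P, a single x meets three demands: it is a multiple of s, so p divides its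
  trace; it lies in a; and it is congruent modulo P to an r with nonzero residue trace. The last two
  make its trace e times that residue trace modulo p, which p does not divide.\<close>

lemma tame_trace:
  assumes tame: "\<not> p dvd ramification_index K P p" and s: "s \<in> trace_divisible (int p)"
  shows "s \<in> P"
proof (rule ccontr)
  assume "s \<notin> P"
  let ?e = "ramification_index K P p"
  obtain a where a: "ideal a R" "Pow ?e \<bullet> a = multiples (int p)" "\<not> a \<subseteq> P"
    using ramification_index_complement .
  then obtain \<epsilon> where \<epsilon>: "\<epsilon> \<in> a" "\<epsilon> \<notin> P" by blast
  have O: "s \<in> \<O>" "\<epsilon> \<in> \<O>" using trace_divisible_O[OF s] \<epsilon>(1) idealD(1)[OF a(1)] by auto
  have "s * \<epsilon> \<notin> P" using P_prime O \<open>s \<notin> P\<close> \<epsilon>(2) by blast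
  then obtain w where w: "w \<in> \<O>" "s * \<epsilon> * w - 1 \<in> P" using ex_inverse_mod_P[OF O_mult[OF O]] by blast
  obtain r where r: "r \<in> \<O>" "\<not> int p dvd (\<Sum>b\<in>B. coords (r * b) b)" using residue_trace_nonzero .
  \<comment> \<open>The factor \<epsilon> brings x into a, and w undoes s \<epsilon> modulo P,
    leaving r.\<close>
  define x where "x = s * \<epsilon> * w * r"
  have xa: "x \<in> a"
    unfolding x_def using idealD(3)[OF a(1) \<epsilon>(1), of "s * w * r"] O w(1) r(1) by (simp add: O_mult ac_simps)
  have xr: "x - r \<in> P" using P_mult[OF r(1) w(2)] by (simp add: x_def algebra_simps)
  have xs: "tr x / of_int (int p) \<in> \<int>"
    unfolding x_def using trace_divisibleD[OF s, of "\<epsilon> * w * r"] O w(1) r(1) by (simp add: O_mult mult.assoc)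
  have xO: "x \<in> \<O>" using xa idealD(1)[OF a(1)] by blast
  obtain k where k: "tr x = of_int (int ?e * (\<Sum>b\<in>B. coords (r * b) b) + int p * k)"
    using residue_trace_field_trace[OF prime_p xO residue_trace_multiplicity[OF a(1,2) xa r(1) xr]] .
  obtain l where l: "tr x / of_int (int p) = of_int l" using xs by (elim Ints_cases)
  then have "tr x = of_int (int p * l)" using p_gt_1 by (simp add: field_simps)
  then have "int ?e * (\<Sum>b\<in>B. coords (r * b) b) + int p * k = int p * l" using k by (metis of_int_eq_iff)
  then have "int ?e * (\<Sum>b\<in>B. coords (r * b) b) = int p * (l - k)" by (simp add: algebra_simps)
  then have "int p dvd int ?e * (\<Sum>b\<in>B. coords (r * b) b)" by (metis dvd_triv_left)
  moreover have "Factorial_Ring.prime (int p)" using prime_p by (simp only: prime_nat_int_transfer)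
  ultimately have "int p dvd int ?e" using r(2) by (metis prime_dvd_multD)
  then show False using tame by simp
qed

end

section \<open>Prime ideals containing a given ideal, and divisibility from tame traces\<close>

context num_field
begin

text \<open>A maximal ideal above J is found by minimising the dimension of \<O> / I over the field
  with p elements, since a strictly larger ideal has a strictly smaller dimension. Maximality among
  proper ideals gives primality.\<close>

lemma ex_prime_over:
  assumes p: "Factorial_Ring.prime p" and J: "ideal J R" "1 \<notin> J" "of_nat p \<in> J"
  obtains P where "prime_over K P p" "J \<subseteq> P"
proof -
  have p1: "p > 1" using p prime_gt_1_nat by blast
  define Q where "Q I \<longleftrightarrow> ideal I R \<and> 1 \<notin> I \<and> J \<subseteq> I" for I
  define F where "F I = (LEAST n. \<exists>C. residue_basis p \<O> I C \<and> card C = n)" for I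
  have pI: "multiples (int p) \<subseteq> I" if QI: "Q I" for I
  proof -
    have "z * of_nat p \<in> I" if "z \<in> \<O>" for z
      using QI J(3) idealD(3)[of I "of_nat p" z] that by (auto simp: Q_def)
    then show ?thesis by (simp add: multiples_def image_subset_iff mult.commute)
  qed
  have F: "\<exists>C. residue_basis p \<O> I C \<and> card C = F I" if QI: "Q I" for I
  proof -
    have I: "int_mod.subspace I" using QI idealD(2) by (simp add: Q_def)
    obtain C where "residue_basis p \<O> I C"
      using ex_residue_basis[OF p I pI[OF QI] subspace_O subset_refl] .
    then have "\<exists>n C. residue_basis p \<O> I C \<and> card C = n" by blast
    from LeastI_ex[OF this] show ?thesis unfolding F_def .
  qed
  have "Q J" using J by (simp add: Q_def)
  then obtain P where P: "Q P" and min: "\<And>I. Q I \<Longrightarrow> F P \<le> F I"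
    using ex_has_least_nat[of Q J F] by blast
  have idP: "ideal P R" using P by (simp add: Q_def)
  have maximal: "I = P" if I: "Q I" "P \<subseteq> I" for I
  proof (rule ccontr)
    assume ne: "I \<noteq> P"
    have idI: "ideal I R" using I by (simp add: Q_def)
    obtain C where C: "residue_basis p \<O> I C" "card C = F I" using F[OF I(1)] by blast
    obtain C' where C': "residue_basis p I P C'"
      using ex_residue_basis[OF p idealD(2)[OF idP] pI[OF P] idealD(2,1)[OF idI]] .
    have "C' \<noteq> {}"
    proof
      assume "C' = {}"
      then have "I \<subseteq> P" using residue_basisD(4)[OF C'] by (auto simp: int_comb_def)
      then show False using ne I(2) by blast
    qed
    then have c': "card C' > 0" using residue_basisD(1)[OF C'] by (simp add: card_gt_0_iff)
    have pW: "of_nat p * w \<in> P" if "w \<in> \<O>" for w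
      using pI[OF P] multiplesI[OF that, of "int p"] by auto
    have comp: "C \<inter> C' = {}" "residue_basis p \<O> P (C \<union> C')"
      using residue_basis_compose[OF idealD(2)[OF idI] idealD(2)[OF idP] I(2) pW subspace_O idealD(1)[OF idI] p1 C(1) C'] by blast+
    obtain C0 where C0: "residue_basis p \<O> P C0" "card C0 = F P" using F[OF P] by blast
    have "card (C \<union> C') \<le> card C0"
      by (rule card_residue_independent_le[OF p1 subspace_O idealD(2)[OF idP] pW C0(1)])
        (use comp(2) in \<open>auto simp: residue_basis_def\<close>)
    moreover have "card (C \<union> C') = card C + card C'"
      by (rule card_Un_disjoint[OF residue_basisD(1)[OF C(1)] residue_basisD(1)[OF C'] comp(1)])
    ultimately show False using min[OF I(1)] C(2) C0(2) c' by simp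
  qed
  have "primeideal P R"
  proof (rule primeidealI)
    show "ideal P R" by (rule idP)
    show "cring R" by (rule cring_integer_ring)
    show "carrier R \<noteq> P" using P O_one by (auto simp: Q_def)
    fix x y assume xy: "x \<in> carrier R" "y \<in> carrier R" "x \<otimes>\<^bsub>R\<^esub> y \<in> P"
    show "x \<in> P \<or> y \<in> P"
    proof (rule ccontr)
      assume n: "\<not> (x \<in> P \<or> y \<in> P)"
      have x: "x \<in> \<O>" "y \<in> \<O>" "x * y \<in> P" using xy by simp_all
      \<comment> \<open>The ideal P + x \<O>; by maximality it contains 1, and multiplying 1 = w + z
        x by y puts y into P.\<close>
      define I where "I = {w + z * x | w z. w \<in> P \<and> z \<in> \<O>}"
      have "ideal I R"
        unfolding ideal_iff
      proof (intro conjI ballI)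
        show "I \<subseteq> \<O>" using idealD(1)[OF idP] x by (auto simp: I_def intro!: O_add O_mult)
        show "int_mod.subspace I"
        proof (rule int_mod.subspaceI)
          have "0 = 0 + 0 * x" by simp
          then show "0 \<in> I" unfolding I_def using int_mod.subspace_0[OF idealD(2)[OF idP]] O_zero by blast
        next
          fix u v assume "u \<in> I" "v \<in> I"
          then obtain w z w' z' where "u = w + z * x" "v = w' + z' * x" "w \<in> P" "z \<in> \<O>" "w' \<in> P" "z' \<in> \<O>"
            by (auto simp: I_def)
          then have "u + v = (w + w') + (z + z') * x" "w + w' \<in> P" "z + z' \<in> \<O>"
            by (auto simp: algebra_simps int_mod.subspace_add[OF idealD(2)[OF idP]] O_add)
          then show "u + v \<in> I" unfolding I_def by blast
        next
          fix c u assume "u \<in> I"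
          then obtain w z where "u = w + z * x" "w \<in> P" "z \<in> \<O>" by (auto simp: I_def)
          then have "of_int c * u = of_int c * w + (of_int c * z) * x" "of_int c * w \<in> P" "of_int c * z \<in> \<O>"
            by (auto simp: distrib_left mult.assoc int_mod.subspace_scale[OF idealD(2)[OF idP]] O_mult O_of_int)
          then show "of_int c * u \<in> I" unfolding I_def by blast
        qed
        fix u r assume "u \<in> I" "r \<in> \<O>"
        then obtain w z where "u = w + z * x" "w \<in> P" "z \<in> \<O>" by (auto simp: I_def)
        then have "r * u = r * w + (r * z) * x" "r * w \<in> P" "r * z \<in> \<O>"
          using \<open>r \<in> \<O>\<close> idealD(3)[OF idP] by (auto simp: distrib_left mult.assoc O_mult)
        then show "r * u \<in> I" unfolding I_def by blast
      qed
      moreover have PI: "P \<subseteq> I"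
      proof
        fix w assume "w \<in> P"
        moreover have "w = w + 0 * x" by simp
        ultimately show "w \<in> I" unfolding I_def using O_zero by blast
      qed
      moreover have "x \<in> I"
      proof -
        have "x = 0 + 1 * x" by simp
        then show ?thesis unfolding I_def using int_mod.subspace_0[OF idealD(2)[OF idP]] O_one by blast
      qed
      ultimately have "1 \<in> I" using maximal[of I] P n by (auto simp: Q_def)
      then obtain w z where wz: "1 = w + z * x" "w \<in> P" "z \<in> \<O>" by (auto simp: I_def)
      have "y = y * (w + z * x)" using wz(1) by simp
      also have "\<dots> = y * w + z * (x * y)" by (simp add: algebra_simps)
      also have "\<dots> \<in> P" using wz x idealD(3)[OF idP] int_mod.subspace_add[OF idealD(2)[OF idP]] by blast
      finally show False using n by blast
    qed
  qed
  then have "prime_over K P p"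
    using p P J(3) num_field_axioms by (auto simp: prime_over_def prime_over_axioms_def Q_def)
  then show ?thesis using that P by (simp add: Q_def)
qed

text \<open>P is chosen to contain every z with z y in p \<O>, so p does not divide y locally at P.
  Local comparability then gives s p = y t with s outside P, and Tr(s z) = Tr(y t z) / p is
  divisible by p, against \<open>tame_trace\<close>.\<close>

lemma tame_trace_divisible_square:
  assumes p: "Factorial_Ring.prime p" and tame: "no_wild_ramification K" and y: "y \<in> trace_divisible ((int p)\<^sup>2)"
  shows "y \<in> multiples (int p)"
proof (rule ccontr)
  assume ny: "y \<notin> multiples (int p)"
  have yO: "y \<in> \<O>" using trace_divisible_O[OF y] .
  define J where "J = {z \<in> \<O>. z * y \<in> multiples (int p)}"
  have J: "ideal J R" using ideal_colon[of "{y}" "int p"] by (simp add: J_def)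
  have "1 \<notin> J" using ny by (simp add: J_def)
  moreover have "of_nat p \<in> J" using multiplesI[OF yO, of "int p"] O_of_int[of "int p"] by (simp add: J_def)
  ultimately obtain P where P: "prime_over K P p" "J \<subseteq> P" by (rule ex_prime_over[OF p J])
  interpret prime_over K P p by (rule P(1))
  have tame': "\<not> p dvd ramification_index K P p"
    using tame prime_P prime_p p_P unfolding no_wild_ramification_def by blast
  show False
  proof (rule local_divisibility[OF yO of_nat_p_O])
    fix s z assume s: "s \<in> \<O>" "s \<notin> P" "z \<in> \<O>" "s * y = of_nat p * z"
    then have "s \<in> J" using multiplesI[OF s(3), of "int p"] by (simp add: J_def)
    then show False using s(2) P(2) by blast
  next
    fix s t assume s: "s \<in> \<O>" "s \<notin> P" "t \<in> \<O>" "s * of_nat p = y * t"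
    have "tr (s * z) / of_int (int p) \<in> \<int>" if z: "z \<in> \<O>" for z
    proof -
      have "of_nat p * (s * z) = (s * of_nat p) * z" by (simp only: ac_simps)
      also have "\<dots> = y * (t * z)" by (simp only: s(4) mult.assoc)
      finally have "of_nat p * (s * z) = y * (t * z)" .
      moreover have "tr (of_int (int p) * (s * z)) = of_int (int p) * tr (s * z)"
        by (rule trace_int_scale[OF O_K[OF O_mult[OF s(1) z]]])
      ultimately have "of_int (int p) * tr (s * z) = tr (y * (t * z))" by (simp only: of_int_of_nat_eq)
      then have "tr (s * z) / of_int (int p) = tr (y * (t * z)) / of_int ((int p)\<^sup>2)"
        using p_gt_1 by (simp add: field_simps power2_eq_square)
      then show ?thesis using trace_divisibleD[OF y O_mult[OF s(3) z]] by simp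
    qed
    then have "s \<in> trace_divisible (int p)" using s(1) by (simp add: trace_divisible_def)
    from tame_trace[OF tame' this] s(2) show False by blast
  qed
qed

end

section \<open>Denominators of the trace pairing\<close>

context integral_isometry
begin

text \<open>The multiples x = m \<alpha>_j^* of the dual basis have integral traces against \<O>,
  and p^k x is integral because the discriminant maps the dual lattice into \<O>. Powers of p are
  then removed until p x is reached.\<close>

lemma algebraic_int_tame:
  assumes p: "Factorial_Ring.prime p" and tame: "no_wild_ramification K" and d: "field_disc K = int p ^ k * m"
  shows "algebraic_int (of_int (int p * m) * c)"
proof -
  obtain \<alpha> where \<alpha>: "K.zbasis \<alpha>" using K.ex_zbasis .
  have p0: "p \<noteq> 0" using p prime_gt_0_nat by blast
  show ?thesis
  proof (rule algebraic_int_mult_c[OF \<alpha>])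
    fix j assume j: "j < K.deg"
    define x where "x = of_int m * K.dual_basis \<alpha> j"
    have xK: "x \<in> K" unfolding x_def by (intro K.K_mult K.K_of_int K.dual_basis_K[OF \<alpha>])
    have x0: "of_int (int p ^ k) * x \<in> K.\<O>"
      using K.field_disc_dual_basis_O[OF \<alpha> j] unfolding d x_def by (simp add: mult.assoc)
    have trx: "K.tr (x * z) \<in> \<int>" if z: "z \<in> K.\<O>" for z
    proof -
      obtain n where n: "z = (\<Sum>i<K.deg. of_int (n i) * \<alpha> i)" using K.zbasisD(3)[OF \<alpha> z] by blast
      have "x * z = (\<Sum>i<K.deg. of_rat (of_int (m * n i)) * (K.dual_basis \<alpha> j * \<alpha> i))"
        by (simp add: x_def n sum_distrib_left of_rat_mult ac_simps)
      also have "K.tr \<dots> = (\<Sum>i<K.deg. of_int (m * n i) * K.tr (K.dual_basis \<alpha> j * \<alpha> i))"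
        by (rule K.trace_sum_scale) (use K.zbasisD(2)[OF \<alpha>] K.O_K in \<open>auto intro!: K.K_mult K.dual_basis_K[OF \<alpha>]\<close>)
      also have "\<dots> \<in> \<int>"
        using j by (intro Ints_sum Ints_mult) (auto simp: K.trace_dual_basis[OF \<alpha>])
      finally show ?thesis .
    qed
    \<comment> \<open>For an exponent of at least 2 the traces of p^i x are divisible by p^2, so a
      factor p can be taken out. Exponent 1 is the goal and stops the descent; exponent 0 only needs
      multiplication by p.\<close>
    have descent: "of_int (int p) * x \<in> K.\<O>" if "of_int (int p ^ i) * x \<in> K.\<O>" for i
      using that
    proof (induction i)
      case 0
      then show ?case using K.O_mult[OF K.O_of_int, of x "int p"] by simp
    next
      case (Suc i)
      show ?case
      proof (cases i)
        case 0
        then show ?thesis using Suc by simp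
      next
        case (Suc l)
        define y where "y = of_int (int p ^ Suc i) * x"
        have "y \<in> K.trace_divisible ((int p)\<^sup>2)"
          unfolding K.trace_divisible_def
        proof (intro CollectI conjI ballI)
          show "y \<in> K.\<O>" using Suc.prems by (simp add: y_def)
          fix z assume z: "z \<in> K.\<O>"
          have "y * z = of_int (int p ^ Suc i) * (x * z)" by (simp only: y_def mult.assoc)
          then have "K.tr (y * z) = of_int (int p ^ Suc i) * K.tr (x * z)"
            using K.trace_int_scale[OF K.K_mult[OF xK K.O_K[OF z]]] by (simp only:)
          also have "\<dots> = of_int ((int p)\<^sup>2) * (of_int (int p ^ l) * K.tr (x * z))"
            by (simp add: Suc power2_eq_square)
          finally have "K.tr (y * z) / of_int ((int p)\<^sup>2) = of_int (int p ^ l) * K.tr (x * z)"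
            using p0 by simp
          then show "K.tr (y * z) / of_int ((int p)\<^sup>2) \<in> \<int>" using trx[OF z] by (simp only: Ints_mult Ints_of_int)
        qed
        then have "y \<in> K.multiples (int p)" by (rule K.tame_trace_divisible_square[OF p tame])
        then obtain z where z: "z \<in> K.\<O>" "y = of_int (int p) * z" by (rule K.multiplesE)
        then have "of_int (int p ^ i) * x = z" using p0 by (simp add: y_def mult.assoc)
        then show ?thesis using Suc.IH z(1) by simp
      qed
    qed
    show "of_int (int p * m) * K.dual_basis \<alpha> j \<in> K.\<O>"
      using descent[OF x0] by (simp add: x_def mult.assoc)
  qed
qed

lemma c_in_compositum: "c \<in> compositum K L"
proof -
  have K: "x \<in> compositum K L" if "x \<in> K" for x
    using that unfolding compositum_def by (intro generate_field.incl) blast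
  have L: "x \<in> compositum K L" if "x \<in> L" for x
    using that unfolding compositum_def by (intro generate_field.incl) blast
  have add: "x + y \<in> compositum K L" if "x \<in> compositum K L" "y \<in> compositum K L" for x y
    using generate_field.eng_add[of x complex_ring "K \<union> L" y] that by (simp add: compositum_def)
  have mult: "x * y \<in> compositum K L" if "x \<in> compositum K L" "y \<in> compositum K L" for x y
    using generate_field.eng_mult[of x complex_ring "K \<union> L" y] that by (simp add: compositum_def)
  obtain \<alpha> where \<alpha>: "K.zbasis \<alpha>" using K.ex_zbasis .
  have "(\<Sum>j<n. K.dual_basis \<alpha> j * \<phi> (\<alpha> j)) \<in> compositum K L" if "n \<le> K.deg" for n
    using that
  proof (induction n)
    case 0
    then show ?case using K K.K_zero by simp
  next
    case (Suc n)
    have "K.dual_basis \<alpha> n * \<phi> (\<alpha> n) \<in> compositum K L"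
      using Suc.prems by (intro mult K L K.dual_basis_K[OF \<alpha>] phi_L K.O_K K.zbasisD(2)[OF \<alpha>]) simp
    then show ?case using Suc by (simp add: add)
  qed
  then show ?thesis unfolding c_dual_basis[OF \<alpha>] by blast
qed

text \<open>The discriminant provides a nonzero element of this ideal of integers, and Bezout makes
  the least positive one a generator.\<close>

lemma ex_denominator:
  "\<exists>g::int. g > 0 \<and> algebraic_int (of_int g * c) \<and> (\<forall>m. algebraic_int (of_int m * c) \<longrightarrow> g dvd m)"
proof -
  define Q where "Q g \<longleftrightarrow> g > 0 \<and> algebraic_int (of_int (int g) * c)" for g
  have "algebraic_int (of_int (int (nat \<bar>field_disc K\<bar>)) * c)"
    using algebraic_int_disc_c by (cases "field_disc K \<ge> 0") (auto simp flip: minus_mult_left)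
  then have "Q (nat \<bar>field_disc K\<bar>)" using K.field_disc_nonzero by (simp add: Q_def)
  then obtain g where g: "Q g" and min: "\<And>h. Q h \<Longrightarrow> g \<le> h"
    using ex_has_least_nat[of Q _ "\<lambda>g. g"] by blast
  have "int g dvd m" if m: "algebraic_int (of_int m * c)" for m
  proof -
    obtain x y where xy: "x * int g + y * m = gcd (int g) m" using bezout_int by blast
    have "of_int (gcd (int g) m) * c = of_int x * (of_int (int g) * c) + of_int y * (of_int m * c)"
      unfolding xy[symmetric] by (simp add: algebra_simps)
    also have "algebraic_int \<dots>"
      by (rule algebraic_int_add[OF algebraic_int_mult[OF algebraic_int_of_int] algebraic_int_mult[OF algebraic_int_of_int m]])
        (use g in \<open>simp add: Q_def\<close>)
    finally have int: "algebraic_int (of_int (gcd (int g) m) * c)" .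
    have nat: "int (nat (gcd (int g) m)) = gcd (int g) m" by simp
    have "gcd (int g) m > 0" using g by (simp add: Q_def)
    then have "Q (nat (gcd (int g) m))" using int unfolding Q_def nat by simp
    from min[OF this] have "int g \<le> int (nat (gcd (int g) m))" by (simp only: of_nat_le_iff)
    then have "int g \<le> gcd (int g) m" by (simp only: nat)
    moreover have "gcd (int g) m \<le> int g"
      by (rule zdvd_imp_le) (use g in \<open>simp_all add: Q_def\<close>)
    ultimately have "gcd (int g) m = int g" by (rule antisym[rotated])
    then show ?thesis by (metis gcd_dvd2)
  qed
  then show ?thesis using g by (intro exI[of _ "int g"]) (simp add: Q_def)
qed

end

lemma prod_primes_dvd:
  fixes n :: int
  assumes "finite A" "\<And>p. p \<in> A \<Longrightarrow> Factorial_Ring.prime p \<and> p dvd n"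
  shows "\<Prod>A dvd n"
  using assms
proof (induction A)
  case (insert p A)
  have "Rings.coprime p (\<Prod>A)"
    using insert by (intro prod_coprime_right primes_coprime) auto
  then show ?case using insert by (simp add: divides_mult)
qed simp

text \<open>Every prime occurs at most once in g, so up to sign g is the product of its primes, all
  of which divide n.\<close>

lemma squarefree_dvd_rad:
  fixes g n :: int
  assumes g: "g \<noteq> 0" and n: "n \<noteq> 0" and sq: "\<And>p. Factorial_Ring.prime p \<Longrightarrow> p dvd g \<Longrightarrow> \<not> p\<^sup>2 dvd g \<and> p dvd n"
  shows "g dvd rad n"
proof -
  have "normalize g = (\<Prod>p\<in>prime_factors g. p ^ multiplicity p g)"
    using prod_prime_factors[OF g] by simp
  also have "\<dots> = \<Prod>(prime_factors g)"
  proof (rule prod.cong[OF refl])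
    fix p assume "p \<in> prime_factors g"
    then have p: "Factorial_Ring.prime p" "p dvd g" by auto
    have "multiplicity p g < 2"
      using sq[OF p] by (intro multiplicity_lessI) (use p g in auto)
    moreover have "multiplicity p g \<ge> 1" using p g by (intro multiplicity_geI) auto
    ultimately have "multiplicity p g = 1" by simp
    then show "p ^ multiplicity p g = p" by simp
  qed
  also have "\<dots> dvd \<Prod>(prime_factors n)"
    by (rule prod_dvd_prod_subset) (use sq n in \<open>auto simp: in_prime_factors_iff\<close>)
  finally show ?thesis by (simp add: rad_def)
qed

theorem theorem4p3:
  fixes K L E :: "complex set" and \<phi> :: "complex \<Rightarrow> complex" and c :: complex
  assumes "number_field K" and "number_field L"
    and "trace_isometry K L \<phi>"
    and "\<phi> ` integers_of K = integers_of L"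
    and "E = compositum K L"
    and "c = trace_pairing K (\<lambda>x. x) \<phi>"
  shows "c \<in> E
    \<and> algebraic_int (of_int (disc_s K) * c)
    \<and> (no_wild_ramification K \<longrightarrow> algebraic_int (of_int (rad (disc_s K)) * c))
    \<and> (squarefree (field_disc K) \<longrightarrow> algebraic_int c)"
proof -
  interpret I: integral_isometry K L \<phi>
    using assms by unfold_locales
  have c: "I.c = c" using assms(6) by (simp add: I.c_def)
  let ?d = "field_disc K"
  have d0: "?d \<noteq> 0" by (rule I.K.field_disc_nonzero)
  obtain g :: int where g: "g > 0" "algebraic_int (of_int g * c)" "\<And>m. algebraic_int (of_int m * c) \<Longrightarrow> g dvd m"
    using I.ex_denominator[unfolded c] by blast
  have mult: "algebraic_int (of_int m * c)" if gm: "g dvd m" for m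
  proof -
    obtain k where "m = g * k" using gm by (elim dvdE)
    then have "of_int m * c = of_int k * (of_int g * c)" by simp
    then show ?thesis using g(2) by (simp only: algebraic_int_mult algebraic_int_of_int)
  qed
  have g_d: "g dvd ?d" by (rule g(3)[OF I.algebraic_int_disc_c[unfolded c]])
  \<comment> \<open>As g divides d / p, a factor p of g would make p^2 divide d.\<close>
  have simple: "\<not> p dvd g" if p: "Factorial_Ring.prime p" "p dvd ?d" "\<not> p\<^sup>2 dvd ?d" for p
  proof
    assume "p dvd g"
    moreover have "g dvd ?d div p" by (rule g(3)[OF I.algebraic_int_simple_prime[OF p, unfolded c]])
    ultimately have "p * p dvd p * (?d div p)" by (meson dvd_trans dvd_refl mult_dvd_mono)
    then show False using p by (simp add: power2_eq_square)
  qed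
  define A where "A = {p. Factorial_Ring.prime p \<and> multiplicity p ?d = 1}"
  have A: "Factorial_Ring.prime p \<and> p dvd ?d \<and> \<not> p\<^sup>2 dvd ?d" if "p \<in> A" for p
  proof -
    have p: "Factorial_Ring.prime p" "multiplicity p ?d = 1" using that by (auto simp: A_def)
    then have "\<not> is_unit p" by auto
    then show ?thesis
      using p power_dvd_iff_le_multiplicity[of ?d p 1] power_dvd_iff_le_multiplicity[of ?d p 2] d0 by simp
  qed
  have "A \<subseteq> prime_factors ?d" using A d0 by (auto simp: in_prime_factors_iff)
  \<comment> \<open>Finiteness gives \<open>disc_f\<close> its intended value, since a product over
    an infinite set would be 1 by default.\<close>
  then have finA: "finite A" by (rule finite_subset) simp
  have "disc_f K dvd ?d"
    unfolding disc_f_def A_def[symmetric] by (rule prod_primes_dvd[OF finA]) (use A in blast)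
  then have d: "?d = disc_f K * disc_s K" by (simp add: disc_s_def)
  \<comment> \<open>None of the simple primes divides g, so from d = d_f d_s the divisor g of d
    already divides d_s.\<close>
  have "Rings.coprime g (disc_f K)"
    unfolding disc_f_def A_def[symmetric]
  proof (rule prod_coprime_right)
    fix p assume "p \<in> A"
    then have "Factorial_Ring.prime p" "\<not> p dvd g" using A simple by blast+
    then show "Rings.coprime g p" by (metis prime_imp_coprime coprime_commute)
  qed
  then have g_s: "g dvd disc_s K" using g_d coprime_dvd_mult_right_iff unfolding d by blast
  have s0: "disc_s K \<noteq> 0" using d0 d by auto
  have "algebraic_int (of_int (rad (disc_s K)) * c)" if tame: "no_wild_ramification K"
  proof (rule mult, rule squarefree_dvd_rad)
    fix p assume p: "Factorial_Ring.prime p" "p dvd g"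
    have "\<not> is_unit p" using p(1) by auto
    then obtain m where m: "?d = p ^ multiplicity p ?d * m" "\<not> p dvd m"
      by (rule multiplicity_decompose'[OF d0])
    have p': "Factorial_Ring.prime (nat p)" "int (nat p) = p"
      using p(1) by (simp_all only: prime_int_nat_transfer prime_ge_0_int nat_0_le)
    \<comment> \<open>Here m is d without its full power of p, so p m contains p exactly once, and
      then g contains it at most once.\<close>
    have "g dvd p * m"
      using I.algebraic_int_tame[OF p'(1) tame, of "multiplicity p ?d" m, unfolded p'(2) c, OF m(1)] by (rule g(3))
    have "\<not> p\<^sup>2 dvd g"
    proof
      assume "p\<^sup>2 dvd g"
      from dvd_trans[OF this \<open>g dvd p * m\<close>] have "p * p dvd p * m" by (simp only: power2_eq_square)
      then show False using m(2) p(1) by auto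
    qed
    then show "\<not> p\<^sup>2 dvd g \<and> p dvd disc_s K" using p(2) g_s by auto
  qed (use g(1) s0 in auto)
  moreover have "algebraic_int c" if sq: "squarefree ?d"
  proof -
    \<comment> \<open>A prime of g would divide the squarefree d exactly once, which
      \<open>simple\<close> excludes. Hence g is a unit.\<close>
    have "\<not> p dvd g" if p: "Factorial_Ring.prime p" for p
    proof
      assume pg: "p dvd g"
      then have "p dvd ?d" using g_d by (rule dvd_trans)
      moreover have "\<not> p\<^sup>2 dvd ?d"
      proof
        assume "p\<^sup>2 dvd ?d"
        from squarefreeD[OF sq this] show False using p not_prime_unit by blast
      qed
      ultimately show False using simple[OF p] pg by blast
    qed
    then have "is_unit g" using g(1) prime_divisor_exists[of g] by auto
    then show ?thesis using mult[of 1] by simp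
  qed
  moreover have "c \<in> E" using I.c_in_compositum assms(5) c by simp
  ultimately show ?thesis using mult[OF g_s] by blast
qed

end
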